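(* Let $m,N,d$ be positive integers and let $F_I=0$, $I=1,\dots,m$, be a system of partial differential equations in independent variables $x^1,\dots,x^d$ for an unknown vector function $\boldsymbol{u}=(u^1,\dots,u^N)^T$; put $\mathcal{F}=(F_1,\dots,F_m)^T$. Suppose there exist differential operators in total derivatives $$A_i=A_i^0+\sum_{j=1}^d A_i^j D_{x^j},\quad B_i=B_i^0+\sum_{j=1}^d B_i^j D_{x^j}\ (i=1,2),\quad L=L^0+\sum_{k=1}^d L^kD_{x^k},\quad M=M^0+\sum_{k=1}^d M^kD_{x^k},$$ whose coefficients are local functions, where $A_i^j,B_i^j$ ($i=1,2$, $j=1,\dots,d$) are scalar, $A_i^0,B_i^0$ are $N\times N$ matrices, $L^k$ ($k=0,\dots,d$) are $N\times m$ matrices and $M^k$ ($k=0,\dots,d$) are $m\times N$ matrices, such that the following hold on $\mathrm{Sol}_{\mathcal{F}}$: (i) $[A_1,A_2]=0$; (ii) $[B_1,B_2]=0$; (iii) $A_1B_2-A_2B_1=L\circ\ell_{\mathcal{F}}$; (iv) $\ell_{\mathcal{F}}=M\circ(B_1A_2-B_2A_1)$; (v) there exist $p,q\in\{1,\dots,d\}$, $p\neq q$, such that $D_{x^p}\tilde{\boldsymbol{U}}$ and $D_{x^q}\tilde{\boldsymbol{U}}$ can be expressed from the relations $$A_i(\tilde{\boldsymbol{U}})=B_i(\boldsymbol{U}),\quad i=1,2.$$ Then the relations $A_i(\tilde{\boldsymbol{U}})=B_i(\boldsymbol{U})$, $i=1,2$, define a recursion operator for the system $\mathcal{F}=0$,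 i.e., whenever $\boldsymbol{U}$ is a (possibly nonlocal) symmetry of the system, so is $\tilde{\boldsymbol{U}}$ defined by these relations.
   Context: Jet variables: for a multi-index of nonnegative integers $(i_1,\dots,i_d)$ put $u^\alpha_{i_1\dots i_d}=\partial^{i_1+\cdots+i_d}u^\alpha/\partial(x^1)^{i_1}\cdots\partial(x^d)^{i_d}$, $u^\alpha_{0\cdots0}=u^\alpha$. The $x^i$ and $u^\alpha_{i_1\dots i_d}$ are regarded as independent coordinates on the infinite jet space. A local function is a function of $\vec x=(x^1,\dots,x^d)$, $\boldsymbol{u}$ and finitely many derivatives of $\boldsymbol{u}$. All functions are assumed locally meromorphic in all their arguments. The components $F_I$ are local functions. Total derivatives: $D_{x^j}=\frac{\partial}{\partial x^j}+\sum_{\alpha=1}^N\sum_{i_1,\dots,i_d\ge 0}u^\alpha_{i_1\dots i_{j-1}(i_j+1)i_{j+1}\dots i_d}\frac{\partial}{\partial u^\alpha_{i_1\dots i_d}}$. $\mathrm{Sol}_{\mathcal{F}}$ is the submanifold of the infinite jet space defined by the system $F_I=0$ and all its differential consequences $D_{x^1}^{i_1}\cdots D_{x^d}^{i_d}F_I=0$. All equations (including operator identities and the symmetry condition) are required to hold only on $\mathrm{Sol}_{\mathcal{F}}$, or on a differential covering of it, not on the whole jet space. A differential covering of $\mathrm{Sol}_{\mathcal{F}}$ is obtained by adjoining further coordinates (nonlocal variables) and extending the total derivatives to these so that the extended operators, again denoted $D_{x^j}$, still commute with each other. Linearization: for a local function $f$, $\ell_f=\sum_{\alpha=1}^N\sum_{i_1,\dots,i_d\ge0}\frac{\partial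 f}{\partial u^\alpha_{i_1\dots i_d}}D_{x^1}^{i_1}\cdots D_{x^d}^{i_d}$ (acting on $N$-component vectors $\boldsymbol{U}=(U^1,\dots,U^N)^T$, the $\alpha$-th summand acting on $U^\alpha$), and $\ell_{\mathcal{F}}=(\ell_{F_1},\dots,\ell_{F_m})^T$, an $m\times N$ matrix differential operator. A symmetry is an $N$-component vector function $\boldsymbol{U}$ satisfying $\ell_{\mathcal{F}}(\boldsymbol{U})=0$ on $\mathrm{Sol}_{\mathcal{F}}$; a nonlocal symmetry is a solution $\boldsymbol{U}$ of $\ell_{\mathcal{F}}(\boldsymbol{U})=0$ which may involve nonlocal variables (so the equation holds on a covering). The vector $\tilde{\boldsymbol{U}}$ defined by the relations in (v) is in general defined on a covering, i.e. it may involve additional nonlocal variables. A recursion operator is understood as a Bäcklund auto-transformation of the linearized system $\ell_{\mathcal{F}}(\boldsymbol{G})=0$, i.e. a system of relations between $\boldsymbol{U}$ and $\tilde{\boldsymbol{U}}$ sending solutions $\boldsymbol{U}$ to solutions $\tilde{\boldsymbol{U}}$. *)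

theory Defs
  imports "HOL-Complex_Analysis.Complex_Analysis" "HOL-Library.Groups_Big_Fun" "HOL-Library.FuncSet"
begin

text \<open>
  Coordinates of the infinite jet space: the independent variables and, for a multi-index \<open>J\<close>, the
  jet variables \<open>u\<^sup>\<alpha>\<^sub>J\<close>. The positive integers \<open>d\<close>, \<open>N\<close>, \<open>m\<close> are the cardinalities of the index types
  \<open>'d\<close>, \<open>'n\<close>, \<open>'m\<close>. A point of a space with coordinates \<open>'c\<close> is a function \<open>'c \<Rightarrow> complex\<close>, with the
  product topology: an open set restricts finitely many coordinates only.
\<close>

datatype ('d, 'n) jcoord = Indep 'd | Dep 'n "'d \<Rightarrow> nat"

type_synonym ('d, 'n) jet = "('d, 'n) jcoord \<Rightarrow> complex"

type_synonym ('d, 'n, 'w) cov_point = "('d, 'n) jcoord + 'w \<Rightarrow> complex"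

text \<open>
  Local functions on an open set \<open>\<Omega>\<close>: functions of finitely many coordinates which are continuous and
  holomorphic in each variable, that is, holomorphic in several variables (Osgood). A locally
  meromorphic function is treated through its restriction to open sets on which it has no poles;
  all domains \<open>\<Omega>\<close> below are arbitrary open sets, e.g. complements of polar sets.
\<close>

definition local_fun :: "('c \<Rightarrow> complex) set \<Rightarrow> (('c \<Rightarrow> complex) \<Rightarrow> complex) \<Rightarrow> bool" where
  "local_fun \<Omega> f \<longleftrightarrow>
     (\<exists>C. finite C \<and> (\<forall>y\<in>\<Omega>. \<forall>z\<in>\<Omega>. (\<forall>c\<in>C. y c = z c) \<longrightarrow> f y = f z)) \<and>
     continuous_on \<Omega> f \<and>
     (\<forall>z\<in>\<Omega>. \<forall>c. (\<lambda>t. f (z(c := t))) field_differentiable at (z c))"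

definition partial :: "'c \<Rightarrow> (('c \<Rightarrow> complex) \<Rightarrow> complex) \<Rightarrow> (('c \<Rightarrow> complex) \<Rightarrow> complex)" where
  "partial c f z = deriv (\<lambda>t. f (z(c := t))) (z c)"

text \<open>
  For a local function only finitely many terms of the sums below are nonzero; \<^const>\<open>Sum_any\<close> is
  the sum over the indices with nonzero terms.
\<close>

definition total_deriv ::
  "'d \<Rightarrow> (('d, 'n) jet \<Rightarrow> complex) \<Rightarrow> (('d, 'n) jet \<Rightarrow> complex)" where
  "total_deriv j f z =
     partial (Indep j) f z
     + Sum_any (\<lambda>(\<alpha>, J). z (Dep \<alpha> (J(j := Suc (J j)))) * partial (Dep \<alpha> J) f z)"

text \<open>
  The total derivative extended to additional coordinates indexed by \<open>'w\<close>, where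
  \<open>X j s\<close> is the prescribed derivative of the nonlocal variable \<open>s\<close> with respect to \<open>x\<^sup>j\<close>.
\<close>

definition cov_deriv ::
  "('d \<Rightarrow> 'w \<Rightarrow> ('d, 'n, 'w) cov_point \<Rightarrow> complex) \<Rightarrow>
   'd \<Rightarrow> (('d, 'n, 'w) cov_point \<Rightarrow> complex) \<Rightarrow> (('d, 'n, 'w) cov_point \<Rightarrow> complex)" where
  "cov_deriv X j f z =
     partial (Inl (Indep j)) f z
     + Sum_any (\<lambda>(\<alpha>, J). z (Inl (Dep \<alpha> (J(j := Suc (J j))))) * partial (Inl (Dep \<alpha> J)) f z)
     + Sum_any (\<lambda>s. X j s z * partial (Inr s) f z)"

text \<open>
  \<open>multi_deriv D J\<close> is \<open>D\<^bsub>1\<^esub>\<^bsup>J 1\<^esup> \<circ> \<dots> \<circ> D\<^bsub>d\<^esub>\<^bsup>J d\<^esup>\<close>; the linear order on \<open>'d\<close> fixes the order of the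
  factors, which is irrelevant when the derivatives commute.
\<close>

definition multi_deriv ::
  "('d::{finite,linorder} \<Rightarrow> 'f \<Rightarrow> 'f) \<Rightarrow> ('d \<Rightarrow> nat) \<Rightarrow> 'f \<Rightarrow> 'f" where
  "multi_deriv D J f = foldr (\<lambda>j. D j ^^ J j) (sorted_list_of_set UNIV) f"

text \<open>
  Operators act on vector functions \<open>V :: 'a \<Rightarrow> 'z \<Rightarrow> complex\<close> on a space of points \<open>'z\<close> with total
  derivatives \<open>D\<close>. Their coefficients are functions on the jet space, pulled back along
  \<open>\<pi> :: 'z \<Rightarrow> jet\<close>: one uses \<open>\<pi> = id\<close>, \<open>D = total_deriv\<close> on the jet space and \<open>\<pi> z = z \<circ> Inl\<close>,
  \<open>D = cov_deriv X\<close> on a covering.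
\<close>

definition linearization ::
  "('z \<Rightarrow> ('d::{finite,linorder}, 'n) jet) \<Rightarrow> ('d \<Rightarrow> ('z \<Rightarrow> complex) \<Rightarrow> ('z \<Rightarrow> complex)) \<Rightarrow>
   ('m \<Rightarrow> ('d, 'n) jet \<Rightarrow> complex) \<Rightarrow> ('n \<Rightarrow> 'z \<Rightarrow> complex) \<Rightarrow> ('m \<Rightarrow> 'z \<Rightarrow> complex)" where
  "linearization \<pi> D F V I z =
     Sum_any (\<lambda>(\<alpha>, J). partial (Dep \<alpha> J) (F I) (\<pi> z) * multi_deriv D J (V \<alpha>) z)"

text \<open>
  \<open>(A0, A)\<close> encodes \<open>A0 + (\<Sum>j. A j D\<^sub>j)\<close>: matrix \<open>A0\<close> and scalars \<open>A j\<close> for \<open>scalar_op\<close>, all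
  coefficients matrices for \<open>matrix_op\<close>.
\<close>

type_synonym ('d, 'n) scalar_op =
  "('n \<Rightarrow> 'n \<Rightarrow> ('d, 'n) jet \<Rightarrow> complex) \<times> ('d \<Rightarrow> ('d, 'n) jet \<Rightarrow> complex)"

type_synonym ('d, 'n, 'a, 'b) matrix_op =
  "('a \<Rightarrow> 'b \<Rightarrow> ('d, 'n) jet \<Rightarrow> complex) \<times> ('d \<Rightarrow> 'a \<Rightarrow> 'b \<Rightarrow> ('d, 'n) jet \<Rightarrow> complex)"

definition local_scalar_op :: "('d, 'n) jet set \<Rightarrow> ('d, 'n) scalar_op \<Rightarrow> bool" where
  "local_scalar_op \<Omega> P \<longleftrightarrow>
     (\<forall>\<alpha> \<beta>. local_fun \<Omega> (fst P \<alpha> \<beta>)) \<and> (\<forall>j. local_fun \<Omega> (snd P j))"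

definition local_matrix_op :: "('d, 'n) jet set \<Rightarrow> ('d, 'n, 'a, 'b) matrix_op \<Rightarrow> bool" where
  "local_matrix_op \<Omega> P \<longleftrightarrow>
     (\<forall>a b. local_fun \<Omega> (fst P a b)) \<and> (\<forall>k a b. local_fun \<Omega> (snd P k a b))"

text \<open>\<open>scalar_symbol P z v0 v\<close> is \<open>P(V)\<close> at \<open>z\<close> when \<open>V\<close> and \<open>D\<^sub>j V\<close> take there the values \<open>v0\<close>, \<open>v j\<close>.\<close>

definition scalar_symbol ::
  "('d::finite, 'n::finite) scalar_op \<Rightarrow> ('d, 'n) jet \<Rightarrow>
   ('n \<Rightarrow> complex) \<Rightarrow> ('d \<Rightarrow> 'n \<Rightarrow> complex) \<Rightarrow> ('n \<Rightarrow> complex)" where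
  "scalar_symbol P z v0 v \<alpha> = (\<Sum>\<beta>\<in>UNIV. fst P \<alpha> \<beta> z * v0 \<beta>) + (\<Sum>j\<in>UNIV. snd P j z * v j \<alpha>)"

definition apply_scalar_op ::
  "('z \<Rightarrow> ('d::finite, 'n::finite) jet) \<Rightarrow> ('d \<Rightarrow> ('z \<Rightarrow> complex) \<Rightarrow> ('z \<Rightarrow> complex)) \<Rightarrow>
   ('d, 'n) scalar_op \<Rightarrow> ('n \<Rightarrow> 'z \<Rightarrow> complex) \<Rightarrow> ('n \<Rightarrow> 'z \<Rightarrow> complex)" where
  "apply_scalar_op \<pi> D P V \<alpha> z =
     scalar_symbol P (\<pi> z) (\<lambda>\<beta>. V \<beta> z) (\<lambda>j \<beta>. D j (V \<beta>) z) \<alpha>"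

definition apply_matrix_op ::
  "('z \<Rightarrow> ('d::finite, 'n) jet) \<Rightarrow> ('d \<Rightarrow> ('z \<Rightarrow> complex) \<Rightarrow> ('z \<Rightarrow> complex)) \<Rightarrow>
   ('d, 'n, 'a, 'b::finite) matrix_op \<Rightarrow> ('b \<Rightarrow> 'z \<Rightarrow> complex) \<Rightarrow> ('a \<Rightarrow> 'z \<Rightarrow> complex)" where
  "apply_matrix_op \<pi> D P V a z =
     (\<Sum>b\<in>UNIV. fst P a b (\<pi> z) * V b z)
     + (\<Sum>k\<in>UNIV. \<Sum>b\<in>UNIV. snd P k a b (\<pi> z) * D k (V b) z)"

abbreviation jet_scalar_op ("\<lbrakk>_\<rbrakk>\<^sub>s") where
  "\<lbrakk>P\<rbrakk>\<^sub>s \<equiv> apply_scalar_op id total_deriv P"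

abbreviation jet_matrix_op ("\<lbrakk>_\<rbrakk>\<^sub>m") where
  "\<lbrakk>P\<rbrakk>\<^sub>m \<equiv> apply_matrix_op id total_deriv P"

abbreviation jet_linearization ("\<ell>") where
  "\<ell> F \<equiv> linearization id total_deriv F"

definition op_diff ::
  "(('b \<Rightarrow> 'z \<Rightarrow> complex) \<Rightarrow> 'a \<Rightarrow> 'z \<Rightarrow> complex) \<Rightarrow>
   (('b \<Rightarrow> 'z \<Rightarrow> complex) \<Rightarrow> 'a \<Rightarrow> 'z \<Rightarrow> complex) \<Rightarrow>
   ('b \<Rightarrow> 'z \<Rightarrow> complex) \<Rightarrow> 'a \<Rightarrow> 'z \<Rightarrow> complex" (infixl "\<ominus>\<^sub>o" 50) where
  "(P \<ominus>\<^sub>o Q) V a z = P V a z - Q V a z"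

definition op_zero :: "('b \<Rightarrow> 'z \<Rightarrow> complex) \<Rightarrow> 'a \<Rightarrow> 'z \<Rightarrow> complex" where
  "op_zero V a z = 0"

definition Sol ::
  "('d::{finite,linorder}, 'n) jet set \<Rightarrow> ('m \<Rightarrow> ('d, 'n) jet \<Rightarrow> complex) \<Rightarrow> ('d, 'n) jet set" where
  "Sol \<Omega> F = {z \<in> \<Omega>. \<forall>I J. multi_deriv total_deriv J (F I) z = 0}"

text \<open>
  \<open>Sol \<Omega> F\<close> is regularly cut out by the system and its differential consequences (the
  meaning given to ``submanifold defined by''): each local function vanishing on it is
  locally a finite combination of the differential consequences. This makes the
  total derivatives tangent to \<open>Sol \<Omega> F\<close>.
\<close>

definition regular_system ::
  "('d::{finite,linorder}, 'n) jet set \<Rightarrow> ('m \<Rightarrow> ('d, 'n) jet \<Rightarrow> complex) \<Rightarrow> bool" where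
  "regular_system \<Omega> F \<longleftrightarrow>
     (\<forall>V f. open V \<and> V \<subseteq> \<Omega> \<and> local_fun V f \<and> (\<forall>z \<in> V \<inter> Sol \<Omega> F. f z = 0) \<longrightarrow>
        (\<forall>z \<in> V \<inter> Sol \<Omega> F. \<exists>V' K c. open V' \<and> z \<in> V' \<and> V' \<subseteq> V \<and> finite K \<and>
           (\<forall>k\<in>K. local_fun V' (c k)) \<and>
           (\<forall>y\<in>V'. f y = (\<Sum>(I, J)\<in>K. c (I, J) y * multi_deriv total_deriv J (F I) y))))"

text \<open>Identities of operators on the jet space, holding on the subset \<open>S\<close>.\<close>

definition op_eq_on ::
  "('c \<Rightarrow> complex) set \<Rightarrow> ('c \<Rightarrow> complex) set \<Rightarrow>
   (('b \<Rightarrow> ('c \<Rightarrow> complex) \<Rightarrow> complex) \<Rightarrow> 'a \<Rightarrow> ('c \<Rightarrow> complex) \<Rightarrow> complex) \<Rightarrow>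
   (('b \<Rightarrow> ('c \<Rightarrow> complex) \<Rightarrow> complex) \<Rightarrow> 'a \<Rightarrow> ('c \<Rightarrow> complex) \<Rightarrow> complex) \<Rightarrow> bool" where
  "op_eq_on \<Omega> S P Q \<longleftrightarrow>
     (\<forall>V. (\<forall>b. local_fun \<Omega> (V b)) \<longrightarrow> (\<forall>z\<in>S. \<forall>a. P V a z = Q V a z))"

definition cov_Sol ::
  "('d::{finite,linorder}, 'n) jet set \<Rightarrow> ('m \<Rightarrow> ('d, 'n) jet \<Rightarrow> complex) \<Rightarrow>
   ('d, 'n, 'w) cov_point set \<Rightarrow> ('d, 'n, 'w) cov_point set" where
  "cov_Sol \<Omega> F \<Theta> = {z \<in> \<Theta>. z \<circ> Inl \<in> Sol \<Omega> F}"

text \<open>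
  A differential covering, with coordinate domain \<open>\<Theta>\<close> and nonlocal variables indexed by \<open>'w\<close>.
  Taking \<open>X = 0\<close> and functions not depending on the nonlocal variables one recovers the local setting.
\<close>

definition diff_covering ::
  "('d::{finite,linorder}, 'n) jet set \<Rightarrow> ('m \<Rightarrow> ('d, 'n) jet \<Rightarrow> complex) \<Rightarrow>
   ('d, 'n, 'w) cov_point set \<Rightarrow> ('d \<Rightarrow> 'w \<Rightarrow> ('d, 'n, 'w) cov_point \<Rightarrow> complex) \<Rightarrow> bool" where
  "diff_covering \<Omega> F \<Theta> X \<longleftrightarrow>
     open \<Theta> \<and> (\<forall>z\<in>\<Theta>. z \<circ> Inl \<in> \<Omega>) \<and> (\<forall>j s. local_fun \<Theta> (X j s)) \<and>
     (\<forall>i j f. local_fun \<Theta> f \<longrightarrow> (\<forall>z \<in> cov_Sol \<Omega> F \<Theta>.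
        cov_deriv X i (cov_deriv X j f) z = cov_deriv X j (cov_deriv X i f) z))"

text \<open>\<open>(\<Theta>', X')\<close> is obtained from \<open>(\<Theta>, X)\<close> by adjoining nonlocal variables indexed by \<open>'v\<close>.\<close>

definition cov_forget :: "('d, 'n, 'w + 'v) cov_point \<Rightarrow> ('d, 'n, 'w) cov_point" where
  "cov_forget z = z \<circ> map_sum id Inl"

definition extends_covering ::
  "('d::{finite,linorder}, 'n) jet set \<Rightarrow> ('m \<Rightarrow> ('d, 'n) jet \<Rightarrow> complex) \<Rightarrow>
   ('d, 'n, 'w) cov_point set \<Rightarrow> ('d \<Rightarrow> 'w \<Rightarrow> ('d, 'n, 'w) cov_point \<Rightarrow> complex) \<Rightarrow>
   ('d, 'n, 'w + 'v) cov_point set \<Rightarrow>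
   ('d \<Rightarrow> 'w + 'v \<Rightarrow> ('d, 'n, 'w + 'v) cov_point \<Rightarrow> complex) \<Rightarrow> bool" where
  "extends_covering \<Omega> F \<Theta> X \<Theta>' X' \<longleftrightarrow>
     (\<forall>z\<in>\<Theta>'. cov_forget z \<in> \<Theta>) \<and>
     cov_forget ` cov_Sol \<Omega> F \<Theta>' = cov_Sol \<Omega> F \<Theta> \<and>
     (\<forall>z\<in>\<Theta>'. \<forall>j s. X' j (Inl s) z = X j s (cov_forget z))"

definition nonlocal_symmetry ::
  "('d::{finite,linorder}, 'n) jet set \<Rightarrow> ('m \<Rightarrow> ('d, 'n) jet \<Rightarrow> complex) \<Rightarrow>
   ('d, 'n, 'w) cov_point set \<Rightarrow> ('d \<Rightarrow> 'w \<Rightarrow> ('d, 'n, 'w) cov_point \<Rightarrow> complex) \<Rightarrow>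
   ('n \<Rightarrow> ('d, 'n, 'w) cov_point \<Rightarrow> complex) \<Rightarrow> bool" where
  "nonlocal_symmetry \<Omega> F \<Theta> X U \<longleftrightarrow>
     (\<forall>\<alpha>. local_fun \<Theta> (U \<alpha>)) \<and>
     (\<forall>z \<in> cov_Sol \<Omega> F \<Theta>. \<forall>I. linearization (\<lambda>z. z \<circ> Inl) (cov_deriv X) F U I z = 0)"

text \<open>The relations \<open>A\<^sub>i(U') = B\<^sub>i(U)\<close>, \<open>i = 1, 2\<close>, on a covering.\<close>

definition related ::
  "('d::{finite,linorder}, 'n::finite) jet set \<Rightarrow> ('m \<Rightarrow> ('d, 'n) jet \<Rightarrow> complex) \<Rightarrow>
   ('d, 'n) scalar_op \<Rightarrow> ('d, 'n) scalar_op \<Rightarrow> ('d, 'n) scalar_op \<Rightarrow> ('d, 'n) scalar_op \<Rightarrow>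
   ('d, 'n, 'w) cov_point set \<Rightarrow> ('d \<Rightarrow> 'w \<Rightarrow> ('d, 'n, 'w) cov_point \<Rightarrow> complex) \<Rightarrow>
   ('n \<Rightarrow> ('d, 'n, 'w) cov_point \<Rightarrow> complex) \<Rightarrow>
   ('n \<Rightarrow> ('d, 'n, 'w) cov_point \<Rightarrow> complex) \<Rightarrow> bool" where
  "related \<Omega> F A1 A2 B1 B2 \<Theta> X U U' \<longleftrightarrow>
     (let ap = apply_scalar_op (\<lambda>z. z \<circ> Inl) (cov_deriv X) in
      \<forall>z \<in> cov_Sol \<Omega> F \<Theta>. \<forall>\<alpha>.
        ap A1 U' \<alpha> z = ap B1 U \<alpha> z \<and> ap A2 U' \<alpha> z = ap B2 U \<alpha> z)"

text \<open>
  \<open>D\<^sub>p U'\<close> and \<open>D\<^sub>q U'\<close> can be expressed from the relations: regarding \<open>U'\<close>, \<open>D\<^sub>j U'\<close>, \<open>U\<close>, \<open>D\<^sub>j U\<close>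
  as independent quantities \<open>v0\<close>, \<open>v j\<close>, \<open>u0\<close>, \<open>u j\<close>, the relations give \<open>v p\<close> and \<open>v q\<close> as functions of
  the remaining ones. As the relations are linear, such functions are given by Cramer's rule and
  hence have local coefficients where the determinant does not vanish.
\<close>

definition expressible ::
  "('d::finite, 'n::finite) jet set \<Rightarrow>
   ('d, 'n) scalar_op \<Rightarrow> ('d, 'n) scalar_op \<Rightarrow> ('d, 'n) scalar_op \<Rightarrow> ('d, 'n) scalar_op \<Rightarrow>
   'd \<Rightarrow> 'd \<Rightarrow> bool" where
  "expressible S A1 A2 B1 B2 p q \<longleftrightarrow>
     (\<exists>Gp Gq. \<forall>z\<in>S. \<forall>v0 v u0 u.
        scalar_symbol A1 z v0 v = scalar_symbol B1 z u0 u \<and>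
        scalar_symbol A2 z v0 v = scalar_symbol B2 z u0 u \<longrightarrow>
          v p = Gp z v0 (restrict v (- {p, q})) u0 u \<and>
          v q = Gq z v0 (restrict v (- {p, q})) u0 u)"

text \<open>
  The relations define a recursion operator: every \<open>U'\<close> related to a (nonlocal) symmetry \<open>U\<close> is a
  symmetry, and every symmetry \<open>U\<close> has such a \<open>U'\<close> after adjoining, if necessary, further
  nonlocal variables (indexed like the jet variables, e.g. by the derivatives of the components of
  \<open>U'\<close>). The type argument is the index type of the nonlocal variables; if \<open>U'\<close> is given
  on a larger covering than \<open>U\<close>, the first clause applies to the pullback of \<open>U\<close> to that covering.
\<close>

definition recursion_operator ::
  "'w itself \<Rightarrow> ('d::{finite,linorder}, 'n::finite) jet set \<Rightarrow> ('m \<Rightarrow> ('d, 'n) jet \<Rightarrow> complex) \<Rightarrow>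
   ('d, 'n) scalar_op \<Rightarrow> ('d, 'n) scalar_op \<Rightarrow> ('d, 'n) scalar_op \<Rightarrow> ('d, 'n) scalar_op \<Rightarrow> bool" where
  "recursion_operator (_ :: 'w itself) \<Omega> F A1 A2 B1 B2 \<longleftrightarrow>
     (\<forall>\<Theta> (X :: 'd \<Rightarrow> 'w \<Rightarrow> ('d, 'n, 'w) cov_point \<Rightarrow> complex) U.
        diff_covering \<Omega> F \<Theta> X \<and> nonlocal_symmetry \<Omega> F \<Theta> X U \<longrightarrow>
          (\<forall>U'. (\<forall>\<alpha>. local_fun \<Theta> (U' \<alpha>)) \<and> related \<Omega> F A1 A2 B1 B2 \<Theta> X U U' \<longrightarrow>
             nonlocal_symmetry \<Omega> F \<Theta> X U') \<and>
          (\<exists>\<Theta>' (X' :: 'd \<Rightarrow> 'w + ('n \<times> ('d \<Rightarrow> nat)) \<Rightarrow> _) U'.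
             diff_covering \<Omega> F \<Theta>' X' \<and> extends_covering \<Omega> F \<Theta> X \<Theta>' X' \<and>
             related \<Omega> F A1 A2 B1 B2 \<Theta>' X' (\<lambda>\<alpha>. U \<alpha> \<circ> cov_forget) U' \<and>
             nonlocal_symmetry \<Omega> F \<Theta>' X' U'))"

end

theory Submission
  imports Defs
begin

text \<open>
  If \<open>U'\<close> is related to \<open>U\<close>, then by (iv) \<open>\<ell>\<^sub>F(U') = M(B\<^sub>1 A\<^sub>2 U' - B\<^sub>2 A\<^sub>1 U') = M([B\<^sub>1, B\<^sub>2] U) = 0\<close>, since the
  total derivatives are tangent to the solution manifold. The operator identities, given on the jet
  space, hold on coverings because at a given point a function on a covering has the same derivatives,
  up to any order, as a polynomial in the independent variables.

  For the existence of \<open>U'\<close> adjoin its derivatives in the directions other than \<open>x\<^sup>p\<close>, \<open>x\<^sup>q\<close> as nonlocal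
  variables and solve the relations for \<open>D\<^sub>p U'\<close> and \<open>D\<^sub>q U'\<close> by Cramer's rule. All total derivatives
  commute by construction except for \<open>D\<^sub>p\<close> and \<open>D\<^sub>q\<close>, and there (i) and (iii) give
  \<open>(A\<^sub>1\<^sup>p A\<^sub>2\<^sup>q - A\<^sub>1\<^sup>q A\<^sub>2\<^sup>p) [D\<^sub>p, D\<^sub>q] U' = A\<^sub>1 A\<^sub>2 U' - A\<^sub>2 A\<^sub>1 U' = A\<^sub>1 B\<^sub>2 U - A\<^sub>2 B\<^sub>1 U = L(\<ell>\<^sub>F(U)) = 0\<close>,
  where the determinant does not vanish by (v).
\<close>

section \<open>Local functions and their partial derivatives\<close>

text \<open>Three obstacles shape the proof. \<open>local_fun\<close> provides only continuity and
  holomorphy in each variable separately; that partial derivatives are again local and commute has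
  to be derived from Cauchy's formula. Next, the identities are given only on the solution set,
  which is not open, so they may be differentiated only because the total derivatives are tangent to
  it; \<open>regular_system\<close> yields this on the jet space, and freezing the nonlocal
  variables carries it to coverings. Finally, matching a function on a covering with a polynomial to
  order two or more presupposes commuting total derivatives, and for D_p and D_q on the adjoined
  covering this is the very claim to be proved. There (i) is tested on polynomials that match
  \<open>U'\<close> to first order only, where no order of differentiation can matter; the
  second-order mismatch then becomes a combination of commutators, of which only that of D_p and D_q
  is left. Since (v) controls the determinant on the solution set alone, its zeros elsewhere are cut
  out of the domain of the new covering.\<close>

lemma continuous_on_update_pair:
  "continuous_on UNIV (\<lambda>(z :: 'c \<Rightarrow> complex, t). z(c := t))"
  unfolding case_prod_unfold
proof (rule continuous_on_coordinatewise_then_product)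
  fix i
  show "continuous_on UNIV (\<lambda>x::('c \<Rightarrow> complex) \<times> complex. ((fst x)(c := snd x)) i)"
  proof (cases "i = c")
    case False
    then show ?thesis
      using continuous_on_compose2[OF continuous_on_product_coordinates continuous_on_fst[OF continuous_on_id]]
      by simp
  qed (auto intro!: continuous_intros)
qed

lemma continuous_on_update:
  fixes g :: "'x::topological_space \<Rightarrow> 'c \<Rightarrow> complex"
  assumes "continuous_on S g" "continuous_on S h"
  shows "continuous_on S (\<lambda>x. (g x)(c := h x))"
  using continuous_on_compose2[OF continuous_on_update_pair continuous_on_Pair[OF assms], of c]
  by simp

text \<open>The radius is uniform in \<open>z\<close>, so that a single circle serves in Cauchy's
  formula for all points near \<open>z0\<close>. It comes from a product neighbourhood inside the
  open preimage of \<open>\<Omega>\<close> under the update map.\<close>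

lemma update_box:
  fixes \<Omega> :: "('c \<Rightarrow> complex) set"
  assumes "open \<Omega>" "z0 \<in> \<Omega>"
  obtains W r where "open W" "z0 \<in> W" "W \<subseteq> \<Omega>" "0 < r"
    "\<And>z t. z \<in> W \<Longrightarrow> t \<in> cball (z0 c) r \<Longrightarrow> z(c := t) \<in> \<Omega>"
proof -
  define P where "P = (\<lambda>(z :: 'c \<Rightarrow> complex, t). z(c := t)) -` \<Omega>"
  have "open P"
    unfolding P_def using continuous_on_update_pair assms(1)
    by (rule open_vimage[rotated])
  moreover have "(z0, z0 c) \<in> P"
    using assms by (simp add: P_def)
  ultimately obtain W T where WT: "open W" "open T" "(z0, z0 c) \<in> W \<times> T" "W \<times> T \<subseteq> P"
    by (rule open_prod_elim)
  then obtain r where r: "0 < r" "cball (z0 c) r \<subseteq> T"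
    using open_contains_cball[of T] by auto
  show ?thesis
  proof (rule that[of "W \<inter> \<Omega>" r])
    fix z t
    assume "z \<in> W \<inter> \<Omega>" "t \<in> cball (z0 c) r"
    then have "(z, t) \<in> P"
      using WT(4) r(2) by blast
    then show "z(c := t) \<in> \<Omega>"
      by (simp add: P_def)
  qed (use WT r assms in auto)
qed

lemma open_update_vimage:
  fixes \<Omega> :: "('c \<Rightarrow> complex) set"
  assumes "open \<Omega>"
  shows "open {t. z(c := t) \<in> \<Omega>}"
proof -
  have "open ((\<lambda>t. z(c := t)) -` \<Omega>)"
    by (rule open_vimage[OF assms continuous_on_update[OF continuous_on_const continuous_on_id]])
  then show ?thesis
    by (simp add: vimage_def)
qed

text \<open>Names the set of coordinates that \<open>local_fun\<close> hides under an existential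
  quantifier; with it the sums over all coordinates become sums over an explicit finite set.\<close>

definition determined_by ::
  "('c \<Rightarrow> complex) set \<Rightarrow> 'c set \<Rightarrow> (('c \<Rightarrow> complex) \<Rightarrow> complex) \<Rightarrow> bool" where
  "determined_by \<Omega> C f \<longleftrightarrow> (\<forall>y\<in>\<Omega>. \<forall>z\<in>\<Omega>. (\<forall>c\<in>C. y c = z c) \<longrightarrow> f y = f z)"

lemma determined_byD:
  "determined_by \<Omega> C f \<Longrightarrow> y \<in> \<Omega> \<Longrightarrow> z \<in> \<Omega> \<Longrightarrow> (\<And>c. c \<in> C \<Longrightarrow> y c = z c) \<Longrightarrow> f y = f z"
  unfolding determined_by_def by blast

lemma determined_by_mono:
  "determined_by \<Omega> C f \<Longrightarrow> C \<subseteq> C' \<Longrightarrow> determined_by \<Omega> C' f"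
  unfolding determined_by_def by blast

lemma local_fun_determined:
  assumes "local_fun \<Omega> f"
  obtains C where "finite C" "determined_by \<Omega> C f"
  using assms unfolding local_fun_def determined_by_def by blast

lemma local_funI:
  assumes "finite C" "determined_by \<Omega> C f" "continuous_on \<Omega> f"
    "\<And>z c. z \<in> \<Omega> \<Longrightarrow> (\<lambda>t. f (z(c := t))) field_differentiable at (z c)"
  shows "local_fun \<Omega> f"
  unfolding local_fun_def
  by (intro conjI exI[of _ C] assms(1,3) assms(2)[unfolded determined_by_def] ballI allI)
     (rule assms(4))

lemma local_fun_differentiable:
  "local_fun \<Omega> f \<Longrightarrow> z \<in> \<Omega> \<Longrightarrow> (\<lambda>t. f (z(c := t))) field_differentiable at (z c)"
  by (simp add: local_fun_def)

lemma local_fun_continuous: "local_fun \<Omega> f \<Longrightarrow> continuous_on \<Omega> f"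
  by (simp add: local_fun_def)

lemma local_fun_partial_derivative:
  assumes "local_fun \<Omega> f" "z(c := t) \<in> \<Omega>"
  shows "((\<lambda>t. f (z(c := t))) has_field_derivative partial c f (z(c := t))) (at t)"
proof -
  have "(\<lambda>s. f ((z(c := t))(c := s))) field_differentiable at ((z(c := t)) c)"
    using assms unfolding local_fun_def by blast
  then show ?thesis
    by (simp add: partial_def field_differentiable_derivI)
qed

lemma local_fun_partial_derivative':
  assumes "local_fun \<Omega> f" "z \<in> \<Omega>"
  shows "((\<lambda>t. f (z(c := t))) has_field_derivative partial c f z) (at (z c))"
  using local_fun_partial_derivative[OF assms(1), of z c "z c"] assms(2) by simp

lemma partial_eqI:
  "((\<lambda>t. f (z(c := t))) has_field_derivative D) (at (z c)) \<Longrightarrow> partial c f z = D"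
  unfolding partial_def by (rule DERIV_imp_deriv)

lemma local_fun_holomorphic:
  assumes "local_fun \<Omega> f" "open T" "\<And>t. t \<in> T \<Longrightarrow> z(c := t) \<in> \<Omega>"
  shows "(\<lambda>t. f (z(c := t))) holomorphic_on T"
  using local_fun_partial_derivative[OF assms(1,3)] assms(2)
  by (auto simp: holomorphic_on_open)

section \<open>Cauchy's formula and differentiation under the integral sign\<close>

definition unit_circle :: "real \<Rightarrow> complex" where
  "unit_circle x = exp (2 * of_real pi * \<i> * of_real x)"

lemma norm_unit_circle [simp]: "norm (unit_circle x) = 1"
  by (simp add: unit_circle_def)

lemma unit_circle_nonzero [simp]: "unit_circle x \<noteq> 0"
  by (simp add: unit_circle_def)

lemma continuous_on_unit_circle [continuous_intros]:
  "continuous_on S g \<Longrightarrow> continuous_on S (\<lambda>x. unit_circle (g x))"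
  unfolding unit_circle_def by (intro continuous_intros)

text \<open>Cauchy's formula for the derivative, as an integral over a fixed circle, so that it can be
  differentiated under the integral sign in the remaining variables.\<close>

lemma partial_Cauchy:
  assumes cont: "continuous_on (cball a r) (\<lambda>t. f (z(c := t)))"
    and hol: "(\<lambda>t. f (z(c := t))) holomorphic_on ball a r"
    and w: "z c \<in> ball a r"
  shows "partial c f z = integral (cbox 0 1)
    (\<lambda>x. f (z(c := a + of_real r * unit_circle x)) * (of_real r * unit_circle x) /
          (a + of_real r * unit_circle x - z c)\<^sup>2)"
proof -
  have "partial c f z = 1 / (2 * of_real pi * \<i>) *
      contour_integral (circlepath a r) (\<lambda>u. f (z(c := u)) / (u - z c)\<^sup>2)"
    by (rule partial_eqI, rule Cauchy_derivative_integral_circlepath(2)[OF cont hol w])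
  also have "contour_integral (circlepath a r) (\<lambda>u. f (z(c := u)) / (u - z c)\<^sup>2) =
      integral {0..1} (\<lambda>x. (2 * of_real pi * \<i>) *
       (f (z(c := a + of_real r * unit_circle x)) * (of_real r * unit_circle x) /
          (a + of_real r * unit_circle x - z c)\<^sup>2))"
    unfolding contour_integral_integral
    by (intro integral_cong) (simp add: circlepath vector_derivative_circlepath[unfolded circlepath] unit_circle_def)
  also have "\<dots> = (2 * of_real pi * \<i>) * integral {0..1} (\<lambda>x. 
       (f (z(c := a + of_real r * unit_circle x)) * (of_real r * unit_circle x) /
          (a + of_real r * unit_circle x - z c)\<^sup>2))"
    by (rule integral_mult_right)
  finally show ?thesis
    by simp
qed

lemma circle_avoids_ball:
  assumes "w \<in> ball a r"
  shows "a + of_real r * unit_circle x - w \<noteq> 0"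
proof
  assume "a + of_real r * unit_circle x - w = 0"
  then have "w - a = of_real r * unit_circle x"
    by (simp add: algebra_simps)
  then have "norm (w - a) = \<bar>r\<bar>"
    by (simp add: norm_mult)
  then show False
    using assms by (simp add: dist_norm norm_minus_commute)
qed

lemma circle_in_cball: "0 < r \<Longrightarrow> a + of_real r * unit_circle x \<in> cball a r"
  by (simp add: dist_norm norm_mult)

lemma partial_Cauchy_local:
  assumes f: "local_fun \<Omega> f" and r: "0 < r"
    and z: "\<And>t. t \<in> cball a r \<Longrightarrow> z(c := t) \<in> \<Omega>"
    and w: "z c \<in> ball a r"
  shows "partial c f z = integral (cbox 0 1)
    (\<lambda>x. f (z(c := a + of_real r * unit_circle x)) * (of_real r * unit_circle x) /
          (a + of_real r * unit_circle x - z c)\<^sup>2)"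
proof (rule partial_Cauchy)
  show "continuous_on (cball a r) (\<lambda>t. f (z(c := t)))"
    by (rule continuous_on_compose2[OF local_fun_continuous[OF f] continuous_on_update])
       (use z in auto)
  show "(\<lambda>t. f (z(c := t))) holomorphic_on ball a r"
    by (rule local_fun_holomorphic[OF f]) (use z in auto)
qed (rule w)

text \<open>Near \<open>z0\<close> Cauchy's formula is taken over a circle centred at the fixed
  value \<open>z0 c\<close>, so the path does not move with \<open>z\<close> and the integrand is
  jointly continuous in the point and the parameter. The local statements are then glued.\<close>

lemma continuous_on_partial:
  assumes "open \<Omega>" and f: "local_fun \<Omega> f"
  shows "continuous_on \<Omega> (partial c f)"
proof -
  have "\<exists>W. open W \<and> z0 \<in> W \<and> W \<subseteq> \<Omega> \<and> continuous_on W (partial c f)" if z0: "z0 \<in> \<Omega>" for z0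
  proof -
    obtain W r where W: "open W" "z0 \<in> W" "W \<subseteq> \<Omega>" "0 < r"
      "\<And>z t. z \<in> W \<Longrightarrow> t \<in> cball (z0 c) r \<Longrightarrow> z(c := t) \<in> \<Omega>"
      by (rule update_box[OF assms(1) z0, of c]) (rule that)
    \<comment> \<open>Besides the uniform radius, the pole \<open>z c\<close> has to stay inside the
      fixed circle.\<close>
    define W' where "W' = W \<inter> (\<lambda>z. z c) -` ball (z0 c) r"
    have "open W'"
      unfolding W'_def by (intro open_Int W open_vimage continuous_on_product_coordinates open_ball)
    moreover have "z0 \<in> W'"
      using W by (simp add: W'_def)
    moreover have "continuous_on W' (partial c f)"
    proof -
      have "continuous_on W' (\<lambda>z. integral (cbox 0 1)
        (\<lambda>x. f (z(c := z0 c + of_real r * unit_circle x)) * (of_real r * unit_circle x) /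
            (z0 c + of_real r * unit_circle x - z c)\<^sup>2))"
      proof (rule integral_continuous_on_param, unfold case_prod_unfold)
        show "continuous_on (W' \<times> cbox 0 1) (\<lambda>p.
            f ((fst p)(c := z0 c + of_real r * unit_circle (snd p))) * (of_real r * unit_circle (snd p)) /
            (z0 c + of_real r * unit_circle (snd p) - fst p c)\<^sup>2)"
        proof (intro continuous_intros)
          show "continuous_on (W' \<times> cbox 0 1)
              (\<lambda>p. f ((fst p)(c := z0 c + of_real r * unit_circle (snd p))))"
          proof (rule continuous_on_compose2[OF local_fun_continuous[OF f]])
            have "continuous_on (W' \<times> cbox 0 1) (\<lambda>p. z0 c + of_real r * unit_circle (snd p))"
              by (intro continuous_intros)
            then show "continuous_on (W' \<times> cbox 0 1)
                (\<lambda>p. (fst p)(c := z0 c + of_real r * unit_circle (snd p)))"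
              by (rule continuous_on_update[OF continuous_on_fst[OF continuous_on_id]])
          qed (use W circle_in_cball[OF W(4)] in \<open>auto simp: W'_def simp del: mem_cball\<close>)
          show "continuous_on (W' \<times> cbox 0 (1::real)) (\<lambda>p. fst p c)"
            by (rule continuous_on_compose2[OF continuous_on_product_coordinates
                  continuous_on_fst[OF continuous_on_id]]) auto
          show "\<forall>p\<in>W' \<times> cbox 0 1. (z0 c + of_real r * unit_circle (snd p) - fst p c)\<^sup>2 \<noteq> 0"
            using circle_avoids_ball by (auto simp: W'_def)
        qed
      qed
      moreover have "partial c f z = integral (cbox 0 1)
        (\<lambda>x. f (z(c := z0 c + of_real r * unit_circle x)) * (of_real r * unit_circle x) /
            (z0 c + of_real r * unit_circle x - z c)\<^sup>2)" if "z \<in> W'" for z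
        by (rule partial_Cauchy_local[OF f]) (use that W in \<open>auto simp: W'_def\<close>)
      ultimately show ?thesis
        using continuous_on_eq by force
    qed
    moreover have "W' \<subseteq> \<Omega>"
      using W(3) by (auto simp: W'_def)
    ultimately show ?thesis
      by blast
  qed
  then have "\<Union>{W. open W \<and> W \<subseteq> \<Omega> \<and> continuous_on W (partial c f)} = \<Omega>"
    by blast
  moreover have "continuous_on (\<Union>{W. open W \<and> W \<subseteq> \<Omega> \<and> continuous_on W (partial c f)}) (partial c f)"
    by (rule continuous_on_open_Union) auto
  ultimately show ?thesis
    by simp
qed

text \<open>Leibniz' rule applied to Cauchy's formula. The integral obtained is Cauchy's formula for
  \<open>partial c (partial c' f)\<close>; the radius is returned so that this can be recognised
  later.\<close>

lemma partial_differentiate_integral: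
  assumes "open \<Omega>" and f: "local_fun \<Omega> f" and z: "z \<in> \<Omega>" and "c \<noteq> c'"
  obtains r where "0 < r" "\<And>t. t \<in> cball (z c) r \<Longrightarrow> z(c := t) \<in> \<Omega>"
    "((\<lambda>s. partial c f (z(c' := s))) has_field_derivative
      integral (cbox 0 1)
    (\<lambda>x. partial c' f (z(c := z c + of_real r * unit_circle x)) * (of_real r * unit_circle x) /
          (z c + of_real r * unit_circle x - z c)\<^sup>2)) (at (z c'))"
proof -
  obtain W r where W: "open W" "z \<in> W" "W \<subseteq> \<Omega>" "0 < r"
    "\<And>y t. y \<in> W \<Longrightarrow> t \<in> cball (z c) r \<Longrightarrow> y(c := t) \<in> \<Omega>"
    by (rule update_box[OF assms(1) z, of c]) (rule that)
  have "open {s. z(c' := s) \<in> W}"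
    using W(1) by (rule open_update_vimage)
  moreover have "z c' \<in> {s. z(c' := s) \<in> W}"
    using W by simp
  ultimately obtain e where e: "e > 0" "ball (z c') e \<subseteq> {s. z(c' := s) \<in> W}"
    by (meson open_contains_ball)
  \<comment> \<open>As \<open>c\<close> and \<open>c'\<close> differ, moving \<open>c'\<close>
    leaves the pole \<open>z c\<close> in place, and only the factor \<open>f\<close> depends on
    \<open>s\<close>.\<close>
  define g where "g s x = f (z(c' := s, c := z c + of_real r * unit_circle x)) *
    (of_real r * unit_circle x) / (z c + of_real r * unit_circle x - z c)\<^sup>2" for s x
  define g' where "g' s x = partial c' f (z(c' := s, c := z c + of_real r * unit_circle x)) *
    (of_real r * unit_circle x) / (z c + of_real r * unit_circle x - z c)\<^sup>2" for s x
  have in\<Omega>: "z(c' := s, c := z c + of_real r * unit_circle x) \<in> \<Omega>" if "s \<in> ball (z c') e" for s x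
    using e W(5) that circle_in_cball[OF W(4)] by blast
  have nz: "(z c + of_real r * unit_circle x - z c)\<^sup>2 \<noteq> 0" for x
    using W(4) by simp
  have 1: "((\<lambda>s. g s x) has_field_derivative g' s x) (at s within ball (z c') e)"
    if "s \<in> ball (z c') e" for s x
  proof -
    let ?y = "z(c := z c + of_real r * unit_circle x)"
    have swap: "z(c' := s, c := t) = z(c := t, c' := s)" for s t
      using assms(4) by (simp add: fun_upd_twist)
    have "((\<lambda>t. f (?y(c' := t))) has_field_derivative partial c' f (?y(c' := s))) (at s)"
      by (rule local_fun_partial_derivative[OF f]) (use in\<Omega>[OF that] in \<open>simp add: swap\<close>)
    then show ?thesis
      unfolding g_def g'_def swap
      by (intro DERIV_cdivide DERIV_cmult_right) (rule has_field_derivative_at_within)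
  qed
  have contg: "continuous_on (ball (z c') e \<times> cbox 0 1) (\<lambda>(s, x). h (z(c' := s, c := z c + of_real r * unit_circle x)) *
    (of_real r * unit_circle x) / (z c + of_real r * unit_circle x - z c)\<^sup>2)"
    if "continuous_on \<Omega> h" for h
    unfolding case_prod_unfold
    by (intro continuous_intros continuous_on_compose2[OF that]
        continuous_on_update) (use in\<Omega> nz in \<open>auto simp: W(4)\<close>)
  have 2: "g s integrable_on cbox 0 1" if "s \<in> ball (z c') e" for s
  proof (rule integrable_continuous)
    have "continuous_on (cbox 0 1) (\<lambda>x. case (s, x) of (s, x) \<Rightarrow> g s x)"
      unfolding g_def
      by (rule continuous_on_compose2[OF contg[OF local_fun_continuous[OF f]]])
         (use that in \<open>auto intro!: continuous_intros\<close>)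
    then show "continuous_on (cbox 0 1) (g s)"
      by simp
  qed
  have 3: "continuous_on (ball (z c') e \<times> cbox 0 1) (\<lambda>(s, x). g' s x)"
    unfolding g'_def by (rule contg[OF continuous_on_partial[OF assms(1) f]])
  have "((\<lambda>s. integral (cbox 0 1) (g s)) has_field_derivative integral (cbox 0 1) (g' (z c')))
      (at (z c') within ball (z c') e)"
    by (rule leibniz_rule_field_derivative[OF 1 2 3]) (use e in auto)
  then have der: "((\<lambda>s. integral (cbox 0 1) (g s)) has_field_derivative integral (cbox 0 1) (g' (z c')))
      (at (z c'))"
    using at_within_open[of "z c'" "ball (z c') e"] e by simp
  have "integral (cbox 0 1) (g s) = partial c f (z(c' := s))" if "s \<in> ball (z c') e" for s
  proof -
    have "z(c' := s) \<in> W"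
      using that e by auto
    then show ?thesis
      unfolding g_def using assms(4) W
      by (subst partial_Cauchy_local[OF f W(4), where a = "z c"]) auto
  qed
  have "((\<lambda>s. partial c f (z(c' := s))) has_field_derivative integral (cbox 0 1) (g' (z c')))
      (at (z c'))"
  proof -
    have "eventually (\<lambda>s. s \<in> ball (z c') e) (nhds (z c'))"
      by (rule eventually_nhds_in_open) (use e(1) in auto)
    then have "eventually (\<lambda>s. integral (cbox 0 1) (g s) = partial c f (z(c' := s))) (nhds (z c'))"
      by eventually_elim fact
    from DERIV_cong_ev[OF refl this refl] show ?thesis
      using der by simp
  qed
  then show ?thesis
    using that[of r] W unfolding g'_def by simp
qed

lemma partial_update_eq:
  assumes "open \<Omega>" "z \<in> \<Omega>" "\<And>y. y \<in> \<Omega> \<Longrightarrow> f y = g y"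
  shows "partial c f z = partial c g z"
proof -
  have "eventually (\<lambda>t. t \<in> {t. z(c := t) \<in> \<Omega>}) (nhds (z c))"
    by (rule eventually_nhds_in_open[OF open_update_vimage[OF assms(1)]]) (use assms in simp)
  then show ?thesis
    unfolding partial_def by (intro deriv_cong_ev refl) (auto elim!: eventually_mono simp: assms(3))
qed

lemma determined_by_partial:
  assumes "open \<Omega>" "determined_by \<Omega> C f"
  shows "determined_by \<Omega> C (partial c f)"
  unfolding determined_by_def
proof (intro ballI impI)
  fix y z assume yz: "y \<in> \<Omega>" "z \<in> \<Omega>" "\<forall>c\<in>C. y c = z c"
  have ev: "eventually (\<lambda>t. t \<in> {t. y(c := t) \<in> \<Omega>}) (nhds (y c))" if "y \<in> \<Omega>" for y
    by (rule eventually_nhds_in_open[OF open_update_vimage[OF assms(1)]]) (use that in simp)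
  show "partial c f y = partial c f z"
  proof (cases "c \<in> C")
    case True
    then have "y c = z c"
      using yz by simp
    have "eventually (\<lambda>t. f (y(c := t)) = f (z(c := t))) (nhds (y c))"
      using ev[OF yz(1)] ev[OF yz(2)] unfolding \<open>y c = z c\<close>
      by eventually_elim (use yz in \<open>auto intro!: determined_byD[OF assms(2)]\<close>)
    then show ?thesis
      unfolding partial_def by (intro deriv_cong_ev \<open>y c = z c\<close>)
  next
    case False
    have "partial c f y = 0" if "y \<in> \<Omega>" for y
    proof -
      have "eventually (\<lambda>t. f (y(c := t)) = f y) (nhds (y c))"
        using ev[OF that] by eventually_elim (use that False in \<open>auto intro!: determined_byD[OF assms(2)]\<close>)
      then show ?thesis
        unfolding partial_def by (subst deriv_cong_ev[where g = "\<lambda>_. f y"]) auto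
    qed
    then show ?thesis
      using yz by simp
  qed
qed

lemma partial_determined_zero:
  assumes "open \<Omega>" "determined_by \<Omega> C f" "c \<notin> C" "z \<in> \<Omega>"
  shows "partial c f z = 0"
proof -
  have "eventually (\<lambda>t. t \<in> {t. z(c := t) \<in> \<Omega>}) (nhds (z c))"
    by (rule eventually_nhds_in_open[OF open_update_vimage[OF assms(1)]]) (use assms in simp)
  then have "eventually (\<lambda>t. f (z(c := t)) = f z) (nhds (z c))"
    by eventually_elim (use assms in \<open>auto intro!: determined_byD[OF assms(2)]\<close>)
  then show ?thesis
    unfolding partial_def by (subst deriv_cong_ev[where g = "\<lambda>_. f z"]) auto
qed

text \<open>In its own direction \<open>partial c f\<close> is a one-variable complex derivative and
  hence holomorphic; in any other direction Cauchy's integral is differentiated under the integral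
  sign. This closure is what allows total derivatives to be iterated.\<close>

lemma local_fun_partial:
  assumes "open \<Omega>" and f: "local_fun \<Omega> f"
  shows "local_fun \<Omega> (partial c f)"
proof -
  obtain C where C: "finite C" "determined_by \<Omega> C f"
    using local_fun_determined[OF f] .
  show ?thesis
  proof (rule local_funI)
    show "finite C" "determined_by \<Omega> C (partial c f)"
      using C determined_by_partial[OF assms(1)] by auto
    show "continuous_on \<Omega> (partial c f)"
      by (rule continuous_on_partial[OF assms])
    fix z :: "'a \<Rightarrow> complex" and c' assume z: "z \<in> \<Omega>"
    show "(\<lambda>t. partial c f (z(c' := t))) field_differentiable at (z c')"
    proof (cases "c = c'")
      case True
      have hol: "(\<lambda>t. f (z(c := t))) holomorphic_on {t. z(c := t) \<in> \<Omega>}"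
        by (rule local_fun_holomorphic[OF f open_update_vimage[OF assms(1)]]) auto
      have "(\<lambda>t. partial c f (z(c := t))) = deriv (\<lambda>t. f (z(c := t)))"
        by (simp add: partial_def fun_eq_iff)
      then have "(\<lambda>t. partial c f (z(c := t))) holomorphic_on {t. z(c := t) \<in> \<Omega>}"
        using holomorphic_deriv[OF hol open_update_vimage[OF assms(1)]] by simp
      then show ?thesis
        using open_update_vimage[OF assms(1)] z True
        by (auto simp: holomorphic_on_open field_differentiable_def)
    next
      case False
      show ?thesis
        by (rule partial_differentiate_integral[OF assms z False]) (unfold field_differentiable_def, rule exI)
    qed
  qed
qed

text \<open>Differentiating Cauchy's integral for \<open>partial c f\<close> along \<open>c'\<close>
  yields Cauchy's integral, over the same circle, for the derivative along \<open>c\<close> of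
  \<open>partial c' f\<close>.\<close>

lemma partial_commute:
  assumes "open \<Omega>" and f: "local_fun \<Omega> f" and z: "z \<in> \<Omega>"
  shows "partial c (partial c' f) z = partial c' (partial c f) z"
proof (cases "c = c'")
  case False
  obtain r where r: "0 < r" "\<And>t. t \<in> cball (z c) r \<Longrightarrow> z(c := t) \<in> \<Omega>"
    "((\<lambda>s. partial c f (z(c' := s))) has_field_derivative
      integral (cbox 0 1)
    (\<lambda>x. partial c' f (z(c := z c + of_real r * unit_circle x)) * (of_real r * unit_circle x) /
          (z c + of_real r * unit_circle x - z c)\<^sup>2)) (at (z c'))"
    by (rule partial_differentiate_integral[OF assms False]) (rule that)
  then show ?thesis
    using partial_Cauchy_local[OF local_fun_partial[OF assms(1) f] r(1,2)]
      partial_eqI[OF r(3)] by simp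
qed simp

section \<open>Derivations given by vector fields\<close>

lemma determined_byI:
  "(\<And>y z. y \<in> \<Omega> \<Longrightarrow> z \<in> \<Omega> \<Longrightarrow> (\<And>c. c \<in> C \<Longrightarrow> y c = z c) \<Longrightarrow> f y = f z) \<Longrightarrow> determined_by \<Omega> C f"
  unfolding determined_by_def by blast

lemma determined_by_combine:
  assumes "determined_by \<Omega> C f" "determined_by \<Omega> C' g" "C \<subseteq> C''" "C' \<subseteq> C''"
  shows "determined_by \<Omega> C'' (\<lambda>z. h (f z) (g z))"
proof (rule determined_byI)
  fix y z assume yz: "y \<in> \<Omega>" "z \<in> \<Omega>" "\<And>c. c \<in> C'' \<Longrightarrow> y c = z c"
  have "f y = f z" "g y = g z"
    using assms(3,4) yz by (auto intro: determined_byD[OF assms(1)] determined_byD[OF assms(2)])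
  then show "h (f y) (g y) = h (f z) (g z)"
    by simp
qed

lemma local_fun_eq_on:
  assumes "open \<Omega>" "local_fun \<Omega> f" "\<And>z. z \<in> \<Omega> \<Longrightarrow> f z = g z"
  shows "local_fun \<Omega> g"
proof -
  obtain C where C: "finite C" "determined_by \<Omega> C f"
    using local_fun_determined[OF assms(2)] .
  show ?thesis
  proof (rule local_funI)
    show "determined_by \<Omega> C g"
    proof (rule determined_byI)
      fix y z assume "y \<in> \<Omega>" "z \<in> \<Omega>" "\<And>c. c \<in> C \<Longrightarrow> y c = z c"
      then have "f y = f z"
        by (rule determined_byD[OF C(2)])
      then show "g y = g z"
        using assms(3) \<open>y \<in> \<Omega>\<close> \<open>z \<in> \<Omega>\<close> by simp
    qed
    show "continuous_on \<Omega> g"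
      using local_fun_continuous[OF assms(2)] assms(3) by (rule continuous_on_eq)
    fix z :: "'a \<Rightarrow> complex" and c assume z: "z \<in> \<Omega>"
    have "((\<lambda>t. g (z(c := t))) has_field_derivative partial c f z) (at (z c))"
      by (rule has_field_derivative_transform_within_open[OF
            local_fun_partial_derivative'[OF assms(2) z] open_update_vimage[OF assms(1)]])
         (use z assms(3) in auto)
    then show "(\<lambda>t. g (z(c := t))) field_differentiable at (z c)"
      unfolding field_differentiable_def by blast
  qed (rule C)
qed

lemma local_fun_subset:
  assumes "local_fun \<Omega> f" "\<Omega>' \<subseteq> \<Omega>"
  shows "local_fun \<Omega>' f"
proof -
  obtain C where C: "finite C" "determined_by \<Omega> C f"
    using local_fun_determined[OF assms(1)] .
  show ?thesis
  proof (rule local_funI)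
    show "determined_by \<Omega>' C f"
      using assms(2) by (intro determined_byI determined_byD[OF C(2)]) auto
  qed (use C assms in \<open>auto intro: local_fun_differentiable continuous_on_subset[OF local_fun_continuous]\<close>)
qed

section \<open>Closure of local functions under arithmetic\<close>

lemma local_fun_const: "local_fun \<Omega> (\<lambda>_. a)"
  by (rule local_funI[of "{}"]) (auto simp: determined_by_def)

lemma local_fun_coordinate: "local_fun \<Omega> (\<lambda>z. z c)"
proof (rule local_funI[of "{c}"])
  show "continuous_on \<Omega> (\<lambda>z. z c)"
    by (rule continuous_on_subset[OF continuous_on_product_coordinates]) simp
  fix z :: "'a \<Rightarrow> complex" and c'
  show "(\<lambda>t. (z(c' := t)) c) field_differentiable at (z c')"
    by (cases "c = c'") auto
qed (auto simp: determined_by_def)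

lemma local_fun_add:
  assumes "local_fun \<Omega> f" "local_fun \<Omega> g"
  shows "local_fun \<Omega> (\<lambda>z. f z + g z)"
proof -
  obtain C C' where C: "finite C" "determined_by \<Omega> C f" "finite C'" "determined_by \<Omega> C' g"
    by (rule local_fun_determined[OF assms(1)], rule local_fun_determined[OF assms(2)]) (rule that)
  show ?thesis
  proof (rule local_funI[of "C \<union> C'"])
    show "determined_by \<Omega> (C \<union> C') (\<lambda>z. f z + g z)"
      by (rule determined_by_combine[OF C(2,4)]) auto
    show "continuous_on \<Omega> (\<lambda>z. f z + g z)"
      by (intro continuous_on_add local_fun_continuous assms)
    fix z c assume "z \<in> \<Omega>"
    then show "(\<lambda>t. f (z(c := t)) + g (z(c := t))) field_differentiable at (z c)"
      by (intro field_differentiable_add local_fun_differentiable[OF assms(1)]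
          local_fun_differentiable[OF assms(2)])
  qed (use C in auto)
qed

lemma local_fun_mult:
  assumes "local_fun \<Omega> f" "local_fun \<Omega> g"
  shows "local_fun \<Omega> (\<lambda>z. f z * g z)"
proof -
  obtain C C' where C: "finite C" "determined_by \<Omega> C f" "finite C'" "determined_by \<Omega> C' g"
    by (rule local_fun_determined[OF assms(1)], rule local_fun_determined[OF assms(2)]) (rule that)
  show ?thesis
  proof (rule local_funI[of "C \<union> C'"])
    show "determined_by \<Omega> (C \<union> C') (\<lambda>z. f z * g z)"
      by (rule determined_by_combine[OF C(2,4)]) auto
    show "continuous_on \<Omega> (\<lambda>z. f z * g z)"
      by (intro continuous_on_mult local_fun_continuous assms)
    fix z c assume "z \<in> \<Omega>"
    then show "(\<lambda>t. f (z(c := t)) * g (z(c := t))) field_differentiable at (z c)"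
      by (intro field_differentiable_mult local_fun_differentiable[OF assms(1)]
          local_fun_differentiable[OF assms(2)])
  qed (use C in auto)
qed

lemma local_fun_inverse:
  assumes "local_fun \<Omega> f" "\<And>z. z \<in> \<Omega> \<Longrightarrow> f z \<noteq> 0"
  shows "local_fun \<Omega> (\<lambda>z. inverse (f z))"
proof -
  obtain C where C: "finite C" "determined_by \<Omega> C f"
    using local_fun_determined[OF assms(1)] .
  show ?thesis
  proof (rule local_funI)
    show "determined_by \<Omega> C (\<lambda>z. inverse (f z))"
      by (rule determined_by_combine[OF C(2,2)]) auto
    show "continuous_on \<Omega> (\<lambda>z. inverse (f z))"
      by (intro continuous_on_inverse local_fun_continuous assms ballI)
    fix z c assume "z \<in> \<Omega>"
    then show "(\<lambda>t. inverse (f (z(c := t)))) field_differentiable at (z c)"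
      using assms(2) by (intro field_differentiable_inverse local_fun_differentiable[OF assms(1)]) simp_all
  qed (rule C)
qed

lemma local_fun_uminus: "local_fun \<Omega> f \<Longrightarrow> local_fun \<Omega> (\<lambda>z. - f z)"
  using local_fun_mult[OF local_fun_const[of \<Omega> "-1"], of f] by simp

lemma local_fun_diff: "local_fun \<Omega> f \<Longrightarrow> local_fun \<Omega> g \<Longrightarrow> local_fun \<Omega> (\<lambda>z. f z - g z)"
  using local_fun_add[OF _ local_fun_uminus, of \<Omega> f g] by simp

lemma local_fun_divide:
  "local_fun \<Omega> f \<Longrightarrow> local_fun \<Omega> g \<Longrightarrow> (\<And>z. z \<in> \<Omega> \<Longrightarrow> g z \<noteq> 0) \<Longrightarrow> local_fun \<Omega> (\<lambda>z. f z / g z)"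
  using local_fun_mult[OF _ local_fun_inverse, of \<Omega> f g] by (simp add: divide_inverse)

lemma local_fun_sum:
  "(\<And>i. i \<in> A \<Longrightarrow> local_fun \<Omega> (f i)) \<Longrightarrow> local_fun \<Omega> (\<lambda>z. \<Sum>i\<in>A. f i z)"
  by (induction A rule: infinite_finite_induct) (auto intro: local_fun_const local_fun_add)

lemmas local_fun_intros =
  local_fun_const local_fun_coordinate local_fun_add local_fun_mult local_fun_diff local_fun_sum

section \<open>Pullback along an injection of coordinates\<close>

lemma continuous_on_precompose: "continuous_on S (\<lambda>z :: 'c \<Rightarrow> complex. z \<circ> \<iota>)"
  unfolding o_def
  by (rule continuous_on_coordinatewise_then_product)
     (rule continuous_on_subset[OF continuous_on_product_coordinates subset_UNIV])

lemma update_precompose: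
  "inj \<iota> \<Longrightarrow> z(\<iota> c := t) \<circ> \<iota> = (z \<circ> \<iota>)(c := t)"
  by (auto simp: fun_eq_iff inj_def)

lemma update_precompose_other:
  "c \<notin> range \<iota> \<Longrightarrow> z(c := t) \<circ> \<iota> = z \<circ> \<iota>"
  by (auto simp: fun_eq_iff)

lemma local_fun_pullback:
  assumes "local_fun \<Omega> f" "inj \<iota>" "\<And>z. z \<in> \<Theta> \<Longrightarrow> z \<circ> \<iota> \<in> \<Omega>"
  shows "local_fun \<Theta> (\<lambda>z. f (z \<circ> \<iota>))"
proof -
  obtain C where C: "finite C" "determined_by \<Omega> C f"
    using local_fun_determined[OF assms(1)] .
  show ?thesis
  proof (rule local_funI[of "\<iota> ` C"])
    show "determined_by \<Theta> (\<iota> ` C) (\<lambda>z. f (z \<circ> \<iota>))"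
          proof (rule determined_byI)
      fix y z assume "y \<in> \<Theta>" "z \<in> \<Theta>" "\<And>c. c \<in> \<iota> ` C \<Longrightarrow> y c = z c"
      then show "f (y \<circ> \<iota>) = f (z \<circ> \<iota>)"
        using assms(3) by (intro determined_byD[OF C(2)]) auto
    qed
    show "continuous_on \<Theta> (\<lambda>z. f (z \<circ> \<iota>))"
      by (rule continuous_on_compose2[OF local_fun_continuous[OF assms(1)] continuous_on_precompose])
         (use assms(3) in auto)
    fix z c assume z: "z \<in> \<Theta>"
    show "(\<lambda>t. f (z(c := t) \<circ> \<iota>)) field_differentiable at (z c)"
    proof (cases "c \<in> range \<iota>")
      case True
      then obtain c' where "c = \<iota> c'" by blast
      then show ?thesis
        using local_fun_differentiable[OF assms(1) assms(3)[OF z], of c']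
        by (simp add: update_precompose[OF assms(2)])
    next
      case False
      then show ?thesis
        by (simp add: update_precompose_other)
    qed
  qed (use C in auto)
qed

lemma partial_pullback:
  "inj \<iota> \<Longrightarrow> partial (\<iota> c) (\<lambda>z. f (z \<circ> \<iota>)) z = partial c f (z \<circ> \<iota>)"
  by (simp add: partial_def update_precompose)

lemma partial_const [simp]: "partial c (\<lambda>_. a) z = 0"
  by (simp add: partial_def)

lemma partial_coordinate: "partial c (\<lambda>z. z c') z = (if c = c' then 1 else 0)"
  by (simp add: partial_def)

lemma partial_add:
  assumes "local_fun \<Omega> f" "local_fun \<Omega> g" "z \<in> \<Omega>"
  shows "partial c (\<lambda>z. f z + g z) z = partial c f z + partial c g z"
  by (rule partial_eqI, intro DERIV_add local_fun_partial_derivative'[OF assms(1,3)]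
      local_fun_partial_derivative'[OF assms(2,3)])

lemma partial_mult:
  assumes "local_fun \<Omega> f" "local_fun \<Omega> g" "z \<in> \<Omega>"
  shows "partial c (\<lambda>z. f z * g z) z = partial c f z * g z + f z * partial c g z"
  using DERIV_mult[OF local_fun_partial_derivative'[OF assms(1,3), of c]
      local_fun_partial_derivative'[OF assms(2,3), of c]]
  by (intro partial_eqI) (simp add: algebra_simps)

definition vector_field ::
  "('c \<Rightarrow> ('c \<Rightarrow> complex) \<Rightarrow> complex) \<Rightarrow> (('c \<Rightarrow> complex) \<Rightarrow> complex) \<Rightarrow> ('c \<Rightarrow> complex) \<Rightarrow> complex" where
  "vector_field \<xi> f z = Sum_any (\<lambda>c. \<xi> c z * partial c f z)"

lemma vector_field_determined:
  assumes "open \<Omega>" "determined_by \<Omega> C f" "finite C" "z \<in> \<Omega>"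
  shows "vector_field \<xi> f z = (\<Sum>c\<in>C. \<xi> c z * partial c f z)"
  unfolding vector_field_def
  using partial_determined_zero[OF assms(1,2) _ assms(4)] assms(3)
  by (intro Sum_any.expand_superset) auto

text \<open>A common frame for \<open>total_deriv\<close> and \<open>cov_deriv\<close>. Their sums,
  split by kind of coordinate, merge into the single sum of \<open>vector_field\<close> because a
  local function has finitely many nonzero partial derivatives; hence the restriction to local
  functions and to points of the domain.\<close>

locale derivations =
  fixes \<Theta> :: "('c \<Rightarrow> complex) set"
    and \<xi> :: "'d \<Rightarrow> 'c \<Rightarrow> ('c \<Rightarrow> complex) \<Rightarrow> complex"
    and D :: "'d \<Rightarrow> (('c \<Rightarrow> complex) \<Rightarrow> complex) \<Rightarrow> ('c \<Rightarrow> complex) \<Rightarrow> complex"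
  assumes open_domain: "open \<Theta>"
    and local_coeff: "local_fun \<Theta> (\<xi> j c)"
    and D_vector_field: "local_fun \<Theta> f \<Longrightarrow> z \<in> \<Theta> \<Longrightarrow> D j f z = vector_field (\<xi> j) f z"
begin

lemma D_determined:
  assumes "local_fun \<Theta> f" "determined_by \<Theta> C f" "finite C" "z \<in> \<Theta>"
  shows "D j f z = (\<Sum>c\<in>C. \<xi> j c z * partial c f z)"
  by (simp add: D_vector_field[OF assms(1,4)] vector_field_determined[OF open_domain assms(2-4)])

lemma D_local:
  assumes "local_fun \<Theta> f"
  shows "local_fun \<Theta> (D j f)"
proof -
  obtain C where C: "finite C" "determined_by \<Theta> C f"
    using local_fun_determined[OF assms] .
  show ?thesis
    by (rule local_fun_eq_on[OF open_domain _ D_determined[OF assms C(2,1), symmetric]])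
       (intro local_fun_intros local_coeff local_fun_partial open_domain assms)
qed

lemma D_cong:
  assumes "local_fun \<Theta> f" "\<And>y. y \<in> \<Theta> \<Longrightarrow> f y = g y" "z \<in> \<Theta>"
  shows "D j f z = D j g z"
  using partial_update_eq[OF open_domain assms(3) assms(2)] local_fun_eq_on[OF open_domain assms(1,2)] assms
  by (simp add: D_vector_field vector_field_def)

lemma D_const: "z \<in> \<Theta> \<Longrightarrow> D j (\<lambda>_. a) z = 0"
  by (simp add: D_vector_field[OF local_fun_const] vector_field_def)

lemma D_coordinate:
  assumes "z \<in> \<Theta>"
  shows "D j (\<lambda>z. z c) z = \<xi> j c z"
  by (subst D_determined[of _ "{c}"])
     (use assms in \<open>auto simp: local_fun_coordinate determined_by_def partial_coordinate\<close>)

lemma common_determined: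
  assumes "local_fun \<Theta> f" "local_fun \<Theta> g"
  obtains C where "finite C" "determined_by \<Theta> C f" "determined_by \<Theta> C g"
proof -
  obtain C C' where C: "finite C" "determined_by \<Theta> C f" "finite C'" "determined_by \<Theta> C' g"
    by (rule local_fun_determined[OF assms(1)], rule local_fun_determined[OF assms(2)]) (rule that)
  then show ?thesis
    using that[of "C \<union> C'"] determined_by_mono[of \<Theta> _ _ "C \<union> C'"] by simp
qed

lemma D_add:
  assumes "local_fun \<Theta> f" "local_fun \<Theta> g" "z \<in> \<Theta>"
  shows "D j (\<lambda>z. f z + g z) z = D j f z + D j g z"
proof -
  obtain C where C: "finite C" "determined_by \<Theta> C f" "determined_by \<Theta> C g"
    using common_determined[OF assms(1,2)] .
  moreover have "determined_by \<Theta> C (\<lambda>z. f z + g z)"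
    by (rule determined_by_combine[OF C(2,3)]) auto
  ultimately show ?thesis
    using assms by (simp add: D_determined[of _ C] local_fun_add partial_add[OF assms] sum.distrib
        algebra_simps)
qed

lemma D_mult:
  assumes "local_fun \<Theta> f" "local_fun \<Theta> g" "z \<in> \<Theta>"
  shows "D j (\<lambda>z. f z * g z) z = D j f z * g z + f z * D j g z"
proof -
  obtain C where C: "finite C" "determined_by \<Theta> C f" "determined_by \<Theta> C g"
    using common_determined[OF assms(1,2)] .
  moreover have "determined_by \<Theta> C (\<lambda>z. f z * g z)"
    by (rule determined_by_combine[OF C(2,3)]) auto
  ultimately show ?thesis
    using assms by (simp add: D_determined[of _ C] local_fun_mult partial_mult[OF assms] sum.distrib
        algebra_simps sum_distrib_left)
qed

lemma D_sum:
  assumes "finite A" "\<And>i. i \<in> A \<Longrightarrow> local_fun \<Theta> (f i)" "z \<in> \<Theta>"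
  shows "D j (\<lambda>z. \<Sum>i\<in>A. f i z) z = (\<Sum>i\<in>A. D j (f i) z)"
  using assms(1,2)
proof (induction A rule: finite_induct)
  case empty
  then show ?case using D_const[OF assms(3)] by simp
next
  case (insert a A)
  then show ?case
    using D_add[of "f a" "\<lambda>z. \<Sum>i\<in>A. f i z" z j] assms(3) by (simp add: local_fun_sum)
qed

lemma D_cmult: "local_fun \<Theta> f \<Longrightarrow> z \<in> \<Theta> \<Longrightarrow> D j (\<lambda>z. a * f z) z = a * D j f z"
  using D_mult[OF local_fun_const, of f z j a] D_const[of z j a] by simp

lemma D_diff:
  assumes "local_fun \<Theta> f" "local_fun \<Theta> g" "z \<in> \<Theta>"
  shows "D j (\<lambda>z. f z - g z) z = D j f z - D j g z"
  using D_add[OF assms(1) local_fun_mult[OF local_fun_const[of \<Theta> "-1"] assms(2)] assms(3), of j]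
    D_cmult[OF assms(2,3), of j "-1"] by simp

text \<open>The second-order terms cancel in a commutator of vector fields, which is therefore determined by
  its values on the coordinates.\<close>

lemma D_commute:
  assumes f: "local_fun \<Theta> f" and z: "z \<in> \<Theta>"
    and coord: "\<And>c. D i (\<xi> j c) z = D j (\<xi> i c) z"
  shows "D i (D j f) z = D j (D i f) z"
proof -
  obtain C where C: "finite C" "determined_by \<Theta> C f"
    using local_fun_determined[OF f] .
  have det: "determined_by \<Theta> C (partial c f)" for c
    by (rule determined_by_partial[OF open_domain C(2)])
  have loc: "local_fun \<Theta> (partial c f)" for c
    by (rule local_fun_partial[OF open_domain f])
  have expand: "D i (D j f) z = (\<Sum>c\<in>C. D i (\<xi> j c) z * partial c f z)
      + (\<Sum>c\<in>C. \<Sum>c'\<in>C. \<xi> j c z * (\<xi> i c' z * partial c' (partial c f) z))" for i j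
  proof -
    have "D i (D j f) z = D i (\<lambda>z. \<Sum>c\<in>C. \<xi> j c z * partial c f z) z"
      by (rule D_cong[OF D_local[OF f] _ z]) (rule D_determined[OF f C(2,1)])
    also have "\<dots> = (\<Sum>c\<in>C. D i (\<xi> j c) z * partial c f z + \<xi> j c z * D i (partial c f) z)"
      using C(1) z loc
      by (subst D_sum) (auto intro!: local_fun_intros local_coeff sum.cong D_mult)
    finally show ?thesis
      using C(1) z loc det
      by (simp add: sum.distrib D_determined[of _ C] sum_distrib_left)
  qed
  have "(\<Sum>c\<in>C. \<Sum>c'\<in>C. \<xi> j c z * (\<xi> i c' z * partial c' (partial c f) z)) =
      (\<Sum>c\<in>C. \<Sum>c'\<in>C. \<xi> i c z * (\<xi> j c' z * partial c' (partial c f) z))"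
    by (subst sum.swap, intro sum.cong refl)
       (simp add: partial_commute[OF open_domain f z] mult_ac)
  then show ?thesis
    unfolding expand[of i j] expand[of j i] by (simp add: coord)
qed

lemma foldr_D_local: "local_fun \<Theta> f \<Longrightarrow> local_fun \<Theta> (foldr D js f)"
  by (induction js) (auto intro: D_local)

end

text \<open>\<open>S\<close> is usually not open, so equality on \<open>S\<close> says nothing by
  itself about derivatives transverse to it. Tangency is what allows identities known on
  \<open>S\<close> only to be differentiated.\<close>

locale tangent_derivations = derivations \<Theta> \<xi> D
  for \<Theta> :: "('c \<Rightarrow> complex) set" and \<xi> :: "'d \<Rightarrow> _" and D +
  fixes S :: "('c \<Rightarrow> complex) set"
  assumes S_subset: "S \<subseteq> \<Theta>"
    and tangent: "local_fun \<Theta> f \<Longrightarrow> (\<And>z. z \<in> S \<Longrightarrow> f z = 0) \<Longrightarrow> z \<in> S \<Longrightarrow> D j f z = 0"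
begin

lemma D_cong_S:
  assumes "local_fun \<Theta> f" "local_fun \<Theta> g" "\<And>y. y \<in> S \<Longrightarrow> f y = g y" "z \<in> S"
  shows "D j f z = D j g z"
proof -
  have "D j (\<lambda>z. f z - g z) z = 0"
    by (rule tangent) (use assms in \<open>auto intro: local_fun_diff\<close>)
  then show ?thesis
    using D_diff[OF assms(1,2)] S_subset assms(4) by auto
qed

lemma foldr_D_cong_S:
  assumes "local_fun \<Theta> f" "local_fun \<Theta> g" "\<And>y. y \<in> S \<Longrightarrow> f y = g y" "z \<in> S"
  shows "foldr D js f z = foldr D js g z"
  using assms(4)
proof (induction js arbitrary: z)
  case (Cons j js)
  then show ?case
    using D_cong_S[OF foldr_D_local[OF assms(1)] foldr_D_local[OF assms(2)] Cons.IH] by simp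
qed (use assms in simp)

text \<open>Stated for one pair of directions, because on the adjoined covering commutation is
  established pair by pair, earlier pairs being used for later ones.\<close>

definition commuting :: "'d \<Rightarrow> 'd \<Rightarrow> bool" where
  "commuting i j \<longleftrightarrow> (\<forall>f z. local_fun \<Theta> f \<longrightarrow> z \<in> S \<longrightarrow> D i (D j f) z = D j (D i f) z)"

lemma commuting_foldr:
  assumes "\<And>j. j \<in> set js \<Longrightarrow> commuting k j" "local_fun \<Theta> f" "z \<in> S"
  shows "D k (foldr D js f) z = foldr D js (D k f) z"
  using assms(1,3)
proof (induction js arbitrary: z)
  case (Cons j js)
  have "D k (D j (foldr D js f)) z = D j (D k (foldr D js f)) z"
    using Cons.prems foldr_D_local[OF assms(2)] unfolding commuting_def by simp
  also have "\<dots> = D j (foldr D js (D k f)) z"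
    by (rule D_cong_S) (use Cons assms(2) in \<open>auto intro: D_local foldr_D_local\<close>)
  finally show ?case by simp
qed simp

text \<open>The first letter of one word is moved to the front of the other. Commutation is asked
  only of the letters that occur, so that words without \<open>p\<close> and \<open>q\<close> can be
  reordered while the commutator of D_p and D_q is still open.\<close>

lemma foldr_D_permute:
  assumes "mset is = mset js" "\<And>i j. i \<in> set is \<Longrightarrow> j \<in> set is \<Longrightarrow> commuting i j"
    "local_fun \<Theta> f" "z \<in> S"
  shows "foldr D is f z = foldr D js f z"
  using assms
proof (induction "is" arbitrary: js z)
  case (Cons i "is")
  have "i \<in> set js"
    using Cons.prems(1) by (metis list.set_intros(1) set_mset_mset)
  then obtain ys zs where js: "js = ys @ i # zs"
    using split_list by metis
  have sub: "set ys \<union> set zs \<subseteq> set (i # is)"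
    using mset_eq_setD[OF Cons.prems(1)] js by auto
  have perm: "mset is = mset (ys @ zs)"
    using Cons.prems(1) js by simp
  have "foldr D js f z = foldr D ys (D i (foldr D zs f)) z"
    using js by simp
  also have "\<dots> = D i (foldr D ys (foldr D zs f)) z"
    using Cons.prems sub by (intro commuting_foldr[symmetric] foldr_D_local) auto
  also have "\<dots> = D i (foldr D is f) z"
    using Cons.IH[OF perm] Cons.prems by (intro D_cong_S foldr_D_local) auto
  finally show ?case by simp
qed simp

end

text \<open>The pulled-back function depends only on coordinates in the image of
  \<open>\<iota>\<close>, and on these the two vector fields have the same coefficients: the upper
  field projects to the lower one.\<close>

lemma derivations_pullback:
  assumes "derivations \<Theta> \<xi> D" "derivations \<Theta>' \<xi>' D'" "inj \<iota>"
    and dom: "\<And>z. z \<in> \<Theta>' \<Longrightarrow> z \<circ> \<iota> \<in> \<Theta>"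
    and coeff: "\<And>z c. z \<in> \<Theta>' \<Longrightarrow> \<xi>' j (\<iota> c) z = \<xi> j c (z \<circ> \<iota>)"
    and f: "local_fun \<Theta> f" and z: "z \<in> \<Theta>'"
  shows "D' j (\<lambda>z. f (z \<circ> \<iota>)) z = D j f (z \<circ> \<iota>)"
proof -
  interpret A: derivations \<Theta> \<xi> D by fact
  interpret B: derivations \<Theta>' \<xi>' D' by fact
  obtain C where C: "finite C" "determined_by \<Theta> C f"
    using local_fun_determined[OF f] .
  have det: "determined_by \<Theta>' (\<iota> ` C) (\<lambda>z. f (z \<circ> \<iota>))"
  proof (rule determined_byI)
    fix y z assume "y \<in> \<Theta>'" "z \<in> \<Theta>'" "\<And>c. c \<in> \<iota> ` C \<Longrightarrow> y c = z c"
    then show "f (y \<circ> \<iota>) = f (z \<circ> \<iota>)"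
      using dom by (intro determined_byD[OF C(2)]) auto
  qed
  have "inj_on \<iota> C"
    using assms(3) by (rule inj_on_subset) simp
  then show ?thesis
    using B.D_determined[OF local_fun_pullback[OF f assms(3) dom] det finite_imageI[OF C(1)] z]
      A.D_determined[OF f C(2,1) dom[OF z]]
    by (simp add: sum.reindex partial_pullback[OF assms(3)] coeff[OF z])
qed

section \<open>Total derivatives on the jet space and on coverings\<close>

definition jet_coeff :: "'d \<Rightarrow> ('d, 'n) jcoord \<Rightarrow> ('d, 'n) jet \<Rightarrow> complex" where
  "jet_coeff j c z = (case c of Indep i \<Rightarrow> if i = j then 1 else 0
     | Dep \<alpha> J \<Rightarrow> z (Dep \<alpha> (J(j := Suc (J j)))))"

definition cov_coeff ::
  "('d \<Rightarrow> 'w \<Rightarrow> ('d, 'n, 'w) cov_point \<Rightarrow> complex) \<Rightarrow> 'd \<Rightarrow> ('d, 'n) jcoord + 'w \<Rightarrow>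
   ('d, 'n, 'w) cov_point \<Rightarrow> complex" where
  "cov_coeff X j c z = (case c of Inl c \<Rightarrow> jet_coeff j c (z \<circ> Inl) | Inr s \<Rightarrow> X j s z)"

lemma jet_coeff_simps [simp]:
  "jet_coeff j (Indep i) = (\<lambda>_. if i = j then 1 else 0)"
  "jet_coeff j (Dep \<alpha> J) = (\<lambda>z. z (Dep \<alpha> (J(j := Suc (J j)))))"
  by (auto simp: jet_coeff_def fun_eq_iff)

lemma cov_coeff_simps [simp]:
  "cov_coeff X j (Inl c) = (\<lambda>z. jet_coeff j c (z \<circ> Inl))"
  "cov_coeff X j (Inr s) = X j s"
  by (auto simp: cov_coeff_def fun_eq_iff)

lemma inj_Dep: "inj (\<lambda>(\<alpha>, J). Dep \<alpha> J)"
  by (auto simp: inj_def)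

lemma inj_Inl_Dep: "inj (\<lambda>(\<alpha>, J). Inl (Dep \<alpha> J))"
  by (auto simp: inj_def)

lemma local_fun_jet_coeff: "local_fun \<Omega> (jet_coeff j c)"
  by (cases c) (auto intro: local_fun_const local_fun_coordinate)

lemma derivations_total_deriv:
  assumes "open \<Omega>"
  shows "derivations \<Omega> jet_coeff total_deriv"
proof
  fix f :: "('a, 'b) jet \<Rightarrow> complex" and z j
  assume f: "local_fun \<Omega> f" and z: "z \<in> \<Omega>"
  obtain C where C: "finite C" "determined_by \<Omega> C f"
    using local_fun_determined[OF f] .
  define P where "P = (\<lambda>(\<alpha>, J). Dep \<alpha> J) -` C"
  have P: "finite P"
    unfolding P_def by (rule finite_vimageI[OF C(1) inj_Dep])
  have zero: "partial c f z = 0" if "c \<notin> C" for c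
    by (rule partial_determined_zero[OF assms C(2) that z])
  have "Sum_any (\<lambda>c. jet_coeff j c z * partial c f z) =
      (\<Sum>c\<in>insert (Indep j) ((\<lambda>(\<alpha>, J). Dep \<alpha> J) ` P). jet_coeff j c z * partial c f z)"
  proof (rule Sum_any.expand_superset)
    show "{c. jet_coeff j c z * partial c f z \<noteq> 0} \<subseteq> insert (Indep j) ((\<lambda>(\<alpha>, J). Dep \<alpha> J) ` P)"
    proof
      fix c assume "c \<in> {c. jet_coeff j c z * partial c f z \<noteq> 0}"
      then have "jet_coeff j c z \<noteq> 0" "c \<in> C"
        using zero by auto
      then show "c \<in> insert (Indep j) ((\<lambda>(\<alpha>, J). Dep \<alpha> J) ` P)"
        by (cases c) (auto simp: P_def split: if_splits)
    qed
  qed (use P in simp)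
  also have "\<dots> = partial (Indep j) f z
      + (\<Sum>(\<alpha>, J)\<in>P. z (Dep \<alpha> (J(j := Suc (J j)))) * partial (Dep \<alpha> J) f z)"
    using P by (subst sum.insert)
      (auto simp: sum.reindex[OF inj_on_subset[OF inj_Dep subset_UNIV]] intro!: sum.cong)
  also have "(\<Sum>(\<alpha>, J)\<in>P. z (Dep \<alpha> (J(j := Suc (J j)))) * partial (Dep \<alpha> J) f z) =
      Sum_any (\<lambda>(\<alpha>, J). z (Dep \<alpha> (J(j := Suc (J j)))) * partial (Dep \<alpha> J) f z)"
  proof (rule Sum_any.expand_superset[symmetric, OF P], rule subsetI)
    fix p assume "p \<in> {p. (case p of (\<alpha>, J) \<Rightarrow> z (Dep \<alpha> (J(j := Suc (J j)))) * partial (Dep \<alpha> J) f z) \<noteq> 0}"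
    then show "p \<in> P"
      using zero by (cases p) (auto simp: P_def)
  qed
  finally show "total_deriv j f z = vector_field (jet_coeff j) f z"
    by (simp add: total_deriv_def vector_field_def)
qed (use assms local_fun_jet_coeff in auto)

lemma derivations_cov_deriv:
  fixes \<Theta> :: "('d, 'n, 'w) cov_point set"
  assumes "open \<Theta>" "\<And>j s. local_fun \<Theta> (X j s)"
  shows "derivations \<Theta> (cov_coeff X) (cov_deriv X)"
proof
  fix f :: "('d, 'n, 'w) cov_point \<Rightarrow> complex" and z j
  assume f: "local_fun \<Theta> f" and z: "z \<in> \<Theta>"
  obtain C where C: "finite C" "determined_by \<Theta> C f"
    using local_fun_determined[OF f] .
  define P where "P = (\<lambda>(\<alpha>, J). Inl (Dep \<alpha> J)) -` C"
  define Q where "Q = Inr -` C"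
  have P: "finite P" and Q: "finite Q"
    unfolding P_def Q_def by (auto intro: finite_vimageI[OF C(1)] inj_Inl_Dep)
  have zero: "partial c f z = 0" if "c \<notin> C" for c
    by (rule partial_determined_zero[OF assms(1) C(2) that z])
  let ?A = "insert (Inl (Indep j)) ((\<lambda>(\<alpha>, J). Inl (Dep \<alpha> J)) ` P)"
  have "Sum_any (\<lambda>c. cov_coeff X j c z * partial c f z) =
      (\<Sum>c\<in>?A \<union> Inr ` Q. cov_coeff X j c z * partial c f z)"
  proof (rule Sum_any.expand_superset)
    show "{c. cov_coeff X j c z * partial c f z \<noteq> 0} \<subseteq> ?A \<union> Inr ` Q"
    proof
      fix c assume "c \<in> {c. cov_coeff X j c z * partial c f z \<noteq> 0}"
      then have nz: "cov_coeff X j c z \<noteq> 0" "c \<in> C"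
        using zero by auto
      show "c \<in> ?A \<union> Inr ` Q"
      proof (cases c)
        case (Inl c')
        then show ?thesis
          using nz by (cases c') (auto simp: P_def split: if_splits)
      next
        case (Inr s)
        then show ?thesis
          using nz by (auto simp: Q_def)
      qed
    qed
  qed (use P Q in simp)
  also have "\<dots> = (\<Sum>c\<in>?A. cov_coeff X j c z * partial c f z)
      + (\<Sum>s\<in>Q. X j s z * partial (Inr s) f z)"
    using P Q by (subst sum.union_disjoint) (auto simp: sum.reindex)
  also have "(\<Sum>c\<in>?A. cov_coeff X j c z * partial c f z) = partial (Inl (Indep j)) f z
      + (\<Sum>(\<alpha>, J)\<in>P. z (Inl (Dep \<alpha> (J(j := Suc (J j))))) * partial (Inl (Dep \<alpha> J)) f z)"
    using P by (subst sum.insert)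
      (auto simp: sum.reindex[OF inj_on_subset[OF inj_Inl_Dep subset_UNIV]] intro!: sum.cong)
  also have "(\<Sum>(\<alpha>, J)\<in>P. z (Inl (Dep \<alpha> (J(j := Suc (J j))))) * partial (Inl (Dep \<alpha> J)) f z) =
      Sum_any (\<lambda>(\<alpha>, J). z (Inl (Dep \<alpha> (J(j := Suc (J j))))) * partial (Inl (Dep \<alpha> J)) f z)"
  proof (rule Sum_any.expand_superset[symmetric, OF P], rule subsetI)
    fix p assume "p \<in> {p. (case p of (\<alpha>, J) \<Rightarrow> z (Inl (Dep \<alpha> (J(j := Suc (J j))))) * partial (Inl (Dep \<alpha> J)) f z) \<noteq> 0}"
    then show "p \<in> P"
      using zero by (cases p) (auto simp: P_def)
  qed
  also have "(\<Sum>s\<in>Q. X j s z * partial (Inr s) f z) = Sum_any (\<lambda>s. X j s z * partial (Inr s) f z)"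
    by (rule Sum_any.expand_superset[symmetric, OF Q]) (use zero in \<open>auto simp: Q_def\<close>)
  finally show "cov_deriv X j f z = vector_field (cov_coeff X j) f z"
    unfolding cov_deriv_def vector_field_def by (rule sym)
next
  fix j and c :: "('d, 'n) jcoord + 'w"
  show "local_fun \<Theta> (cov_coeff X j c)"
    by (cases c) (auto intro!: assms local_fun_pullback[OF local_fun_jet_coeff[of UNIV]])
qed (rule assms(1))

text \<open>On an open domain equality is inherited by derivatives, so the choice
  \<open>S = \<Theta>\<close> is tangent; it gives access to the reordering lemmas on the jet space
  itself.\<close>

lemma tangent_derivations_whole:
  assumes "derivations \<Theta> \<xi> D"
  shows "tangent_derivations \<Theta> \<xi> D \<Theta>"
proof -
  interpret derivations \<Theta> \<xi> D by fact
  show ?thesis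
  proof
    fix f z j assume f: "local_fun \<Theta> f" "\<And>z. z \<in> \<Theta> \<Longrightarrow> f z = 0" and z: "z \<in> \<Theta>"
    show "D j f z = 0"
      using D_cong[OF f z, of j] D_const[OF z, of j 0] by simp
  qed auto
qed

text \<open>A multi-index written as a sorted word: \<open>multi_deriv\<close> becomes a fold over a
  word, and a change in the order of derivatives becomes an equality of multisets.\<close>

definition multi_list :: "('d::{finite,linorder} \<Rightarrow> nat) \<Rightarrow> 'd list" where
  "multi_list J = concat (map (\<lambda>j. replicate (J j) j) (sorted_list_of_set UNIV))"

lemma multi_deriv_foldr: "multi_deriv D J f = foldr D (multi_list J) f"
proof -
  have "foldr (\<lambda>j. D j ^^ J j) js f = foldr D (concat (map (\<lambda>j. replicate (J j) j) js)) f" for js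
  proof (induction js)
    case (Cons j js)
    have "foldr D (replicate n j) g = (D j ^^ n) g" for n g
      by (induction n) auto
    with Cons show ?case by simp
  qed simp
  then show ?thesis
    by (simp add: multi_deriv_def multi_list_def)
qed

lemma count_multi_list: "count (mset (multi_list J)) j = J j"
proof -
  have "count (mset (concat (map (\<lambda>j. replicate (J j) j) js))) j = (\<Sum>i\<leftarrow>js. if i = j then J j else 0)" for js
    by (induction js) auto
  also have "(\<Sum>i\<leftarrow>sorted_list_of_set UNIV. if i = j then J j else 0) = J j"
    by (subst sum_list_distinct_conv_sum_set) auto
  finally show ?thesis
    by (simp add: multi_list_def)
qed

lemma set_multi_list: "set (multi_list J) = {j. J j \<noteq> 0}"
  by (auto simp: count_multi_list simp flip: set_mset_mset count_greater_zero_iff)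

lemma multi_list_zero: "multi_list (\<lambda>_. 0) = []"
  by (simp add: multi_list_def)

lemma mset_multi_list_Suc: "mset (k # multi_list J) = mset (multi_list (J(k := Suc (J k))))"
  by (rule multiset_eqI) (simp add: count_multi_list)

text \<open>The new letter \<open>k\<close> has to be sorted into the word of \<open>J\<close>; the
  indices in the commutation hypothesis are exactly the letters of the extended word.\<close>

lemma multi_deriv_Suc:
  assumes "tangent_derivations \<Theta> \<xi> D S"
    and "\<And>i j. i = k \<or> J i \<noteq> 0 \<Longrightarrow> j = k \<or> J j \<noteq> 0 \<Longrightarrow> tangent_derivations.commuting \<Theta> D S i j"
    and "local_fun \<Theta> f" "z \<in> S"
  shows "D k (multi_deriv D J f) z = multi_deriv D (J(k := Suc (J k))) f z"
  using tangent_derivations.foldr_D_permute[OF assms(1) mset_multi_list_Suc _ assms(3,4), of k J] assms(2)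
  by (simp add: multi_deriv_foldr set_multi_list)

lemma multi_deriv_local:
  "derivations \<Theta> \<xi> D \<Longrightarrow> local_fun \<Theta> f \<Longrightarrow> local_fun \<Theta> (multi_deriv D J f)"
  by (simp add: multi_deriv_foldr derivations.foldr_D_local)

section \<open>Commutation of total derivatives and tangency to the solution set\<close>

lemma total_deriv_commute:
  assumes "open \<Omega>" "local_fun \<Omega> f" "z \<in> \<Omega>"
  shows "total_deriv i (total_deriv j f) z = total_deriv j (total_deriv i f) z"
proof -
  interpret derivations \<Omega> jet_coeff total_deriv
    by (rule derivations_total_deriv[OF assms(1)])
  show ?thesis
  proof (rule D_commute[OF assms(2,3)])
    fix c
    show "total_deriv i (jet_coeff j c) z = total_deriv j (jet_coeff i c) z"
    proof (cases c)
      case (Dep \<alpha> J)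
      then show ?thesis
        using assms(3) by (cases "i = j") (auto simp: D_coordinate fun_upd_twist)
    qed (use assms(3) in \<open>simp add: D_const\<close>)
  qed
qed

lemma total_deriv_multi_deriv:
  assumes "open \<Omega>" "local_fun \<Omega> f" "z \<in> \<Omega>"
  shows "total_deriv k (multi_deriv total_deriv J f) z =
    multi_deriv total_deriv (J(k := Suc (J k))) f z"
proof -
  interpret tangent_derivations \<Omega> jet_coeff total_deriv \<Omega>
    by (rule tangent_derivations_whole[OF derivations_total_deriv[OF assms(1)]])
  show ?thesis
    by (rule multi_deriv_Suc[OF tangent_derivations_axioms]) (use assms total_deriv_commute in \<open>auto simp: commuting_def\<close>)
qed

text \<open>In the local representation of \<open>f\<close> by differential consequences, the
  product rule leaves only terms containing some consequence or its total derivative, which is again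
  a consequence; all vanish on \<open>Sol \<Omega> F\<close>. The smaller open set \<open>V\<close>
  is there for slices of coverings.\<close>

lemma total_deriv_tangent:
  assumes "open \<Omega>" "\<And>I. local_fun \<Omega> (F I)" "regular_system \<Omega> F"
    and V: "open V" "V \<subseteq> \<Omega>" and f: "local_fun V f" "\<And>z. z \<in> V \<inter> Sol \<Omega> F \<Longrightarrow> f z = 0"
    and z: "z \<in> V" "z \<in> Sol \<Omega> F"
  shows "total_deriv j f z = 0"
proof -
  have "\<exists>V' K c. open V' \<and> z \<in> V' \<and> V' \<subseteq> V \<and> finite K \<and> (\<forall>k\<in>K. local_fun V' (c k)) \<and>
           (\<forall>y\<in>V'. f y = (\<Sum>(I, J)\<in>K. c (I, J) y * multi_deriv total_deriv J (F I) y))"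
    by (rule assms(3)[unfolded regular_system_def, rule_format])
       (use V f z in auto)
  then obtain V' K c where V': "open V'" "z \<in> V'" "V' \<subseteq> V" "finite K"
    "\<And>k. k \<in> K \<Longrightarrow> local_fun V' (c k)"
    "\<And>y. y \<in> V' \<Longrightarrow> f y = (\<Sum>(I, J)\<in>K. c (I, J) y * multi_deriv total_deriv J (F I) y)"
    by blast
  interpret W: derivations \<Omega> jet_coeff total_deriv
    by (rule derivations_total_deriv[OF assms(1)])
  interpret derivations V' jet_coeff total_deriv
    by (rule derivations_total_deriv[OF V'(1)])
  have loc: "local_fun V' (multi_deriv total_deriv J (F I))" for I J
    using multi_deriv_local[OF W.derivations_axioms assms(2)] V V'(3) by (meson local_fun_subset order_trans)
  have "total_deriv j f z =
      total_deriv j (\<lambda>y. \<Sum>k\<in>K. c k y * multi_deriv total_deriv (snd k) (F (fst k)) y) z"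
    using V'(2,3,6) by (intro D_cong local_fun_subset[OF f(1)]) (auto simp: case_prod_unfold)
  also have "\<dots> = (\<Sum>k\<in>K. total_deriv j (\<lambda>y. c k y * multi_deriv total_deriv (snd k) (F (fst k)) y) z)"
    using V' loc by (intro D_sum local_fun_mult) auto
  also have "\<dots> = (\<Sum>k\<in>K. 0)"
  proof (rule sum.cong[OF refl])
    fix k assume k: "k \<in> K"
    have "multi_deriv total_deriv J (F I) z = 0" for I J
      using z(2) by (simp add: Sol_def)
    moreover have "z \<in> \<Omega>"
      using z V by auto
    ultimately show "total_deriv j (\<lambda>y. c k y * multi_deriv total_deriv (snd k) (F (fst k)) y) z = 0"
      using k V' loc by (simp add: D_mult total_deriv_multi_deriv[OF assms(1,2)])
  qed
  finally show ?thesis by simp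
qed

section \<open>Slices of a covering with frozen nonlocal variables\<close>

lemma continuous_on_case_sum: "continuous_on UNIV (\<lambda>y :: 'a \<Rightarrow> complex. case_sum y (w :: 'b \<Rightarrow> complex))"
proof (rule continuous_on_coordinatewise_then_product)
  fix c :: "'a + 'b"
  show "continuous_on UNIV (\<lambda>y. case_sum y w c)"
    by (cases c) auto
qed

lemma case_sum_update: "(case_sum y w)(Inl c := t) = case_sum (y(c := t)) w"
  by (auto simp: fun_eq_iff split: sum.split)

lemma local_fun_slice:
  fixes \<Theta> :: "('a + 'b \<Rightarrow> complex) set"
  assumes "local_fun \<Theta> f"
  shows "local_fun {y. case_sum y w \<in> \<Theta>} (\<lambda>y. f (case_sum y w))"
proof -
  obtain C where C: "finite C" "determined_by \<Theta> C f"
    using local_fun_determined[OF assms] .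
  show ?thesis
  proof (rule local_funI[of "Inl -` C"])
    show "finite (Inl -` C)"
      by (rule finite_vimageI[OF C(1)]) simp
    show "determined_by {y. case_sum y w \<in> \<Theta>} (Inl -` C) (\<lambda>y. f (case_sum y w))"
      by (intro determined_byI determined_byD[OF C(2)]) (auto split: sum.split)
    show "continuous_on {y. case_sum y w \<in> \<Theta>} (\<lambda>y. f (case_sum y w))"
      by (rule continuous_on_compose2[OF local_fun_continuous[OF assms]
            continuous_on_subset[OF continuous_on_case_sum]]) auto
    fix z c assume "z \<in> {y. case_sum y w \<in> \<Theta>}"
    then show "(\<lambda>t. f (case_sum (z(c := t)) w)) field_differentiable at (z c)"
      using local_fun_differentiable[OF assms, of "case_sum z w" "Inl c"]
      by (simp add: case_sum_update)
  qed
qed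

lemma open_slice:
  fixes \<Theta> :: "('a + 'b \<Rightarrow> complex) set"
  assumes "open \<Theta>"
  shows "open {y. case_sum y w \<in> \<Theta>}"
proof -
  have "open ((\<lambda>y. case_sum y w) -` \<Theta>)"
    by (rule open_vimage[OF assms continuous_on_case_sum])
  then show ?thesis
    by (simp add: vimage_def)
qed

text \<open>For fixed nonlocal variables the tangency statement reduces to the jet space; in the
  nonlocal directions \<^const>\<open>cov_Sol\<close> is open.\<close>

lemma cov_deriv_tangent:
  assumes "open \<Omega>" "\<And>I. local_fun \<Omega> (F I)" "regular_system \<Omega> F"
    and \<Theta>: "open \<Theta>" "\<And>z. z \<in> \<Theta> \<Longrightarrow> z \<circ> Inl \<in> \<Omega>"
    and f: "local_fun \<Theta> f" "\<And>z. z \<in> cov_Sol \<Omega> F \<Theta> \<Longrightarrow> f z = 0"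
    and z: "z \<in> cov_Sol \<Omega> F \<Theta>"
  shows "cov_deriv X j f z = 0"
proof -
  define w where "w = z \<circ> Inr"
  have z_eq: "z = case_sum (z \<circ> Inl) w"
    by (auto simp: w_def fun_eq_iff split: sum.split)
  define g where "g y = f (case_sum y w)" for y
  have "partial (Inr s) f z = 0" for s
  proof (rule partial_eqI)
    have upd: "z(Inr s := t) \<circ> Inl = z \<circ> Inl" for t
      by (auto simp: fun_eq_iff)
    show "((\<lambda>t. f (z(Inr s := t))) has_field_derivative 0) (at (z (Inr s)))"
    proof (rule has_field_derivative_transform_within_open[OF DERIV_const open_update_vimage[OF \<Theta>(1)]])
      show "z (Inr s) \<in> {t. z(Inr s := t) \<in> \<Theta>}"
        using z by (simp add: cov_Sol_def)
      fix t assume "t \<in> {t. z(Inr s := t) \<in> \<Theta>}"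
      then show "0 = f (z(Inr s := t))"
        using z by (intro f(2)[symmetric]) (auto simp: cov_Sol_def upd)
    qed
  qed
  moreover have "partial (Inl c) f z = partial c g (z \<circ> Inl)" for c
    unfolding partial_def g_def by (subst z_eq) (simp add: case_sum_update)
  ultimately have "cov_deriv X j f z = total_deriv j g (z \<circ> Inl)"
    by (simp add: cov_deriv_def total_deriv_def)
  also have "\<dots> = 0"
  proof (rule total_deriv_tangent[OF assms(1-3) open_slice[OF \<Theta>(1), of w]])
    show "{y. case_sum y w \<in> \<Theta>} \<subseteq> \<Omega>"
    proof
      fix y assume "y \<in> {y. case_sum y w \<in> \<Theta>}"
      then show "y \<in> \<Omega>"
        using \<Theta>(2)[of "case_sum y w"] by (simp add: o_def)
    qed
    show "local_fun {y. case_sum y w \<in> \<Theta>} g"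
      unfolding g_def by (rule local_fun_slice[OF f(1)])
    show "g y = 0" if "y \<in> {y. case_sum y w \<in> \<Theta>} \<inter> Sol \<Omega> F" for y
      using that unfolding g_def by (intro f(2)) (simp add: cov_Sol_def o_def)
    show "z \<circ> Inl \<in> {y. case_sum y w \<in> \<Theta>}" "z \<circ> Inl \<in> Sol \<Omega> F"
      using z z_eq by (auto simp: cov_Sol_def)
  qed
  finally show ?thesis .
qed

lemma tangent_cov_deriv:
  assumes "open \<Omega>" "\<And>I. local_fun \<Omega> (F I)" "regular_system \<Omega> F"
    and "open \<Theta>" "\<And>z. z \<in> \<Theta> \<Longrightarrow> z \<circ> Inl \<in> \<Omega>" "\<And>j s. local_fun \<Theta> (X j s)"
  shows "tangent_derivations \<Theta> (cov_coeff X) (cov_deriv X) (cov_Sol \<Omega> F \<Theta>)"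
  by (intro tangent_derivations.intro tangent_derivations_axioms.intro
      derivations_cov_deriv cov_deriv_tangent[OF assms(1-5)] assms(4,6))
     (auto simp: cov_Sol_def)

section \<open>Transfer of operator identities to coverings\<close>

text \<open>Only independent variables occur, so total derivatives reduce to ordinary ones, and the
  factorials make differentiation a pure lowering of exponents without numerical factors.\<close>

definition taylor_monomial ::
  "('d::finite, 'n) jet \<Rightarrow> ('d \<Rightarrow> nat) \<Rightarrow> ('d, 'n) jet \<Rightarrow> complex" where
  "taylor_monomial z0 J z = (\<Prod>j\<in>UNIV. (z (Indep j) - z0 (Indep j)) ^ J j / fact (J j))"

lemma local_fun_power: "local_fun \<Omega> f \<Longrightarrow> local_fun \<Omega> (\<lambda>z. f z ^ n)"
  by (induction n) (auto intro: local_fun_intros)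

lemma local_fun_prod:
  "(\<And>i. i \<in> A \<Longrightarrow> local_fun \<Omega> (f i)) \<Longrightarrow> local_fun \<Omega> (\<lambda>z. \<Prod>i\<in>A. f i z)"
  by (induction A rule: infinite_finite_induct) (auto intro: local_fun_const local_fun_mult)

lemma local_fun_taylor_monomial: "local_fun \<Omega> (taylor_monomial z0 J)"
  unfolding taylor_monomial_def[abs_def]
  by (intro local_fun_prod local_fun_divide local_fun_power local_fun_intros) simp

lemma taylor_monomial_center: "taylor_monomial z0 J z0 = (if J = (\<lambda>_. 0) then 1 else 0)"
  by (auto simp: taylor_monomial_def fun_eq_iff power_0_left)

lemma total_deriv_taylor_monomial:
  "total_deriv i (taylor_monomial z0 J) z =
    (if J i = 0 then 0 else taylor_monomial z0 (J(i := J i - 1)) z)"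
proof -
  define R where "R = (\<Prod>j\<in>-{i}. (z (Indep j) - z0 (Indep j)) ^ J j / fact (J j))"
  have split: "(\<Prod>j\<in>UNIV. h j) = h i * (\<Prod>j\<in>-{i}. h j)" for h :: "'a \<Rightarrow> complex"
    using prod.remove[of UNIV i h] by (simp add: Compl_eq_Diff_UNIV)
  have eq: "taylor_monomial z0 J (z(Indep i := t)) = (t - z0 (Indep i)) ^ J i / fact (J i) * R" for t
    unfolding taylor_monomial_def R_def by (subst split) (auto intro!: prod.cong)
  have "partial (Dep \<alpha> I) (taylor_monomial z0 J) z = 0" for \<alpha> I
    by (simp add: partial_def taylor_monomial_def)
  moreover have "partial (Indep i) (taylor_monomial z0 J) z =
      (if J i = 0 then 0 else taylor_monomial z0 (J(i := J i - 1)) z)"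
  proof (cases "J i")
    case 0
    then show ?thesis
      unfolding partial_def eq by simp
  next
    case (Suc n)
    have "taylor_monomial z0 (J(i := n)) z = (z (Indep i) - z0 (Indep i)) ^ n / fact n * R"
      unfolding taylor_monomial_def R_def by (subst split) (auto intro!: prod.cong)
    moreover have "((\<lambda>t. (t - z0 (Indep i)) ^ Suc n / fact (Suc n) * R) has_field_derivative
        (z (Indep i) - z0 (Indep i)) ^ n / fact n * R) (at (z (Indep i)))"
    proof -
      have "((\<lambda>t. (t - z0 (Indep i)) ^ Suc n) has_field_derivative
          of_nat (Suc n) * (z (Indep i) - z0 (Indep i)) ^ n) (at (z (Indep i)))"
        by (auto intro!: derivative_eq_intros simp del: power_Suc of_nat_Suc)
      from DERIV_cmult_right[OF DERIV_cdivide[OF this, of "fact (Suc n)"], of R] show ?thesis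
        by (simp del: of_nat_Suc power_Suc)
    qed
    ultimately show ?thesis
      using Suc by (intro partial_eqI) (simp add: eq)
  qed
  ultimately show ?thesis
    by (simp add: total_deriv_def case_prod_unfold)
qed

text \<open>The case distinction guards the truncated subtraction of exponents: as soon as a letter
  occurs more often than its exponent allows, the result is zero.\<close>

lemma foldr_taylor_monomial:
  "foldr total_deriv js (taylor_monomial z0 J) =
    (if \<forall>j. count (mset js) j \<le> J j then taylor_monomial z0 (\<lambda>j. J j - count (mset js) j)
     else (\<lambda>_. 0))"
proof (induction js)
  case (Cons i js)
  let ?c = "count (mset js)"
  have zero: "total_deriv i (\<lambda>_. 0) = (\<lambda>_. 0 :: complex)"
    by (auto simp: total_deriv_def fun_eq_iff case_prod_unfold)
  have upd: "(\<lambda>j. J j - ?c j)(i := J i - ?c i - 1) = (\<lambda>j. J j - count (mset (i # js)) j)"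
    by auto
  have iff: "(\<forall>j. count (mset (i # js)) j \<le> J j) \<longleftrightarrow> (\<forall>j. ?c j \<le> J j) \<and> J i - ?c i \<noteq> 0"
  proof -
    have "count (mset (i # js)) j \<le> J j \<longleftrightarrow> ?c j \<le> J j \<and> (j = i \<longrightarrow> J j - ?c j \<noteq> 0)" for j
      by (cases "j = i") auto
    then show ?thesis by blast
  qed
  show ?case
  proof (cases "\<forall>j. ?c j \<le> J j")
    case True
    then have "foldr total_deriv (i # js) (taylor_monomial z0 J) =
        total_deriv i (taylor_monomial z0 (\<lambda>j. J j - ?c j))"
      using Cons.IH by simp
    also have "\<dots> = (\<lambda>z. if J i - ?c i = 0 then 0 else
        taylor_monomial z0 ((\<lambda>j. J j - ?c j)(i := J i - ?c i - 1)) z)"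
      by (rule ext) (rule total_deriv_taylor_monomial)
    finally show ?thesis
      unfolding iff upd using True by auto
  next
    case False
    then have "foldr total_deriv js (taylor_monomial z0 J) = (\<lambda>_. 0)"
      using Cons.IH by argo
    with False show ?thesis
      unfolding iff using zero by auto
  qed
qed simp

lemma foldr_taylor_monomial_center:
  "foldr total_deriv js (taylor_monomial z0 J) z0 = (if J = count (mset js) then 1 else 0)"
  unfolding foldr_taylor_monomial
  by (auto simp: taylor_monomial_center fun_eq_iff intro!: antisym)

lemma (in derivations) foldr_D_linear_combination:
  assumes "finite A" "\<And>i. i \<in> A \<Longrightarrow> local_fun \<Theta> (f i)" "z \<in> \<Theta>"
  shows "foldr D js (\<lambda>z. \<Sum>i\<in>A. a i * f i z) z = (\<Sum>i\<in>A. a i * foldr D js (f i) z)"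
  using assms(3)
proof (induction js arbitrary: z)
  case (Cons j js)
  have "foldr D (j # js) (\<lambda>z. \<Sum>i\<in>A. a i * f i z) z = D j (\<lambda>z. \<Sum>i\<in>A. a i * foldr D js (f i) z) z"
    unfolding foldr_Cons o_def
    by (rule D_cong) (use Cons assms in \<open>auto intro!: foldr_D_local local_fun_intros\<close>)
  also have "\<dots> = (\<Sum>i\<in>A. a i * D j (foldr D js (f i)) z)"
    using Cons.prems assms
    by (subst D_sum) (auto intro!: foldr_D_local local_fun_intros sum.cong D_cmult)
  finally show ?case by simp
qed simp

text \<open>A Taylor polynomial with coefficients \<open>a\<close>. The target values depend on a
  word through its letter counts only, as they must for commuting derivatives.\<close>

lemma prescribed_jet:
  fixes z0 :: "('d::finite, 'n) jet" and a :: "('d \<Rightarrow> nat) \<Rightarrow> complex"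
  obtains V where "local_fun UNIV V"
    "\<And>js. length js \<le> K \<Longrightarrow> foldr total_deriv js V z0 = a (count (mset js))"
proof -
  interpret derivations UNIV jet_coeff "total_deriv :: 'd \<Rightarrow> (('d, 'n) jet \<Rightarrow> complex) \<Rightarrow> _"
    by (rule derivations_total_deriv) simp
  \<comment> \<open>This box of exponents contains the letter counts of every word of length at most
    \<open>K\<close>.\<close>
  define A where "A = (UNIV :: 'd set) \<rightarrow>\<^sub>E {..K}"
  have A: "finite A"
    unfolding A_def by (rule finite_PiE) auto
  define V where "V = (\<lambda>z. \<Sum>J\<in>A. a J * taylor_monomial z0 J z)"
  show ?thesis
  proof (rule that)
    show "local_fun UNIV V"
      unfolding V_def by (intro local_fun_intros local_fun_taylor_monomial)
    fix js :: "'d list" assume "length js \<le> K"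
    moreover have "count (mset js) j \<le> length js" for j
      by (induction js) auto
    ultimately have "count (mset js) \<in> A"
      unfolding A_def by (auto intro: order_trans)
    then show "foldr total_deriv js V z0 = a (count (mset js))"
      unfolding V_def
      by (subst foldr_D_linear_combination[OF A])
         (auto simp: local_fun_taylor_monomial foldr_taylor_monomial_center A if_distrib cong: if_cong)
  qed
qed

lemma linearization_finite:
  assumes "open \<Omega>" "determined_by \<Omega> C (F I)" "finite C" "\<pi> z \<in> \<Omega>"
  shows "linearization \<pi> D F V I z =
    (\<Sum>p\<in>(\<lambda>(\<alpha>, J). Dep \<alpha> J) -` C.
       partial (Dep (fst p) (snd p)) (F I) (\<pi> z) * multi_deriv D (snd p) (V (fst p)) z)"
proof -
  have zero: "partial c (F I) (\<pi> z) = 0" if "c \<notin> C" for c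
    by (rule partial_determined_zero[OF assms(1,2) that assms(4)])
  show ?thesis
    unfolding linearization_def case_prod_unfold
    by (rule Sum_any.expand_superset[OF finite_vimageI[OF assms(3) inj_Dep, unfolded case_prod_unfold]])
       (use zero in auto)
qed

text \<open>The two functions live on different spaces and are compared at one point of each. All
  words of derivatives are compared, in every order of the letters, so the notion makes sense
  without commutation; peeling off the innermost derivative suits inductions by the product
  rule.\<close>

primrec agree_to_order ::
  "nat \<Rightarrow> ('d \<Rightarrow> ('y \<Rightarrow> complex) \<Rightarrow> 'y \<Rightarrow> complex) \<Rightarrow> 'y \<Rightarrow>
   ('d \<Rightarrow> ('z \<Rightarrow> complex) \<Rightarrow> 'z \<Rightarrow> complex) \<Rightarrow> 'z \<Rightarrow> ('y \<Rightarrow> complex) \<Rightarrow> ('z \<Rightarrow> complex) \<Rightarrow> bool" where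
  "agree_to_order 0 D' \<zeta> D z f g \<longleftrightarrow> f \<zeta> = g z"
| "agree_to_order (Suc k) D' \<zeta> D z f g \<longleftrightarrow>
     f \<zeta> = g z \<and> (\<forall>j. agree_to_order k D' \<zeta> D z (D' j f) (D j g))"

lemma agree_to_order_Suc: "agree_to_order (Suc k) D' \<zeta> D z f g \<Longrightarrow> agree_to_order k D' \<zeta> D z f g"
  by (induction k arbitrary: f g) auto

lemma agree_to_order_mono:
  assumes "agree_to_order k D' \<zeta> D z f g" "l \<le> k"
  shows "agree_to_order l D' \<zeta> D z f g"
  using assms(2,1)
proof (induction rule: dec_induct)
  case (step n)
  then show ?case using agree_to_order_Suc[of n D' \<zeta> D z f g] by blast
qed

lemma agree_to_order_foldrI:
  assumes "\<And>js. length js \<le> k \<Longrightarrow> foldr D' js f \<zeta> = foldr D js g z"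
  shows "agree_to_order k D' \<zeta> D z f g"
  using assms
proof (induction k arbitrary: f g)
  case 0
  then show ?case using 0[of "[]"] by simp
next
  case (Suc k)
  have "foldr D' js (D' j f) \<zeta> = foldr D js (D j g) z" if "length js \<le> k" for js j
    using Suc.prems[of "js @ [j]"] that by simp
  then show ?case
    using Suc.IH Suc.prems[of "[]"] by simp
qed

lemma agree_to_order_foldr:
  "agree_to_order (k + length js) D' \<zeta> D z f g \<Longrightarrow>
    agree_to_order k D' \<zeta> D z (foldr D' js f) (foldr D js g)"
proof (induction js arbitrary: k)
  case (Cons j js)
  have "agree_to_order (Suc k + length js) D' \<zeta> D z f g"
    using Cons.prems by (metis add_Suc_shift length_Cons)
  then have "agree_to_order (Suc k) D' \<zeta> D z (foldr D' js f) (foldr D js g)"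
    by (rule Cons.IH)
  then show ?case by simp
qed simp

section \<open>Operators with the same coefficients on the jet space and on a covering\<close>

lemma op_zero_eq: "op_zero U a = (\<lambda>_. 0)"
  by (simp add: op_zero_def fun_eq_iff)

text \<open>Only openness and locality are assumed, so that the locale can be entered on the
  adjoined covering before its total derivatives are known to commute.\<close>

locale covering_point =
  fixes \<Omega> :: "('d::{finite,linorder}, 'n::finite) jet set"
    and \<Theta> :: "('d, 'n, 'w) cov_point set"
    and X :: "'d \<Rightarrow> 'w \<Rightarrow> ('d, 'n, 'w) cov_point \<Rightarrow> complex"
    and \<zeta> :: "('d, 'n, 'w) cov_point"
  assumes open_base: "open \<Omega>" and open_cover: "open \<Theta>"
    and over: "z \<in> \<Theta> \<Longrightarrow> z \<circ> Inl \<in> \<Omega>"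
    and local_X: "local_fun \<Theta> (X j s)"
    and point: "\<zeta> \<in> \<Theta>"
begin

sublocale base: derivations \<Omega> jet_coeff total_deriv
  by (rule derivations_total_deriv[OF open_base])

sublocale cover: derivations \<Theta> "cov_coeff X" "cov_deriv X"
  by (rule derivations_cov_deriv[OF open_cover local_X])

lemma cov_deriv_pullback:
  assumes "local_fun \<Omega> f" "z \<in> \<Theta>"
  shows "cov_deriv X j (\<lambda>z. f (z \<circ> Inl)) z = total_deriv j f (z \<circ> Inl)"
  by (rule derivations_pullback[OF base.derivations_axioms cover.derivations_axioms _ over])
     (use assms in auto)

definition "z0 = \<zeta> \<circ> Inl"

lemma z0: "z0 \<in> \<Omega>"
  using over[OF point] by (simp add: z0_def)

abbreviation agree where
  "agree k \<equiv> agree_to_order k (cov_deriv X) \<zeta> total_deriv z0"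

text \<open>The sum and product rules give equalities on the open domains only, not equalities of
  functions; this lets them be used inside \<open>agree\<close>.\<close>

lemma agree_cong:
  assumes "agree k f g" "local_fun \<Theta> f" "\<And>z. z \<in> \<Theta> \<Longrightarrow> f z = f' z"
    "local_fun \<Omega> g" "\<And>z. z \<in> \<Omega> \<Longrightarrow> g z = g' z"
  shows "agree k f' g'"
  using assms
proof (induction k arbitrary: f g f' g')
  case 0
  then show ?case using point z0 by simp
next
  case (Suc k)
  have "agree k (cov_deriv X j f') (total_deriv j g')" for j
    by (rule Suc.IH[of "cov_deriv X j f" "total_deriv j g"])
       (use Suc.prems in \<open>auto intro: cover.D_local base.D_local cover.D_cong base.D_cong\<close>)
  then show ?case
    using Suc.prems point z0 by simp
qed

lemma agree_add:
  assumes "agree k f g" "agree k f' g'"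
    "local_fun \<Theta> f" "local_fun \<Theta> f'" "local_fun \<Omega> g" "local_fun \<Omega> g'"
  shows "agree k (\<lambda>z. f z + f' z) (\<lambda>z. g z + g' z)"
  using assms
proof (induction k arbitrary: f g f' g')
  case (Suc k)
  have "agree k (cov_deriv X j (\<lambda>z. f z + f' z)) (total_deriv j (\<lambda>z. g z + g' z))" for j
    by (rule agree_cong[OF Suc.IH[of "cov_deriv X j f" "total_deriv j g" "cov_deriv X j f'" "total_deriv j g'"]])
       (use Suc.prems in \<open>auto intro!: cover.D_local base.D_local local_fun_add simp: cover.D_add base.D_add\<close>)
  then show ?case
    using Suc.prems by simp
qed simp

lemma agree_mult:
  assumes "agree k f g" "agree k f' g'"
    "local_fun \<Theta> f" "local_fun \<Theta> f'" "local_fun \<Omega> g" "local_fun \<Omega> g'"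
  shows "agree k (\<lambda>z. f z * f' z) (\<lambda>z. g z * g' z)"
  using assms
proof (induction k arbitrary: f g f' g')
  case (Suc k)
  have ag: "agree k f g" "agree k f' g'" "agree k (cov_deriv X j f) (total_deriv j g)"
      "agree k (cov_deriv X j f') (total_deriv j g')" for j
    using Suc.prems(1,2)[THEN agree_to_order_Suc] Suc.prems(1,2) by simp_all
  have "agree k (cov_deriv X j (\<lambda>z. f z * f' z)) (total_deriv j (\<lambda>z. g z * g' z))" for j
    by (rule agree_cong[OF agree_add[OF
          Suc.IH[OF ag(3)[of j] ag(2)] Suc.IH[OF ag(1) ag(4)[of j]]]])
       (use Suc.prems in \<open>auto intro!: cover.D_local base.D_local local_fun_add local_fun_mult
          simp: cover.D_mult base.D_mult\<close>)
  then show ?case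
    using Suc.prems by simp
qed simp

lemma local_fun_pullback_Inl: "local_fun \<Omega> a \<Longrightarrow> local_fun \<Theta> (\<lambda>z. a (z \<circ> Inl))"
  by (rule local_fun_pullback) (auto intro: over)

lemma agree_pullback:
  "local_fun \<Omega> f \<Longrightarrow> agree k (\<lambda>z. f (z \<circ> Inl)) f"
proof (induction k arbitrary: f)
  case (Suc k)
  have "agree k (cov_deriv X j (\<lambda>z. f (z \<circ> Inl))) (total_deriv j f)" for j
  proof (rule agree_cong[OF Suc.IH[OF base.D_local[OF Suc.prems, of j]]])
    show "local_fun \<Theta> (\<lambda>z. total_deriv j f (z \<circ> Inl))"
      by (rule local_fun_pullback_Inl[OF base.D_local[OF Suc.prems]])
    show "total_deriv j f (z \<circ> Inl) = cov_deriv X j (\<lambda>z. f (z \<circ> Inl)) z" if "z \<in> \<Theta>" for z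
      by (rule cov_deriv_pullback[OF Suc.prems that, symmetric])
  qed (use Suc.prems in \<open>auto intro: base.D_local\<close>)
  moreover have "f (\<zeta> \<circ> Inl) = f z0"
    by (simp only: z0_def)
  ultimately show ?case
    unfolding agree_to_order.simps by blast
qed (simp only: agree_to_order.simps z0_def)

lemma agree_const: "agree k (\<lambda>_. a) (\<lambda>_. a)"
  using agree_pullback[OF local_fun_const] by simp

lemma agree_sum:
  assumes "\<And>i. i \<in> A \<Longrightarrow> agree k (f i) (g i)"
    "\<And>i. i \<in> A \<Longrightarrow> local_fun \<Theta> (f i)" "\<And>i. i \<in> A \<Longrightarrow> local_fun \<Omega> (g i)"
  shows "agree k (\<lambda>z. \<Sum>i\<in>A. f i z) (\<lambda>z. \<Sum>i\<in>A. g i z)"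
  using assms
  by (induction A rule: infinite_finite_induct)
     (auto intro!: agree_const agree_add local_fun_sum)

text \<open>This holds for operators \<open>P'\<close>, \<open>P\<close> with the same coefficients; \<open>K\<close> bounds their order.\<close>

definition natural ::
  "(('b \<Rightarrow> ('d, 'n, 'w) cov_point \<Rightarrow> complex) \<Rightarrow> 'a \<Rightarrow> ('d, 'n, 'w) cov_point \<Rightarrow> complex) \<Rightarrow>
   (('b \<Rightarrow> ('d, 'n) jet \<Rightarrow> complex) \<Rightarrow> 'a \<Rightarrow> ('d, 'n) jet \<Rightarrow> complex) \<Rightarrow> bool" where
  "natural P' P \<longleftrightarrow> (\<exists>K. \<forall>k U V.
     (\<forall>b. local_fun \<Theta> (U b) \<and> local_fun \<Omega> (V b) \<and> agree (k + K) (U b) (V b)) \<longrightarrow>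
     (\<forall>a. local_fun \<Theta> (P' U a) \<and> local_fun \<Omega> (P V a) \<and> agree k (P' U a) (P V a)))"

lemma natural_compose:
  fixes Q' :: "('c \<Rightarrow> ('d, 'n, 'w) cov_point \<Rightarrow> complex) \<Rightarrow> 'b \<Rightarrow> _"
  assumes "natural P' P" "natural Q' Q"
  shows "natural (P' \<circ> Q') (P \<circ> Q)"
proof -
  obtain K where K: "\<And>k U V. \<forall>b. local_fun \<Theta> (U b) \<and> local_fun \<Omega> (V b) \<and> agree (k + K) (U b) (V b) \<Longrightarrow>
      \<forall>a. local_fun \<Theta> (P' U a) \<and> local_fun \<Omega> (P V a) \<and> agree k (P' U a) (P V a)"
    using assms(1) unfolding natural_def by auto
  obtain L where L: "\<And>k U V. \<forall>b. local_fun \<Theta> (U b) \<and> local_fun \<Omega> (V b) \<and> agree (k + L) (U b) (V b) \<Longrightarrow>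
      \<forall>a. local_fun \<Theta> (Q' U a) \<and> local_fun \<Omega> (Q V a) \<and> agree k (Q' U a) (Q V a)"
    using assms(2) unfolding natural_def by auto
  show ?thesis
    unfolding natural_def
  proof (intro exI[of _ "K + L"] allI impI)
    fix k a and U :: "'c \<Rightarrow> _" and V :: "'c \<Rightarrow> _"
    assume "\<forall>b. local_fun \<Theta> (U b) \<and> local_fun \<Omega> (V b) \<and> agree (k + (K + L)) (U b) (V b)"
    then show "local_fun \<Theta> ((P' \<circ> Q') U a) \<and> local_fun \<Omega> ((P \<circ> Q) V a) \<and>
        agree k ((P' \<circ> Q') U a) ((P \<circ> Q) V a)"
      using K[OF L[of U V "k + K"]] by (simp add: add.assoc)
  qed
qed

lemma natural_diff:
  fixes Q' :: "('c \<Rightarrow> ('d, 'n, 'w) cov_point \<Rightarrow> complex) \<Rightarrow> 'b \<Rightarrow> _"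
  assumes "natural P' P" "natural Q' Q"
  shows "natural (P' \<ominus>\<^sub>o Q') (P \<ominus>\<^sub>o Q)"
proof -
  obtain K where K: "\<And>k U V. \<forall>b. local_fun \<Theta> (U b) \<and> local_fun \<Omega> (V b) \<and> agree (k + K) (U b) (V b) \<Longrightarrow>
      \<forall>a. local_fun \<Theta> (P' U a) \<and> local_fun \<Omega> (P V a) \<and> agree k (P' U a) (P V a)"
    using assms(1) unfolding natural_def by auto
  obtain L where L: "\<And>k U V. \<forall>b. local_fun \<Theta> (U b) \<and> local_fun \<Omega> (V b) \<and> agree (k + L) (U b) (V b) \<Longrightarrow>
      \<forall>a. local_fun \<Theta> (Q' U a) \<and> local_fun \<Omega> (Q V a) \<and> agree k (Q' U a) (Q V a)"
    using assms(2) unfolding natural_def by auto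
  show ?thesis
    unfolding natural_def
  proof (intro exI[of _ "K + L"] allI impI)
    fix k a and U :: "'c \<Rightarrow> _" and V :: "'c \<Rightarrow> _"
    assume H: "\<forall>b. local_fun \<Theta> (U b) \<and> local_fun \<Omega> (V b) \<and> agree (k + (K + L)) (U b) (V b)"
    have agK: "\<forall>b. agree (k + K) (U b) (V b)" and agL: "\<forall>b. agree (k + L) (U b) (V b)"
      using H by (auto intro: agree_to_order_mono[where k = "k + (K + L)"])
    have P: "local_fun \<Theta> (P' U a)" "local_fun \<Omega> (P V a)" "agree k (P' U a) (P V a)"
      using K[of U V k] agK H by auto
    have Q: "local_fun \<Theta> (Q' U a)" "local_fun \<Omega> (Q V a)" "agree k (Q' U a) (Q V a)"
      using L[of U V k] agL H by auto
    have eq: "(P' \<ominus>\<^sub>o Q') U a = (\<lambda>z. P' U a z + (- 1) * Q' U a z)"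
      "(P \<ominus>\<^sub>o Q) V a = (\<lambda>z. P V a z + (- 1) * Q V a z)"
      by (auto simp: op_diff_def fun_eq_iff)
    show "local_fun \<Theta> ((P' \<ominus>\<^sub>o Q') U a) \<and> local_fun \<Omega> ((P \<ominus>\<^sub>o Q) V a) \<and>
        agree k ((P' \<ominus>\<^sub>o Q') U a) ((P \<ominus>\<^sub>o Q) V a)"
      unfolding eq using P Q
      by (intro conjI agree_add agree_mult agree_const local_fun_add local_fun_mult local_fun_const)
  qed
qed

lemma natural_zero: "natural op_zero op_zero"
  unfolding natural_def by (auto simp: op_zero_eq local_fun_const agree_const)

lemma natural_scalar_op:
  fixes P :: "('d, 'n) scalar_op"
  assumes "local_scalar_op \<Omega> P"
  shows "natural (apply_scalar_op (\<lambda>z. z \<circ> Inl) (cov_deriv X) P) \<lbrakk>P\<rbrakk>\<^sub>s"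
  unfolding natural_def
proof (intro exI[of _ 1] allI impI)
  fix k a and U :: "'n \<Rightarrow> _" and V :: "'n \<Rightarrow> _"
  assume H: "\<forall>b. local_fun \<Theta> (U b) \<and> local_fun \<Omega> (V b) \<and> agree (k + 1) (U b) (V b)"
  have Suc: "agree (Suc k) (U b) (V b)" for b
    using H by (metis Suc_eq_plus1)
  have ag: "agree k (U b) (V b)" "agree k (cov_deriv X j (U b)) (total_deriv j (V b))" for b j
    using agree_to_order_Suc[OF Suc] Suc[of b] by simp_all
  have loc: "local_fun \<Theta> (U b)" "local_fun \<Omega> (V b)" for b
    using H by auto
  have eq: "apply_scalar_op (\<lambda>z. z \<circ> Inl) (cov_deriv X) P U a =
      (\<lambda>z. (\<Sum>b\<in>UNIV. fst P a b (z \<circ> Inl) * U b z) + (\<Sum>j\<in>UNIV. snd P j (z \<circ> Inl) * cov_deriv X j (U a) z))"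
    "\<lbrakk>P\<rbrakk>\<^sub>s V a =
      (\<lambda>z. (\<Sum>b\<in>UNIV. fst P a b z * V b z) + (\<Sum>j\<in>UNIV. snd P j z * total_deriv j (V a) z))"
    by (auto simp: apply_scalar_op_def scalar_symbol_def fun_eq_iff)
  have P: "local_fun \<Omega> (fst P \<alpha> \<beta>)" "local_fun \<Omega> (snd P j)" for \<alpha> \<beta> j
    using assms by (auto simp: local_scalar_op_def)
  show "local_fun \<Theta> (apply_scalar_op (\<lambda>z. z \<circ> Inl) (cov_deriv X) P U a) \<and> local_fun \<Omega> (\<lbrakk>P\<rbrakk>\<^sub>s V a) \<and>
      agree k (apply_scalar_op (\<lambda>z. z \<circ> Inl) (cov_deriv X) P U a) (\<lbrakk>P\<rbrakk>\<^sub>s V a)"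
    unfolding eq
    by (intro conjI agree_add agree_sum agree_mult agree_pullback local_fun_intros
        local_fun_pullback_Inl cover.D_local base.D_local loc ag P)
qed

lemma natural_matrix_op:
  fixes P :: "('d, 'n, 'a, 'b::finite) matrix_op"
  assumes "local_matrix_op \<Omega> P"
  shows "natural (apply_matrix_op (\<lambda>z. z \<circ> Inl) (cov_deriv X) P) \<lbrakk>P\<rbrakk>\<^sub>m"
  unfolding natural_def
proof (intro exI[of _ 1] allI impI)
  fix k a and U :: "'b \<Rightarrow> _" and V :: "'b \<Rightarrow> _"
  assume H: "\<forall>b. local_fun \<Theta> (U b) \<and> local_fun \<Omega> (V b) \<and> agree (k + 1) (U b) (V b)"
  have Suc: "agree (Suc k) (U b) (V b)" for b
    using H by (metis Suc_eq_plus1)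
  have ag: "agree k (U b) (V b)" "agree k (cov_deriv X j (U b)) (total_deriv j (V b))" for b j
    using agree_to_order_Suc[OF Suc] Suc[of b] by simp_all
  have loc: "local_fun \<Theta> (U b)" "local_fun \<Omega> (V b)" for b
    using H by auto
  have eq: "apply_matrix_op (\<lambda>z. z \<circ> Inl) (cov_deriv X) P U a =
      (\<lambda>z. (\<Sum>b\<in>UNIV. fst P a b (z \<circ> Inl) * U b z)
        + (\<Sum>j\<in>UNIV. \<Sum>b\<in>UNIV. snd P j a b (z \<circ> Inl) * cov_deriv X j (U b) z))"
    "\<lbrakk>P\<rbrakk>\<^sub>m V a = (\<lambda>z. (\<Sum>b\<in>UNIV. fst P a b z * V b z)
        + (\<Sum>j\<in>UNIV. \<Sum>b\<in>UNIV. snd P j a b z * total_deriv j (V b) z))"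
    by (auto simp: apply_matrix_op_def fun_eq_iff)
  have P: "local_fun \<Omega> (fst P \<alpha> \<beta>)" "local_fun \<Omega> (snd P j \<alpha> \<beta>)" for \<alpha> \<beta> j
    using assms by (auto simp: local_matrix_op_def)
  show "local_fun \<Theta> (apply_matrix_op (\<lambda>z. z \<circ> Inl) (cov_deriv X) P U a) \<and> local_fun \<Omega> (\<lbrakk>P\<rbrakk>\<^sub>m V a) \<and>
      agree k (apply_matrix_op (\<lambda>z. z \<circ> Inl) (cov_deriv X) P U a) (\<lbrakk>P\<rbrakk>\<^sub>m V a)"
    unfolding eq
    by (intro conjI agree_add agree_sum agree_mult agree_pullback local_fun_intros
        local_fun_pullback_Inl cover.D_local base.D_local loc ag P)
qed

lemma natural_linearization:
  fixes F :: "'m::finite \<Rightarrow> ('d, 'n) jet \<Rightarrow> complex"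
  assumes F: "\<And>I. local_fun \<Omega> (F I)"
  shows "natural (linearization (\<lambda>z. z \<circ> Inl) (cov_deriv X) F) (\<ell> F)"
proof -
  have "\<exists>C. finite C \<and> determined_by \<Omega> C (F I)" for I
    using local_fun_determined[OF F[of I]] by blast
  then obtain C where C: "\<And>I. finite (C I)" "\<And>I. determined_by \<Omega> (C I) (F I)"
    by metis
  define P where "P I = (\<lambda>(\<alpha>, J). Dep \<alpha> J) -` C I" for I
  have P: "finite (P I)" for I
    unfolding P_def by (rule finite_vimageI[OF C(1) inj_Dep])
  \<comment> \<open>The order of the linearization: there are finitely many components, each
    involving finitely many jet variables. The inserted 0 covers systems in which no jet variable
    occurs.\<close>
  define K where "K = Max (insert 0 ((\<lambda>p. length (multi_list (snd p))) ` (\<Union>I. P I)))"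
  have K: "length (multi_list (snd p)) \<le> K" if "p \<in> P I" for p I
    unfolding K_def using that P by (intro Max_ge) auto
  show ?thesis
    unfolding natural_def
  proof (intro exI[of _ K] allI impI)
    fix k and U :: "'n \<Rightarrow> ('d, 'n, 'w) cov_point \<Rightarrow> complex" and V :: "'n \<Rightarrow> ('d, 'n) jet \<Rightarrow> complex" and I
    assume H: "\<forall>b. local_fun \<Theta> (U b) \<and> local_fun \<Omega> (V b) \<and> agree (k + K) (U b) (V b)"
    let ?lin' = "\<lambda>z. \<Sum>p\<in>P I. partial (Dep (fst p) (snd p)) (F I) (z \<circ> Inl) *
        foldr (cov_deriv X) (multi_list (snd p)) (U (fst p)) z"
    let ?lin = "\<lambda>z. \<Sum>p\<in>P I. partial (Dep (fst p) (snd p)) (F I) z *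
        foldr total_deriv (multi_list (snd p)) (V (fst p)) z"
    have eq: "?lin' z = linearization (\<lambda>z. z \<circ> Inl) (cov_deriv X) F U I z" if "z \<in> \<Theta>" for z
      using linearization_finite[of \<Omega> "C I" F I, OF open_base C(2,1), of "\<lambda>z. z \<circ> Inl" z] over[OF that]
      by (simp add: P_def multi_deriv_foldr)
    have eq': "?lin z = \<ell> F V I z" if "z \<in> \<Omega>" for z
      using linearization_finite[of \<Omega> "C I" F I, OF open_base C(2,1), of id z] that
      by (simp add: P_def multi_deriv_foldr)
    have loc: "local_fun \<Theta> ?lin'"
      using H by (intro local_fun_intros local_fun_pullback_Inl local_fun_partial open_base F
          cover.foldr_D_local) auto
    have loc': "local_fun \<Omega> ?lin"
      using H by (intro local_fun_intros local_fun_partial open_base F base.foldr_D_local) auto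
    have "agree k ?lin' ?lin"
    proof (intro agree_sum agree_mult)
      fix p assume "p \<in> P I"
      then show "agree k (foldr (cov_deriv X) (multi_list (snd p)) (U (fst p)))
          (foldr total_deriv (multi_list (snd p)) (V (fst p)))"
        using H K[of p I]
        by - (rule agree_to_order_foldr, rule agree_to_order_mono[where k = "k + K"], auto)
    qed (use H in \<open>auto intro!: agree_pullback local_fun_intros local_fun_pullback_Inl
        local_fun_partial open_base F cover.foldr_D_local base.foldr_D_local\<close>)
    then show "local_fun \<Theta> (linearization (\<lambda>z. z \<circ> Inl) (cov_deriv X) F U I) \<and>
        local_fun \<Omega> (\<ell> F V I) \<and> agree k (linearization (\<lambda>z. z \<circ> Inl) (cov_deriv X) F U I) (\<ell> F V I)"
      by (intro conjI agree_cong[OF _ loc eq loc' eq'] local_fun_eq_on[OF open_cover loc eq]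
          local_fun_eq_on[OF open_base loc' eq'])
  qed
qed

end

lemma covering_point_diff_covering:
  "open \<Omega> \<Longrightarrow> diff_covering \<Omega> F \<Theta> X \<Longrightarrow> z \<in> \<Theta> \<Longrightarrow> covering_point \<Omega> \<Theta> X z"
  by unfold_locales (auto simp: diff_covering_def)

lemma tangent_diff_covering:
  assumes "open \<Omega>" "\<And>I. local_fun \<Omega> (F I)" "regular_system \<Omega> F" "diff_covering \<Omega> F \<Theta> X"
  shows "tangent_derivations \<Theta> (cov_coeff X) (cov_deriv X) (cov_Sol \<Omega> F \<Theta>)"
  using assms(4) by (intro tangent_cov_deriv assms(1-3)) (auto simp: diff_covering_def)

text \<open>At a given point a function on a covering has the same Taylor expansion as a polynomial in the
  independent variables; so an identity of operators need only be known for functions on the jet space.\<close>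

lemma op_eq_on_covering:
  fixes P' Q' :: "('b \<Rightarrow> ('d::{finite,linorder}, 'n::finite, 'w) cov_point \<Rightarrow> complex) \<Rightarrow> 'a \<Rightarrow> _"
  assumes sys: "open \<Omega>" "\<And>I. local_fun \<Omega> (F I)" "regular_system \<Omega> F"
    and cov: "diff_covering \<Omega> F \<Theta> X"
    and eq: "op_eq_on \<Omega> (Sol \<Omega> F) P Q"
    and nat: "\<And>z. covering_point \<Omega> \<Theta> X z \<Longrightarrow> covering_point.natural \<Omega> \<Theta> X z P' P"
      "\<And>z. covering_point \<Omega> \<Theta> X z \<Longrightarrow> covering_point.natural \<Omega> \<Theta> X z Q' Q"
  shows "op_eq_on \<Theta> (cov_Sol \<Omega> F \<Theta>) P' Q'"
  unfolding op_eq_on_def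
proof (intro allI impI ballI)
  fix U :: "'b \<Rightarrow> ('d, 'n, 'w) cov_point \<Rightarrow> complex" and z a
  assume U: "\<forall>b. local_fun \<Theta> (U b)" and z: "z \<in> cov_Sol \<Omega> F \<Theta>"
  interpret tangent_derivations \<Theta> "cov_coeff X" "cov_deriv X" "cov_Sol \<Omega> F \<Theta>"
    by (rule tangent_diff_covering[OF sys cov])
  have comm: "commuting i j" for i j
    using cov unfolding commuting_def diff_covering_def by blast
  interpret covering_point \<Omega> \<Theta> X z
    by (rule covering_point_diff_covering[OF sys(1) cov]) (use z in \<open>simp add: cov_Sol_def\<close>)
  obtain K where K: "\<And>k U V. \<forall>b. local_fun \<Theta> (U b) \<and> local_fun \<Omega> (V b) \<and> agree (k + K) (U b) (V b) \<Longrightarrow>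
      \<forall>a. local_fun \<Theta> (P' U a) \<and> local_fun \<Omega> (P V a) \<and> agree k (P' U a) (P V a)"
    using nat(1)[OF covering_point_axioms] unfolding natural_def by auto
  obtain L where L: "\<And>k U V. \<forall>b. local_fun \<Theta> (U b) \<and> local_fun \<Omega> (V b) \<and> agree (k + L) (U b) (V b) \<Longrightarrow>
      \<forall>a. local_fun \<Theta> (Q' U a) \<and> local_fun \<Omega> (Q V a) \<and> agree k (Q' U a) (Q V a)"
    using nat(2)[OF covering_point_axioms] unfolding natural_def by auto
  \<comment> \<open>\<open>K\<close> and \<open>L\<close> are the orders lost by the two operators,
    so agreement to order \<open>K + L\<close> leaves agreement of values for both.\<close>
  have "\<exists>V. local_fun \<Omega> V \<and> agree (K + L) (U b) V" for b
  proof -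
    obtain V where V: "local_fun UNIV V"
      "\<And>js. length js \<le> K + L \<Longrightarrow>
        foldr total_deriv js V z0 = multi_deriv (cov_deriv X) (count (mset js)) (U b) z"
      by (rule prescribed_jet[of "K + L" z0 "\<lambda>J. multi_deriv (cov_deriv X) J (U b) z"]) (rule that)
    have "agree (K + L) (U b) V"
    proof (rule agree_to_order_foldrI)
      fix js :: "'d list" assume js: "length js \<le> K + L"
      \<comment> \<open>The polynomial knows a word only by its letter counts. Commutation on the
        covering ensures that the derivatives of \<open>U b\<close> do not depend on more than
        that.\<close>
      have "mset js = mset (multi_list (count (mset js)))"
        by (rule multiset_eqI) (simp add: count_multi_list)
      then have "foldr (cov_deriv X) js (U b) z = foldr (cov_deriv X) (multi_list (count (mset js))) (U b) z"
        by (rule foldr_D_permute) (use comm U z in auto)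
      then show "foldr (cov_deriv X) js (U b) z = foldr total_deriv js V z0"
        using V(2)[OF js] by (simp add: multi_deriv_foldr)
    qed
    then show ?thesis
      using local_fun_subset[OF V(1)] by blast
  qed
  then obtain V where V: "\<And>b. local_fun \<Omega> (V b)" "\<And>b. agree (K + L) (U b) (V b)"
    by metis
  have "agree 0 (P' U a) (P V a)"
    using K[of U V 0] U V agree_to_order_mono[OF V(2), of K] by auto
  moreover have "agree 0 (Q' U a) (Q V a)"
    using L[of U V 0] U V agree_to_order_mono[OF V(2), of L] by auto
  moreover have "P V a z0 = Q V a z0"
    using eq V(1) z unfolding op_eq_on_def z0_def by (auto simp: cov_Sol_def)
  ultimately show "P' U a z = Q' U a z"
    by simp
qed

section \<open>Relations between symmetries\<close>

lemma local_fun_apply_scalar_op: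
  assumes D: "derivations \<Theta> \<xi> D"
    and "\<And>a. local_fun \<Omega> a \<Longrightarrow> local_fun \<Theta> (\<lambda>z. a (\<pi> z))"
    and "local_scalar_op \<Omega> P" "\<And>b. local_fun \<Theta> (U b)"
  shows "local_fun \<Theta> (apply_scalar_op \<pi> D P U \<alpha>)"
proof -
  have "local_fun \<Omega> (fst P \<alpha> \<beta>)" "local_fun \<Omega> (snd P j)" for \<beta> j
    using assms(3) by (auto simp: local_scalar_op_def)
  then show ?thesis
    unfolding apply_scalar_op_def[abs_def] scalar_symbol_def
    by (intro local_fun_intros assms(2,4) derivations.D_local[OF D])
qed

lemma local_fun_linearization:
  assumes D: "derivations \<Theta> \<xi> D" and "open \<Omega>"
    and "\<And>a. local_fun \<Omega> a \<Longrightarrow> local_fun \<Theta> (\<lambda>z. a (\<pi> z))" "\<And>z. z \<in> \<Theta> \<Longrightarrow> \<pi> z \<in> \<Omega>"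
    and F: "local_fun \<Omega> (F I)" and "\<And>b. local_fun \<Theta> (U b)"
  shows "local_fun \<Theta> (linearization \<pi> D F U I)"
proof -
  obtain C where C: "finite C" "determined_by \<Omega> C (F I)"
    using local_fun_determined[OF F] .
  show ?thesis
    by (rule local_fun_eq_on[OF derivations.open_domain[OF D] _ linearization_finite[of \<Omega> C F I, OF assms(2) C(2,1) assms(4), symmetric]])
       (intro local_fun_intros multi_deriv_local[OF D] assms(3,6) local_fun_partial[OF assms(2)] F | assumption)+
qed

lemma apply_scalar_op_cong_S:
  assumes T: "tangent_derivations \<Theta> \<xi> D S"
    and "\<And>b. local_fun \<Theta> (U b)" "\<And>b. local_fun \<Theta> (V b)" "\<And>b y. y \<in> S \<Longrightarrow> U b y = V b y" "z \<in> S"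
  shows "apply_scalar_op \<pi> D P U \<alpha> z = apply_scalar_op \<pi> D P V \<alpha> z"
  unfolding apply_scalar_op_def scalar_symbol_def
  by (simp add: assms(4,5) tangent_derivations.D_cong_S[OF T assms(2-5)])

lemma apply_matrix_op_zero_S:
  assumes T: "tangent_derivations \<Theta> \<xi> D S"
    and "\<And>b. local_fun \<Theta> (U b)" "\<And>b y. y \<in> S \<Longrightarrow> U b y = 0" "z \<in> S"
  shows "apply_matrix_op \<pi> D P U a z = 0"
  unfolding apply_matrix_op_def by (simp add: assms(3,4) tangent_derivations.tangent[OF T assms(2-4)])

abbreviation cov_scalar_op where
  "cov_scalar_op X \<equiv> apply_scalar_op (\<lambda>z. z \<circ> Inl) (cov_deriv X)"

lemma diff_covering_over: "diff_covering \<Omega> F \<Theta> X \<Longrightarrow> z \<in> \<Theta> \<Longrightarrow> z \<circ> Inl \<in> \<Omega>"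
  by (simp add: diff_covering_def)

lemma diff_covering_pullback:
  "diff_covering \<Omega> F \<Theta> X \<Longrightarrow> local_fun \<Omega> a \<Longrightarrow> local_fun \<Theta> (\<lambda>z. a (z \<circ> Inl))"
  by (rule local_fun_pullback) (auto simp: diff_covering_def)

lemma relatedD:
  assumes "related \<Omega> F A1 A2 B1 B2 \<Theta> X U U'" "z \<in> cov_Sol \<Omega> F \<Theta>"
  shows "cov_scalar_op X A1 U' \<alpha> z = cov_scalar_op X B1 U \<alpha> z"
    "cov_scalar_op X A2 U' \<alpha> z = cov_scalar_op X B2 U \<alpha> z"
  using assms unfolding related_def Let_def by auto

lemma related_nonlocal_symmetry:
  fixes F :: "'m::finite \<Rightarrow> ('d::{finite,linorder}, 'n::finite) jet \<Rightarrow> complex"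
  assumes sys: "open \<Omega>" "\<And>I. local_fun \<Omega> (F I)" "regular_system \<Omega> F"
    and ops: "local_scalar_op \<Omega> A1" "local_scalar_op \<Omega> A2" "local_scalar_op \<Omega> B1"
      "local_scalar_op \<Omega> B2" "local_matrix_op \<Omega> M"
    and B: "op_eq_on \<Omega> (Sol \<Omega> F) (\<lbrakk>B1\<rbrakk>\<^sub>s \<circ> \<lbrakk>B2\<rbrakk>\<^sub>s \<ominus>\<^sub>o \<lbrakk>B2\<rbrakk>\<^sub>s \<circ> \<lbrakk>B1\<rbrakk>\<^sub>s) op_zero"
    and M: "op_eq_on \<Omega> (Sol \<Omega> F) (\<ell> F) (\<lbrakk>M\<rbrakk>\<^sub>m \<circ> (\<lbrakk>B1\<rbrakk>\<^sub>s \<circ> \<lbrakk>A2\<rbrakk>\<^sub>s \<ominus>\<^sub>o \<lbrakk>B2\<rbrakk>\<^sub>s \<circ> \<lbrakk>A1\<rbrakk>\<^sub>s))"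
    and cov: "diff_covering \<Omega> F \<Theta> X"
    and loc: "\<And>\<alpha>. local_fun \<Theta> (U \<alpha>)" "\<And>\<alpha>. local_fun \<Theta> (U' \<alpha>)"
    and rel: "related \<Omega> F A1 A2 B1 B2 \<Theta> X U U'"
  shows "nonlocal_symmetry \<Omega> F \<Theta> X U'"
  unfolding nonlocal_symmetry_def
proof (intro conjI allI ballI loc)
  fix z I assume z: "z \<in> cov_Sol \<Omega> F \<Theta>"
  interpret tangent_derivations \<Theta> "cov_coeff X" "cov_deriv X" "cov_Sol \<Omega> F \<Theta>"
    by (rule tangent_diff_covering[OF sys cov])
  have ap_local: "local_fun \<Theta> (cov_scalar_op X P V \<alpha>)"
    if "local_scalar_op \<Omega> P" "\<And>b. local_fun \<Theta> (V b)" for P :: "('d, 'n) scalar_op" and V \<alpha>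
    by (rule local_fun_apply_scalar_op[OF derivations_axioms diff_covering_pullback[OF cov] that])
  note natural = covering_point.natural_compose covering_point.natural_diff covering_point.natural_zero
    covering_point.natural_scalar_op[OF _ ops(1)] covering_point.natural_scalar_op[OF _ ops(2)]
    covering_point.natural_scalar_op[OF _ ops(3)] covering_point.natural_scalar_op[OF _ ops(4)]
    covering_point.natural_matrix_op[OF _ ops(5)] covering_point.natural_linearization[OF _ sys(2)]
  let ?W = "(cov_scalar_op X B1 \<circ> cov_scalar_op X A2 \<ominus>\<^sub>o cov_scalar_op X B2 \<circ> cov_scalar_op X A1) U'"
  have "op_eq_on \<Theta> (cov_Sol \<Omega> F \<Theta>)
      (cov_scalar_op X B1 \<circ> cov_scalar_op X B2 \<ominus>\<^sub>o cov_scalar_op X B2 \<circ> cov_scalar_op X B1) op_zero"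
    by (rule op_eq_on_covering[OF sys cov B]) (intro natural; assumption)+
  then have B_comm: "cov_scalar_op X B1 (cov_scalar_op X B2 U) \<alpha> y =
      cov_scalar_op X B2 (cov_scalar_op X B1 U) \<alpha> y" if "y \<in> cov_Sol \<Omega> F \<Theta>" for \<alpha> y
    using loc that unfolding op_eq_on_def by (auto simp: op_diff_def op_zero_def)
  have W: "?W \<alpha> y = 0" if y: "y \<in> cov_Sol \<Omega> F \<Theta>" for \<alpha> y
  proof -
    \<comment> \<open>The relations hold on \<open>cov_Sol\<close> only; tangency permits the
      application of \<open>B1\<close> and \<open>B2\<close> to both sides.\<close>
    have "cov_scalar_op X B1 (cov_scalar_op X A2 U') \<alpha> y = cov_scalar_op X B1 (cov_scalar_op X B2 U) \<alpha> y"
      by (intro apply_scalar_op_cong_S[OF tangent_derivations_axioms] ap_local relatedD(2)[OF rel] y ops loc)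
    moreover have "cov_scalar_op X B2 (cov_scalar_op X A1 U') \<alpha> y = cov_scalar_op X B2 (cov_scalar_op X B1 U) \<alpha> y"
      by (intro apply_scalar_op_cong_S[OF tangent_derivations_axioms] ap_local relatedD(1)[OF rel] y ops loc)
    ultimately show ?thesis
      using B_comm[OF y] by (simp add: op_diff_def)
  qed
  have W_local: "local_fun \<Theta> (?W \<alpha>)" for \<alpha>
  proof -
    have "?W \<alpha> = (\<lambda>z. cov_scalar_op X B1 (cov_scalar_op X A2 U') \<alpha> z
        - cov_scalar_op X B2 (cov_scalar_op X A1 U') \<alpha> z)"
      by (simp add: op_diff_def fun_eq_iff)
    then show ?thesis
      by (simp only:) (intro local_fun_diff ap_local ops loc)
  qed
  have "op_eq_on \<Theta> (cov_Sol \<Omega> F \<Theta>) (linearization (\<lambda>z. z \<circ> Inl) (cov_deriv X) F)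
      (apply_matrix_op (\<lambda>z. z \<circ> Inl) (cov_deriv X) M \<circ>
       (cov_scalar_op X B1 \<circ> cov_scalar_op X A2 \<ominus>\<^sub>o cov_scalar_op X B2 \<circ> cov_scalar_op X A1))"
    by (rule op_eq_on_covering[OF sys cov M]) (intro natural; assumption)+
  then have "linearization (\<lambda>z. z \<circ> Inl) (cov_deriv X) F U' I z =
      apply_matrix_op (\<lambda>z. z \<circ> Inl) (cov_deriv X) M ?W I z"
    using loc z unfolding op_eq_on_def by auto
  also have "\<dots> = 0"
    by (rule apply_matrix_op_zero_S[OF tangent_derivations_axioms W_local W z])
  finally show "linearization (\<lambda>z. z \<circ> Inl) (cov_deriv X) F U' I z = 0" .
qed

text \<open>The integrability condition for the relations: applying \<open>A1\<close> to the second
  and \<open>A2\<close> to the first must give equal right-hand sides once \<open>A1\<close> and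
  \<open>A2\<close> commute. \<open>L\<close> differentiates, but the linearization of
  \<open>U\<close> vanishes along all of \<open>cov_Sol\<close>, to which the derivatives are
  tangent.\<close>

lemma symmetry_compatibility:
  fixes F :: "'m::finite \<Rightarrow> ('d::{finite,linorder}, 'n::finite) jet \<Rightarrow> complex"
  assumes sys: "open \<Omega>" "\<And>I. local_fun \<Omega> (F I)" "regular_system \<Omega> F"
    and ops: "local_scalar_op \<Omega> A1" "local_scalar_op \<Omega> A2" "local_scalar_op \<Omega> B1"
      "local_scalar_op \<Omega> B2" "local_matrix_op \<Omega> L"
    and L: "op_eq_on \<Omega> (Sol \<Omega> F) (\<lbrakk>A1\<rbrakk>\<^sub>s \<circ> \<lbrakk>B2\<rbrakk>\<^sub>s \<ominus>\<^sub>o \<lbrakk>A2\<rbrakk>\<^sub>s \<circ> \<lbrakk>B1\<rbrakk>\<^sub>s) (\<lbrakk>L\<rbrakk>\<^sub>m \<circ> \<ell> F)"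
    and cov: "diff_covering \<Omega> F \<Theta> X"
    and sym: "nonlocal_symmetry \<Omega> F \<Theta> X U" and z: "z \<in> cov_Sol \<Omega> F \<Theta>"
  shows "cov_scalar_op X A1 (cov_scalar_op X B2 U) \<alpha> z = cov_scalar_op X A2 (cov_scalar_op X B1 U) \<alpha> z"
proof -
  interpret tangent_derivations \<Theta> "cov_coeff X" "cov_deriv X" "cov_Sol \<Omega> F \<Theta>"
    by (rule tangent_diff_covering[OF sys cov])
  note natural = covering_point.natural_compose covering_point.natural_diff covering_point.natural_zero
    covering_point.natural_scalar_op[OF _ ops(1)] covering_point.natural_scalar_op[OF _ ops(2)]
    covering_point.natural_scalar_op[OF _ ops(3)] covering_point.natural_scalar_op[OF _ ops(4)]
    covering_point.natural_matrix_op[OF _ ops(5)] covering_point.natural_linearization[OF _ sys(2)]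
  have loc: "local_fun \<Theta> (U \<alpha>)" for \<alpha>
    using sym by (simp add: nonlocal_symmetry_def)
  have "op_eq_on \<Theta> (cov_Sol \<Omega> F \<Theta>)
      (cov_scalar_op X A1 \<circ> cov_scalar_op X B2 \<ominus>\<^sub>o cov_scalar_op X A2 \<circ> cov_scalar_op X B1)
      (apply_matrix_op (\<lambda>z. z \<circ> Inl) (cov_deriv X) L \<circ> linearization (\<lambda>z. z \<circ> Inl) (cov_deriv X) F)"
    by (rule op_eq_on_covering[OF sys cov L]) (intro natural; assumption)+
  then have "cov_scalar_op X A1 (cov_scalar_op X B2 U) \<alpha> z - cov_scalar_op X A2 (cov_scalar_op X B1 U) \<alpha> z =
      apply_matrix_op (\<lambda>z. z \<circ> Inl) (cov_deriv X) L (linearization (\<lambda>z. z \<circ> Inl) (cov_deriv X) F U) \<alpha> z"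
    using loc z unfolding op_eq_on_def by (auto simp: op_diff_def)
  also have "\<dots> = 0"
  proof (rule apply_matrix_op_zero_S[OF tangent_derivations_axioms _ _ z])
    show "local_fun \<Theta> (linearization (\<lambda>z. z \<circ> Inl) (cov_deriv X) F U I)" for I
      by (rule local_fun_linearization[where \<pi> = "\<lambda>z. z \<circ> Inl" and F = F and I = I and U = U,
            OF derivations_axioms sys(1) diff_covering_pullback[OF cov] diff_covering_over[OF cov] sys(2) loc])
    show "linearization (\<lambda>z. z \<circ> Inl) (cov_deriv X) F U I y = 0" if "y \<in> cov_Sol \<Omega> F \<Theta>" for I y
      using sym that by (simp add: nonlocal_symmetry_def)
  qed
  finally show ?thesis by simp
qed

lemma (in derivations) D_linear_form:
  fixes a0 :: "'b::finite \<Rightarrow> ('c \<Rightarrow> complex) \<Rightarrow> complex" and a :: "'e::finite \<Rightarrow> _"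
  assumes "\<And>b. local_fun \<Theta> (a0 b)" "\<And>k. local_fun \<Theta> (a k)" "\<And>b. local_fun \<Theta> (U b)"
    "\<And>k. local_fun \<Theta> (W k)" "z \<in> \<Theta>"
  shows "D i (\<lambda>z. (\<Sum>b\<in>UNIV. a0 b z * U b z) + (\<Sum>k\<in>UNIV. a k z * W k z)) z =
    (\<Sum>b\<in>UNIV. D i (a0 b) z * U b z + a0 b z * D i (U b) z) +
    (\<Sum>k\<in>UNIV. D i (a k) z * W k z + a k z * D i (W k) z)"
  using assms
  by (simp add: D_add D_sum D_mult local_fun_sum local_fun_mult)

section \<open>Second-order mismatch and commutators\<close>

context covering_point
begin

text \<open>By the product rule every term is determined by first-order data, where \<open>U\<close>
  and \<open>V\<close> agree, except those in which D_i meets a D_j already applied.\<close>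

lemma first_order_defect:
  fixes P :: "('d, 'n) scalar_op"
  assumes "local_scalar_op \<Omega> P" "\<And>b. local_fun \<Theta> (U b)" "\<And>b. local_fun \<Omega> (V b)"
    and agree: "\<And>b. agree 1 (U b) (V b)"
  shows "cov_deriv X i (cov_scalar_op X P U \<alpha>) \<zeta> - total_deriv i (\<lbrakk>P\<rbrakk>\<^sub>s V \<alpha>) z0 =
    (\<Sum>j\<in>UNIV. snd P j z0 *
      (cov_deriv X i (cov_deriv X j (U \<alpha>)) \<zeta> - total_deriv i (total_deriv j (V \<alpha>)) z0))"
proof -
  have eq: "cov_scalar_op X P U \<alpha> =
      (\<lambda>z. (\<Sum>b\<in>UNIV. fst P \<alpha> b (z \<circ> Inl) * U b z) + (\<Sum>j\<in>UNIV. snd P j (z \<circ> Inl) * cov_deriv X j (U \<alpha>) z))"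
    "\<lbrakk>P\<rbrakk>\<^sub>s V \<alpha> =
      (\<lambda>z. (\<Sum>b\<in>UNIV. fst P \<alpha> b z * V b z) + (\<Sum>j\<in>UNIV. snd P j z * total_deriv j (V \<alpha>) z))"
    by (auto simp: apply_scalar_op_def scalar_symbol_def fun_eq_iff)
  have P: "local_fun \<Omega> (fst P \<alpha> \<beta>)" "local_fun \<Omega> (snd P j)" for \<alpha> \<beta> j
    using assms(1) by (auto simp: local_scalar_op_def)
  have ag: "U b \<zeta> = V b z0" "cov_deriv X j (U b) \<zeta> = total_deriv j (V b) z0" for b j
    using agree[of b] by simp_all
  have pull: "cov_deriv X i (\<lambda>z. f (z \<circ> Inl)) \<zeta> = total_deriv i f z0" if "local_fun \<Omega> f" for f
    unfolding z0_def by (rule cov_deriv_pullback[OF that point])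
  have "cov_deriv X i (cov_scalar_op X P U \<alpha>) \<zeta> =
    (\<Sum>b\<in>UNIV. total_deriv i (fst P \<alpha> b) z0 * V b z0 + fst P \<alpha> b z0 * total_deriv i (V b) z0) +
    (\<Sum>j\<in>UNIV. total_deriv i (snd P j) z0 * total_deriv j (V \<alpha>) z0
       + snd P j z0 * cov_deriv X i (cov_deriv X j (U \<alpha>)) \<zeta>)"
    unfolding eq(1)
    by (subst cover.D_linear_form)
       (auto simp only: ag pull[OF P(1)] pull[OF P(2)] z0_def[symmetric]
         intro!: assms point cover.D_local local_fun_pullback_Inl P)
  moreover have "total_deriv i (\<lbrakk>P\<rbrakk>\<^sub>s V \<alpha>) z0 =
    (\<Sum>b\<in>UNIV. total_deriv i (fst P \<alpha> b) z0 * V b z0 + fst P \<alpha> b z0 * total_deriv i (V b) z0) +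
    (\<Sum>j\<in>UNIV. total_deriv i (snd P j) z0 * total_deriv j (V \<alpha>) z0
       + snd P j z0 * total_deriv i (total_deriv j (V \<alpha>)) z0)"
    unfolding eq(2)
    by (subst base.D_linear_form) (auto intro!: assms z0 base.D_local P)
  ultimately show ?thesis
    by (simp add: sum.distrib sum_subtractf right_diff_distrib)
qed

text \<open>The matrix part of \<open>P\<close> multiplies values that agree, so only products of
  leading coefficients survive. These are scalars, which is why the component
  \<open>\<alpha>\<close> alone appears on the right.\<close>

lemma second_order_defect:
  fixes P Q :: "('d, 'n) scalar_op"
  assumes "local_scalar_op \<Omega> P" "local_scalar_op \<Omega> Q"
    and "\<And>b. local_fun \<Theta> (U b)" "\<And>b. local_fun \<Omega> (V b)"
    and agree: "\<And>b. agree 1 (U b) (V b)"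
  shows "cov_scalar_op X P (cov_scalar_op X Q U) \<alpha> \<zeta> - \<lbrakk>P\<rbrakk>\<^sub>s (\<lbrakk>Q\<rbrakk>\<^sub>s V) \<alpha> z0 =
    (\<Sum>i\<in>UNIV. \<Sum>j\<in>UNIV. snd P i z0 * snd Q j z0 *
      (cov_deriv X i (cov_deriv X j (U \<alpha>)) \<zeta> - total_deriv i (total_deriv j (V \<alpha>)) z0))"
proof -
  have ag: "U b \<zeta> = V b z0" "cov_deriv X j (U b) \<zeta> = total_deriv j (V b) z0" for b j
    using agree[of b] by simp_all
  have "cov_scalar_op X Q U b \<zeta> = \<lbrakk>Q\<rbrakk>\<^sub>s V b z0" for b
    unfolding apply_scalar_op_def scalar_symbol_def z0_def[symmetric] by (simp add: ag)
  then have "cov_scalar_op X P (cov_scalar_op X Q U) \<alpha> \<zeta> - \<lbrakk>P\<rbrakk>\<^sub>s (\<lbrakk>Q\<rbrakk>\<^sub>s V) \<alpha> z0 =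
      (\<Sum>i\<in>UNIV. snd P i z0 *
        (cov_deriv X i (cov_scalar_op X Q U \<alpha>) \<zeta> - total_deriv i (\<lbrakk>Q\<rbrakk>\<^sub>s V \<alpha>) z0))"
    unfolding apply_scalar_op_def[of _ _ P] scalar_symbol_def z0_def[symmetric]
    by (simp add: right_diff_distrib sum_subtractf)
  then show ?thesis
    unfolding first_order_defect[OF assms(2-5)] by (simp add: sum_distrib_left mult.assoc)
qed

text \<open>The total derivatives on \<open>\<Theta>\<close> need not commute here: the lemma serves to show that they do.\<close>

lemma commutator_defect:
  fixes P Q :: "('d, 'n) scalar_op" and F :: "'m \<Rightarrow> ('d, 'n) jet \<Rightarrow> complex"
  assumes "local_scalar_op \<Omega> P" "local_scalar_op \<Omega> Q"
    and U: "\<And>b. local_fun \<Theta> (U b)"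
    and PQ: "op_eq_on \<Omega> (Sol \<Omega> F) (\<lbrakk>P\<rbrakk>\<^sub>s \<circ> \<lbrakk>Q\<rbrakk>\<^sub>s \<ominus>\<^sub>o \<lbrakk>Q\<rbrakk>\<^sub>s \<circ> \<lbrakk>P\<rbrakk>\<^sub>s) op_zero"
    and sol: "\<zeta> \<circ> Inl \<in> Sol \<Omega> F"
  shows "cov_scalar_op X P (cov_scalar_op X Q U) \<alpha> \<zeta> - cov_scalar_op X Q (cov_scalar_op X P U) \<alpha> \<zeta> =
    (\<Sum>i\<in>UNIV. \<Sum>j\<in>UNIV. snd P i (\<zeta> \<circ> Inl) * snd Q j (\<zeta> \<circ> Inl) *
      (cov_deriv X i (cov_deriv X j (U \<alpha>)) \<zeta> - cov_deriv X j (cov_deriv X i (U \<alpha>)) \<zeta>))"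
proof -
  have "\<exists>V. local_fun \<Omega> V \<and> agree 1 (U b) V" for b
  proof -
    obtain V where V: "local_fun UNIV V"
      "\<And>js. length js \<le> 1 \<Longrightarrow> foldr total_deriv js V z0 = multi_deriv (cov_deriv X) (count (mset js)) (U b) \<zeta>"
      by (rule prescribed_jet[of 1 z0 "\<lambda>J. multi_deriv (cov_deriv X) J (U b) \<zeta>"]) (rule that)
    have "agree 1 (U b) V"
    proof (rule agree_to_order_foldrI)
      fix js :: "'d list" assume js: "length js \<le> 1"
      have "mset (multi_list (count (mset js))) = mset js"
        by (rule multiset_eqI) (simp add: count_multi_list)
      \<comment> \<open>Words of length at most one admit no reordering, so prescribing the jet by
        letter counts loses nothing on a covering whose derivatives may fail to commute.\<close>
      with js have "multi_list (count (mset js)) = js"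
        by (cases js) auto
      then show "foldr (cov_deriv X) js (U b) \<zeta> = foldr total_deriv js V z0"
        using V(2)[OF js] by (simp add: multi_deriv_foldr)
    qed
    then show ?thesis
      using local_fun_subset[OF V(1)] by blast
  qed
  then obtain V where V: "\<And>b. local_fun \<Omega> (V b)" "\<And>b. agree 1 (U b) (V b)"
    by metis
  \<comment> \<open>The derivatives of \<open>V\<close> commute, so antisymmetrizing
    \<open>E\<close> eliminates \<open>V\<close> and leaves the commutator on
    \<open>U\<close>.\<close>
  define E where "E i j = cov_deriv X i (cov_deriv X j (U \<alpha>)) \<zeta> - total_deriv i (total_deriv j (V \<alpha>)) z0" for i j
  have "\<lbrakk>P\<rbrakk>\<^sub>s (\<lbrakk>Q\<rbrakk>\<^sub>s V) \<alpha> z0 = \<lbrakk>Q\<rbrakk>\<^sub>s (\<lbrakk>P\<rbrakk>\<^sub>s V) \<alpha> z0"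
    using PQ V(1) sol unfolding op_eq_on_def z0_def by (auto simp: op_diff_def op_zero_def)
  then have "cov_scalar_op X P (cov_scalar_op X Q U) \<alpha> \<zeta> - cov_scalar_op X Q (cov_scalar_op X P U) \<alpha> \<zeta> =
      (\<Sum>i\<in>UNIV. \<Sum>j\<in>UNIV. snd P i z0 * snd Q j z0 * E i j)
      - (\<Sum>i\<in>UNIV. \<Sum>j\<in>UNIV. snd Q i z0 * snd P j z0 * E i j)"
    unfolding E_def second_order_defect[where \<alpha> = \<alpha> and U = U and V = V, OF assms(1,2) U V, symmetric]
      second_order_defect[where \<alpha> = \<alpha> and U = U and V = V, OF assms(2,1) U V, symmetric]
    by simp
  \<comment> \<open>The leading coefficients are scalars: exchanging \<open>P\<close> and
    \<open>Q\<close> amounts to exchanging the indices of \<open>E\<close>.\<close>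
  also have "(\<Sum>i\<in>UNIV. \<Sum>j\<in>UNIV. snd Q i z0 * snd P j z0 * E i j) =
      (\<Sum>i\<in>UNIV. \<Sum>j\<in>UNIV. snd P i z0 * snd Q j z0 * E j i)"
    by (subst sum.swap) (simp add: mult_ac)
  also have "(\<Sum>i\<in>UNIV. \<Sum>j\<in>UNIV. snd P i z0 * snd Q j z0 * E i j) - \<dots> =
      (\<Sum>i\<in>UNIV. \<Sum>j\<in>UNIV. snd P i z0 * snd Q j z0 * (E i j - E j i))"
    by (simp add: sum_subtractf right_diff_distrib)
  finally have "cov_scalar_op X P (cov_scalar_op X Q U) \<alpha> \<zeta> - cov_scalar_op X Q (cov_scalar_op X P U) \<alpha> \<zeta> =
      (\<Sum>i\<in>UNIV. \<Sum>j\<in>UNIV. snd P i z0 * snd Q j z0 * (E i j - E j i))" .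
  moreover have "E i j - E j i = cov_deriv X i (cov_deriv X j (U \<alpha>)) \<zeta> - cov_deriv X j (cov_deriv X i (U \<alpha>)) \<zeta>" for i j
    unfolding E_def by (simp add: total_deriv_commute[OF open_base V(1) z0, of i j])
  ultimately show ?thesis
    unfolding z0_def by simp
qed

end

section \<open>The covering on which the new symmetry is defined\<close>

text \<open>The determinant of the relations as equations for \<open>D_p U'\<close> and
  \<open>D_q U'\<close>. Scalar leading coefficients make them the same 2x2 system for every
  component.\<close>

definition det_symbol :: "('d, 'n) scalar_op \<Rightarrow> ('d, 'n) scalar_op \<Rightarrow> 'd \<Rightarrow> 'd \<Rightarrow> ('d, 'n) jet \<Rightarrow> complex" where
  "det_symbol A1 A2 p q z = snd A1 p z * snd A2 q z - snd A1 q z * snd A2 p z"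

text \<open>Expressibility makes the 2x2 system uniquely solvable, whereas a vanishing determinant
  provides a kernel vector, that is, two different choices of \<open>v p\<close>, \<open>v q\<close>
  with equal remaining data.\<close>

lemma expressible_det_nonzero:
  fixes A1 A2 B1 B2 :: "('d::finite, 'n::finite) scalar_op"
  assumes "expressible S A1 A2 B1 B2 p q" "p \<noteq> q" "z \<in> S"
  shows "det_symbol A1 A2 p q z \<noteq> 0"
proof
  assume det: "det_symbol A1 A2 p q z = 0"
  obtain Gp Gq where G: "\<And>v0 v u0 u.
        scalar_symbol A1 z v0 v = scalar_symbol B1 z u0 u \<Longrightarrow>
        scalar_symbol A2 z v0 v = scalar_symbol B2 z u0 u \<Longrightarrow>
          v p = Gp z v0 (restrict v (- {p, q})) u0 u \<and>
          v q = Gq z v0 (restrict v (- {p, q})) u0 u"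
    using assms(1,3) unfolding expressible_def by metis
  \<comment> \<open>All other quantities are set to zero, so the relations become the homogeneous
    2x2 system in \<open>a\<close> and \<open>b\<close>.\<close>
  define w :: "complex \<Rightarrow> complex \<Rightarrow> 'd \<Rightarrow> 'n \<Rightarrow> complex" where
    "w a b j \<beta> = (if j = p then a else if j = q then b else 0)" for a b j \<beta>
  have symbol: "scalar_symbol P z (\<lambda>_. 0) (w a b) \<alpha> = snd P p z * a + snd P q z * b"
    for P :: "('d, 'n) scalar_op" and a b \<alpha>
  proof -
    have "(\<Sum>j\<in>UNIV. snd P j z * w a b j \<alpha>) = (\<Sum>j\<in>{p, q}. snd P j z * w a b j \<alpha>)"
      by (rule sum.mono_neutral_right) (auto simp: w_def)
    then show ?thesis
      using assms(2) by (simp add: scalar_symbol_def w_def)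
  qed
  have symbol0: "scalar_symbol P z (\<lambda>_. 0) (\<lambda>_ _. 0) = (\<lambda>_. 0)" for P :: "('d, 'n) scalar_op"
    by (simp add: scalar_symbol_def fun_eq_iff)
  have restrict: "restrict (w a b) (- {p, q}) = restrict (w 0 0) (- {p, q})" for a b
    by (auto simp: restrict_def w_def fun_eq_iff)
  have unique: "a = 0 \<and> b = 0"
    if "snd A1 p z * a + snd A1 q z * b = 0" "snd A2 p z * a + snd A2 q z * b = 0" for a b
  proof -
    have "w a b p = w 0 0 p" "w a b q = w 0 0 q"
      using G[of "\<lambda>_. 0" "w a b" "\<lambda>_. 0" "\<lambda>_ _. 0"] G[of "\<lambda>_. 0" "w 0 0" "\<lambda>_. 0" "\<lambda>_ _. 0"]
      unfolding restrict[of a b] by (simp_all add: symbol symbol0 fun_eq_iff that)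
    then show ?thesis
      using assms(2) by (simp add: w_def fun_eq_iff)
  qed
  \<comment> \<open>Each row turned by a right angle is annihilated by itself and, the determinant
    being zero, by the other row. By uniqueness all four coefficients vanish, and then (1, 0) solves
    the system too.\<close>
  have "snd A1 q z = 0 \<and> snd A1 p z = 0" "snd A2 q z = 0 \<and> snd A2 p z = 0"
    using unique[of "- snd A1 q z" "snd A1 p z"] unique[of "- snd A2 q z" "snd A2 p z"] det
    by (auto simp: det_symbol_def algebra_simps)
  then show False
    using unique[of 1 0] by simp
qed

text \<open>The derivative in direction \<open>j\<close> sees only the \<open>j\<close>-th row of
  \<open>X\<close>; this is what makes the definition of \<open>X'\<close> free of
  circularity.\<close>

lemma cov_deriv_cong: "X j = Y j \<Longrightarrow> cov_deriv X j = cov_deriv Y j"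
  by (simp add: cov_deriv_def fun_eq_iff)

lemma inj_map_sum_Inl: "inj (map_sum id Inl)"
  by (rule injI) (auto simp: map_sum_def split: sum.splits)

lemma cov_forget_Inl: "cov_forget z \<circ> Inl = z \<circ> Inl"
  by (auto simp: cov_forget_def fun_eq_iff)

lemma diff_covering_commute:
  assumes "diff_covering \<Omega> F \<Theta> X" "local_fun \<Theta> f" "z \<in> cov_Sol \<Omega> F \<Theta>"
  shows "cov_deriv X i (cov_deriv X j f) z = cov_deriv X j (cov_deriv X i f) z"
  using assms unfolding diff_covering_def by simp

locale adjoined_covering =
  fixes \<Omega> :: "('d::{finite,linorder}, 'n::finite) jet set"
    and F :: "'m::finite \<Rightarrow> ('d, 'n) jet \<Rightarrow> complex"
    and A1 A2 B1 B2 :: "('d, 'n) scalar_op"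
    and L :: "('d, 'n, 'n, 'm) matrix_op"
    and p q :: 'd
    and \<Theta> :: "('d, 'n, 'w) cov_point set"
    and X :: "'d \<Rightarrow> 'w \<Rightarrow> ('d, 'n, 'w) cov_point \<Rightarrow> complex"
    and U :: "'n \<Rightarrow> ('d, 'n, 'w) cov_point \<Rightarrow> complex"
  assumes sys: "open \<Omega>" "\<And>I. local_fun \<Omega> (F I)" "regular_system \<Omega> F"
    and ops: "local_scalar_op \<Omega> A1" "local_scalar_op \<Omega> A2" "local_scalar_op \<Omega> B1"
      "local_scalar_op \<Omega> B2" "local_matrix_op \<Omega> L"
    and A_comm: "op_eq_on \<Omega> (Sol \<Omega> F) (\<lbrakk>A1\<rbrakk>\<^sub>s \<circ> \<lbrakk>A2\<rbrakk>\<^sub>s \<ominus>\<^sub>o \<lbrakk>A2\<rbrakk>\<^sub>s \<circ> \<lbrakk>A1\<rbrakk>\<^sub>s) op_zero"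
    and L_eq: "op_eq_on \<Omega> (Sol \<Omega> F) (\<lbrakk>A1\<rbrakk>\<^sub>s \<circ> \<lbrakk>B2\<rbrakk>\<^sub>s \<ominus>\<^sub>o \<lbrakk>A2\<rbrakk>\<^sub>s \<circ> \<lbrakk>B1\<rbrakk>\<^sub>s) (\<lbrakk>L\<rbrakk>\<^sub>m \<circ> \<ell> F)"
    and pq: "p \<noteq> q"
    and det_nonzero: "z \<in> Sol \<Omega> F \<Longrightarrow> det_symbol A1 A2 p q z \<noteq> 0"
    and cov: "diff_covering \<Omega> F \<Theta> X"
    and sym: "nonlocal_symmetry \<Omega> F \<Theta> X U"
begin

abbreviation det where "det \<equiv> det_symbol A1 A2 p q"

abbreviation S where "S \<equiv> cov_Sol \<Omega> F \<Theta>"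

lemma U_local: "local_fun \<Theta> (U \<alpha>)"
  using sym by (simp add: nonlocal_symmetry_def)

sublocale old: tangent_derivations \<Theta> "cov_coeff X" "cov_deriv X" S
  by (rule tangent_diff_covering[OF sys cov])

text \<open>Cramer's rule divides by \<open>det\<close>, known to be nonzero only on solutions. Its
  zeros are removed, which takes away no point over \<open>Sol \<Omega> F\<close>.\<close>

definition new_domain :: "('d, 'n, 'w + ('n \<times> ('d \<Rightarrow> nat))) cov_point set" ("\<Theta>''") where
  "\<Theta>' = {z. cov_forget z \<in> \<Theta> \<and> det (z \<circ> Inl) \<noteq> 0}"

abbreviation S' where "S' \<equiv> cov_Sol \<Omega> F \<Theta>'"

abbreviation new_coord :: "'n \<Rightarrow> ('d \<Rightarrow> nat) \<Rightarrow> ('d, 'n) jcoord + ('w + ('n \<times> ('d \<Rightarrow> nat)))" where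
  "new_coord \<alpha> J \<equiv> Inr (Inr (\<alpha>, J))"

abbreviation raise :: "'d \<Rightarrow> ('d \<Rightarrow> nat) \<Rightarrow> 'd \<Rightarrow> nat" where
  "raise j J \<equiv> J(j := Suc (J j))"

abbreviation drop_pq :: "('d \<Rightarrow> nat) \<Rightarrow> 'd \<Rightarrow> nat" where
  "drop_pq J \<equiv> J(p := 0, q := 0)"

text \<open>The relation \<open>A(U') = B(U)\<close> reads \<open>A\<^sup>p D\<^sub>p U' + A\<^sup>q D\<^sub>q U' = remainder A B\<close>.\<close>

definition remainder where
  "remainder A B \<alpha> z = cov_scalar_op X B U \<alpha> (cov_forget z)
     - (\<Sum>\<beta>\<in>UNIV. fst A \<alpha> \<beta> (z \<circ> Inl) * z (new_coord \<beta> (\<lambda>_. 0)))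
     - (\<Sum>j\<in>-{p, q}. snd A j (z \<circ> Inl) * z (new_coord \<alpha> (raise j (\<lambda>_. 0))))"

text \<open>Cramer's rule, with \<open>r = p\<close> giving \<open>D_p U'\<close> and the other
  branch \<open>D_q U'\<close>; the definition of \<open>X'\<close> uses it for these two directions
  only.\<close>

definition solved where
  "solved r \<alpha> z = (if r = p
     then snd A2 q (z \<circ> Inl) * remainder A1 B1 \<alpha> z - snd A1 q (z \<circ> Inl) * remainder A2 B2 \<alpha> z
     else snd A1 p (z \<circ> Inl) * remainder A2 B2 \<alpha> z - snd A2 p (z \<circ> Inl) * remainder A1 B1 \<alpha> z) /
     det (z \<circ> Inl)"

text \<open>The rows \<open>p\<close> and \<open>q\<close> of \<open>X'\<close> call for derivatives
  in the other directions before \<open>X'\<close> exists. This auxiliary field, shifting in every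
  direction, supplies them, since it agrees with \<open>X'\<close> outside \<open>p\<close> and
  \<open>q\<close>.\<close>

definition shift_deriv ::
  "'d \<Rightarrow> 'w + ('n \<times> ('d \<Rightarrow> nat)) \<Rightarrow> ('d, 'n, 'w + ('n \<times> ('d \<Rightarrow> nat))) cov_point \<Rightarrow> complex" where
  "shift_deriv j s z = (case s of Inl s \<Rightarrow> X j s (cov_forget z)
     | Inr (\<alpha>, J) \<Rightarrow> z (new_coord \<alpha> (raise j J)))"

text \<open>The variables \<open>new_coord \<alpha> J\<close> with \<open>J p = J q = 0\<close> stand for the derivatives of \<open>U'\<close>. The others
  are superfluous: \<open>X'\<close> treats \<open>new_coord \<alpha> J\<close> as a further copy of these, ignoring \<open>J p\<close> and \<open>J q\<close>.\<close>

definition new_deriv ::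
  "'d \<Rightarrow> 'w + ('n \<times> ('d \<Rightarrow> nat)) \<Rightarrow> ('d, 'n, 'w + ('n \<times> ('d \<Rightarrow> nat))) cov_point \<Rightarrow> complex" ("X''") where
  "X' j s z = (case s of Inl s \<Rightarrow> X j s (cov_forget z)
     | Inr (\<alpha>, J) \<Rightarrow> if j \<in> {p, q} then multi_deriv (cov_deriv shift_deriv) (drop_pq J) (solved j \<alpha>) z
         else z (new_coord \<alpha> (raise j J)))"

lemma new_deriv_old: "X' j (Inl s) = (\<lambda>z. X j s (cov_forget z))"
  by (simp add: new_deriv_def fun_eq_iff)

lemma new_deriv_shift: "j \<notin> {p, q} \<Longrightarrow> X' j (Inr (\<alpha>, J)) = (\<lambda>z. z (new_coord \<alpha> (raise j J)))"
  by (simp add: new_deriv_def fun_eq_iff)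

lemma new_deriv_eq_shift: "j \<notin> {p, q} \<Longrightarrow> cov_deriv X' j = cov_deriv shift_deriv j"
  by (intro cov_deriv_cong) (auto simp: new_deriv_def shift_deriv_def fun_eq_iff split: sum.split)

lemma set_multi_list_drop: "set (multi_list (drop_pq J)) \<subseteq> -{p, q}"
  by (auto simp: set_multi_list)

text \<open>The word of \<open>drop_pq J\<close> contains neither \<open>p\<close> nor
  \<open>q\<close>, so the auxiliary derivatives can be exchanged for those of \<open>X'\<close>
  itself.\<close>

lemma new_deriv_solved:
  assumes "r \<in> {p, q}"
  shows "X' r (Inr (\<alpha>, J)) = multi_deriv (cov_deriv X') (drop_pq J) (solved r \<alpha>)"
proof -
  have "foldr (cov_deriv shift_deriv) js f = foldr (cov_deriv X') js f" if "set js \<subseteq> -{p, q}" for js f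
    using that by (induction js) (auto simp: new_deriv_eq_shift)
  from this[OF set_multi_list_drop] show ?thesis
    using assms by (auto simp: new_deriv_def fun_eq_iff multi_deriv_foldr)
qed

lemma new_deriv_solved_zero: "r \<in> {p, q} \<Longrightarrow> X' r (Inr (\<alpha>, \<lambda>_. 0)) = solved r \<alpha>"
proof -
  have "drop_pq (\<lambda>_. 0) = (\<lambda>_. 0)"
    by auto
  then show "r \<in> {p, q} \<Longrightarrow> ?thesis"
    by (simp add: new_deriv_solved multi_deriv_foldr multi_list_zero)
qed

lemma det_local: "local_fun \<Omega> det"
  using ops(1,2) unfolding det_symbol_def[abs_def]
  by (intro local_fun_intros) (auto simp: local_scalar_op_def)

lemma new_over: "z \<in> \<Theta>' \<Longrightarrow> z \<circ> Inl \<in> \<Omega>"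
  using diff_covering_over[OF cov, of "cov_forget z"] by (simp add: new_domain_def cov_forget_Inl)

lemma new_forget: "z \<in> \<Theta>' \<Longrightarrow> cov_forget z \<in> \<Theta>"
  by (simp add: new_domain_def)

lemma open_new_domain: "open \<Theta>'"
proof -
  have "open (\<Omega> \<inter> det -` (-{0}))"
    by (rule continuous_open_preimage[OF local_fun_continuous[OF det_local] sys(1)]) auto
  then have "open ((\<lambda>z :: ('d, 'n, 'w + ('n \<times> ('d \<Rightarrow> nat))) cov_point. z \<circ> Inl) -` (\<Omega> \<inter> det -` (-{0})))"
    by (rule open_vimage[OF _ continuous_on_precompose])
  moreover have "open ((\<lambda>z :: ('d, 'n, 'w + ('n \<times> ('d \<Rightarrow> nat))) cov_point. z \<circ> map_sum id Inl) -` \<Theta>)"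
    by (rule open_vimage[OF old.open_domain continuous_on_precompose])
  moreover have "\<Theta>' = ((\<lambda>z. z \<circ> Inl) -` (\<Omega> \<inter> det -` (-{0}))) \<inter> ((\<lambda>z. z \<circ> map_sum id Inl) -` \<Theta>)"
    using new_over by (auto simp: new_domain_def cov_forget_def)
  ultimately show ?thesis
    by (metis open_Int)
qed

lemma local_pullback_forget: "local_fun \<Theta> f \<Longrightarrow> local_fun \<Theta>' (\<lambda>z. f (cov_forget z))"
  unfolding cov_forget_def
  by (rule local_fun_pullback[OF _ inj_map_sum_Inl]) (auto dest: new_forget simp: cov_forget_def)

lemma local_pullback_base: "local_fun \<Omega> a \<Longrightarrow> local_fun \<Theta>' (\<lambda>z. a (z \<circ> Inl))"
  by (rule local_fun_pullback[OF _ _ new_over]) auto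

lemma local_old_scalar_op:
  "local_scalar_op \<Omega> P \<Longrightarrow> (\<And>b. local_fun \<Theta> (V b)) \<Longrightarrow> local_fun \<Theta> (cov_scalar_op X P V \<alpha>)"
  by (rule local_fun_apply_scalar_op[OF old.derivations_axioms diff_covering_pullback[OF cov]])

lemma local_remainder:
  assumes "local_scalar_op \<Omega> A" "local_scalar_op \<Omega> B"
  shows "local_fun \<Theta>' (remainder A B \<alpha>)"
proof -
  have "local_fun \<Omega> (fst A \<alpha> \<beta>)" "local_fun \<Omega> (snd A j)" for \<beta> j
    using assms(1) by (auto simp: local_scalar_op_def)
  then show ?thesis
    unfolding remainder_def[abs_def]
    by (intro local_fun_intros local_pullback_forget local_pullback_base local_old_scalar_op assms U_local)
qed

lemma local_solved: "local_fun \<Theta>' (solved r \<alpha>)"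
proof -
  have nonzero: "det (z \<circ> Inl) \<noteq> 0" if "z \<in> \<Theta>'" for z
    using that unfolding new_domain_def by blast
  have coeff: "local_fun \<Omega> (snd A1 j)" "local_fun \<Omega> (snd A2 j)" for j
    using ops(1,2) by (auto simp: local_scalar_op_def)
  have loc: "local_fun \<Theta>' (\<lambda>z. (snd A j (z \<circ> Inl) * remainder A1 B1 \<alpha> z
          - snd A' j' (z \<circ> Inl) * remainder A2 B2 \<alpha> z) / det (z \<circ> Inl))"
    "local_fun \<Theta>' (\<lambda>z. (snd A j (z \<circ> Inl) * remainder A2 B2 \<alpha> z
          - snd A' j' (z \<circ> Inl) * remainder A1 B1 \<alpha> z) / det (z \<circ> Inl))"
    if "A \<in> {A1, A2}" "A' \<in> {A1, A2}" for A A' j j'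
    using that coeff
    by (auto intro!: local_fun_divide local_fun_diff local_fun_mult local_remainder[OF ops(1,3)]
        local_remainder[OF ops(2,4)] local_pullback_base det_local dest: nonzero)
  show ?thesis
    unfolding solved_def[abs_def] by (cases "r = p") (simp_all add: loc)
qed

lemma local_shift_deriv: "local_fun \<Theta>' (shift_deriv j s)"
proof (cases s)
  case (Inl s')
  then have "shift_deriv j s = (\<lambda>z. X j s' (cov_forget z))"
    by (simp add: shift_deriv_def fun_eq_iff)
  then show ?thesis
    using old.local_coeff[of j "Inr s'"] by (simp add: local_pullback_forget)
next
  case (Inr t)
  then show ?thesis
    by (cases t) (simp add: shift_deriv_def[abs_def] local_fun_coordinate)
qed

lemma local_new_deriv: "local_fun \<Theta>' (X' j s)"
proof (cases s)
  case (Inl s')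
  then show ?thesis
    using old.local_coeff[of j "Inr s'"] by (simp add: new_deriv_old local_pullback_forget)
next
  case (Inr t)
  obtain \<alpha> J where t: "t = (\<alpha>, J)" by force
  show ?thesis
  proof (cases "j \<in> {p, q}")
    case True
    then have "X' j s = multi_deriv (cov_deriv shift_deriv) (drop_pq J) (solved j \<alpha>)"
      using Inr t by (auto simp: new_deriv_def fun_eq_iff)
    then show ?thesis
      using multi_deriv_local[OF derivations_cov_deriv[OF open_new_domain local_shift_deriv] local_solved]
      by simp
  qed (use Inr t in \<open>simp add: new_deriv_shift local_fun_coordinate\<close>)
qed

sublocale new: tangent_derivations \<Theta>' "cov_coeff X'" "cov_deriv X'" S'
  by (rule tangent_cov_deriv[OF sys open_new_domain new_over local_new_deriv])

lemma covering_point_new: "z \<in> \<Theta>' \<Longrightarrow> covering_point \<Omega> \<Theta>' X' z"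
  by unfold_locales (use sys(1) open_new_domain new_over local_new_deriv in blast)+

lemma new_deriv_pullback:
  assumes "local_fun \<Theta> f" "z \<in> \<Theta>'"
  shows "cov_deriv X' j (\<lambda>z. f (cov_forget z)) z = cov_deriv X j f (cov_forget z)"
  unfolding cov_forget_def
proof (rule derivations_pullback[OF old.derivations_axioms new.derivations_axioms inj_map_sum_Inl _ _ assms])
  show "z \<circ> map_sum id Inl \<in> \<Theta>" if "z \<in> \<Theta>'" for z
    using new_forget[OF that] by (simp only: cov_forget_def)
  show "cov_coeff X' j (map_sum id Inl c) z = cov_coeff X j c (z \<circ> map_sum id Inl)" for z c
  proof (cases c)
    case (Inl c')
    have "z \<circ> map_sum id Inl \<circ> Inl = z \<circ> Inl"
      by (auto simp: fun_eq_iff)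
    then show ?thesis
      unfolding Inl by (simp only: map_sum.simps id_apply cov_coeff_simps)
  next
    case (Inr s)
    then show ?thesis
      by (simp add: new_deriv_old cov_forget_def)
  qed
qed

lemma new_scalar_op_pullback:
  assumes "\<And>b. local_fun \<Theta> (V b)" "z \<in> \<Theta>'"
  shows "cov_scalar_op X' P (\<lambda>b z. V b (cov_forget z)) \<alpha> z = cov_scalar_op X P V \<alpha> (cov_forget z)"
  unfolding apply_scalar_op_def cov_forget_Inl by (simp only: new_deriv_pullback[OF assms])

section \<open>Commutation of the total derivatives on the adjoined covering\<close>

lemma new_Sol_subset: "z \<in> S' \<Longrightarrow> z \<in> \<Theta>'"
  by (simp add: cov_Sol_def)

lemma forget_Sol: "z \<in> S' \<Longrightarrow> cov_forget z \<in> S"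
  using new_forget[of z] unfolding cov_Sol_def mem_Collect_eq cov_forget_Inl by blast

lemma new_coordinate: "z \<in> \<Theta>' \<Longrightarrow> cov_deriv X' j (\<lambda>z. z (new_coord \<alpha> J)) z = X' j (Inr (\<alpha>, J)) z"
  by (simp add: new.D_coordinate)

text \<open>A commutator of vector fields is determined by its values on coordinates. On jet
  coordinates it vanishes by inspection and on the old nonlocal variables by commutation on the old
  covering, so only the adjoined variables are left.\<close>

lemma commuting_newI:
  assumes "\<And>\<alpha> J z. z \<in> S' \<Longrightarrow>
    cov_deriv X' i (X' j (Inr (\<alpha>, J))) z = cov_deriv X' j (X' i (Inr (\<alpha>, J))) z"
  shows "new.commuting i j"
  unfolding new.commuting_def
proof (intro allI impI)
  fix f z assume f: "local_fun \<Theta>' f" and z: "z \<in> S'"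
  show "cov_deriv X' i (cov_deriv X' j f) z = cov_deriv X' j (cov_deriv X' i f) z"
  proof (rule new.D_commute[OF f new_Sol_subset[OF z]])
    fix c
    show "cov_deriv X' i (cov_coeff X' j c) z = cov_deriv X' j (cov_coeff X' i c) z"
    proof (cases c)
      case (Inl c')
      show ?thesis
      proof (cases c')
        case (Indep k)
        then show ?thesis
          using Inl new.D_const[OF new_Sol_subset[OF z]] by simp
      next
        case (Dep \<alpha> J)
        have "cov_coeff X' k (Inl (Dep \<alpha> J)) = (\<lambda>z. z (Inl (Dep \<alpha> (raise k J))))" for k
          by (simp add: fun_eq_iff)
        then show ?thesis
          using new_Sol_subset[OF z] unfolding Inl Dep
          by (cases "i = j") (auto simp: new.D_coordinate fun_upd_twist)
      qed
    next
      case (Inr t)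
      show ?thesis
      proof (cases t)
        case (Inl s)
        have loc: "local_fun \<Theta> (X k s)" for k
          using old.local_coeff[of k "Inr s"] by simp
        have coord: "cov_deriv X k (\<lambda>y. y (Inr s)) y = X k s y" if "y \<in> \<Theta>" for k y
          using old.D_coordinate[OF that, of k "Inr s"] by simp
        have y: "cov_forget z \<in> S" "cov_forget z \<in> \<Theta>"
          using forget_Sol[OF z] new_forget[OF new_Sol_subset[OF z]] by auto
        \<comment> \<open>Since \<open>X k s\<close> is the derivative of the coordinate
          \<open>s\<close>, commutation on that coordinate is the identity sought.\<close>
        have "cov_deriv X i (cov_deriv X j (\<lambda>y. y (Inr s))) (cov_forget z) =
            cov_deriv X j (cov_deriv X i (\<lambda>y. y (Inr s))) (cov_forget z)"
          by (rule diff_covering_commute[OF cov local_fun_coordinate y(1)])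
        moreover have "cov_deriv X k (cov_deriv X l (\<lambda>y. y (Inr s))) (cov_forget z) =
            cov_deriv X k (X l s) (cov_forget z)" for k l
          by (rule old.D_cong[OF old.D_local[OF local_fun_coordinate] coord y(2)])
        ultimately show ?thesis
          unfolding Inr Inl cov_coeff_simps new_deriv_old
          by (simp only: new_deriv_pullback[OF loc new_Sol_subset[OF z]])
      next
        case (Inr u)
        then show ?thesis
          using \<open>c = Inr t\<close> assms[OF z] by (cases u) simp
      qed
    qed
  qed
qed

lemma commuting_shift:
  assumes "i \<notin> {p, q}" "j \<notin> {p, q}"
  shows "new.commuting i j"
proof (rule commuting_newI)
  fix \<alpha> J z assume "z \<in> S'"
  then have "z \<in> \<Theta>'"
    by (rule new_Sol_subset)
  then show "cov_deriv X' i (X' j (Inr (\<alpha>, J))) z = cov_deriv X' j (X' i (Inr (\<alpha>, J))) z"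
    using assms by (cases "i = j") (simp_all add: new_deriv_shift new_coordinate fun_upd_twist)
qed

lemma commuting_sym: "new.commuting i j \<Longrightarrow> new.commuting j i"
  unfolding new.commuting_def by (intro allI impI, rule HOL.sym, elim allE impE)

text \<open>Built into \<open>X'\<close>: row \<open>r\<close> on the variable with index
  \<open>raise j J\<close> is the D_j-derivative of row \<open>r\<close> on index \<open>J\<close>,
  up to reordering a word without \<open>p\<close> and \<open>q\<close>.\<close>

lemma commuting_solved_shift:
  assumes r: "r \<in> {p, q}" and j: "j \<notin> {p, q}"
  shows "new.commuting r j"
proof (rule commuting_newI)
  fix \<alpha> J z assume z: "z \<in> S'"
  have drop: "drop_pq (raise j J) = raise j (drop_pq J)"
    using j by (auto simp: fun_eq_iff)
  have "cov_deriv X' r (X' j (Inr (\<alpha>, J))) z = X' r (Inr (\<alpha>, raise j J)) z"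
    using j new_Sol_subset[OF z] by (simp add: new_deriv_shift new_coordinate)
  also have "\<dots> = multi_deriv (cov_deriv X') (raise j (drop_pq J)) (solved r \<alpha>) z"
    unfolding new_deriv_solved[OF r] drop ..
  also have "\<dots> = cov_deriv X' j (multi_deriv (cov_deriv X') (drop_pq J) (solved r \<alpha>)) z"
    by (rule multi_deriv_Suc[symmetric, OF new.tangent_derivations_axioms _ local_solved z])
       (use j in \<open>auto intro!: commuting_shift split: if_splits\<close>)
  finally show "cov_deriv X' r (X' j (Inr (\<alpha>, J))) z = cov_deriv X' j (X' r (Inr (\<alpha>, J))) z"
    unfolding new_deriv_solved[OF r] .
qed

definition new_symmetry where "new_symmetry \<alpha> = (\<lambda>z. z (new_coord \<alpha> (\<lambda>_. 0)))"

lemma local_new_symmetry: "local_fun \<Theta>' (new_symmetry \<alpha>)"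
  unfolding new_symmetry_def by (rule local_fun_coordinate)

lemma new_symmetry_deriv:
  "z \<in> \<Theta>' \<Longrightarrow> cov_deriv X' j (new_symmetry \<alpha>) z =
    (if j \<in> {p, q} then solved j \<alpha> z else z (new_coord \<alpha> (raise j (\<lambda>_. 0))))"
  unfolding new_symmetry_def by (auto simp: new_coordinate new_deriv_solved_zero new_deriv_shift)

text \<open>Cramer's rule is exact wherever \<open>det\<close> is nonzero, so the relations hold
  throughout \<open>\<Theta>'\<close>, not only over solutions.\<close>

lemma new_relation:
  assumes z: "z \<in> \<Theta>'" and AB: "(A, B) \<in> {(A1, B1), (A2, B2)}"
  shows "cov_scalar_op X' A new_symmetry \<alpha> z = cov_scalar_op X B U \<alpha> (cov_forget z)"
proof -
  have split: "(\<Sum>j\<in>UNIV. h j) = h p + h q + (\<Sum>j\<in>-{p, q}. h j)" for h :: "'d \<Rightarrow> complex"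
  proof -
    have "(\<Sum>j\<in>UNIV. h j) = (\<Sum>j\<in>{p, q}. h j) + (\<Sum>j\<in>UNIV - {p, q}. h j)"
      by (rule sum.subset_diff[THEN trans]) (auto simp: add.commute)
    then show ?thesis
      using pq by (simp add: Compl_eq_Diff_UNIV)
  qed
  have det: "det (z \<circ> Inl) \<noteq> 0"
    using z by (simp add: new_domain_def)
  have solve: "snd A p (z \<circ> Inl) * solved p \<alpha> z + snd A q (z \<circ> Inl) * solved q \<alpha> z = remainder A B \<alpha> z"
    using AB det pq unfolding solved_def
    by (auto simp: divide_simps) (auto simp: det_symbol_def algebra_simps)
  have "cov_scalar_op X' A new_symmetry \<alpha> z =
      (\<Sum>\<beta>\<in>UNIV. fst A \<alpha> \<beta> (z \<circ> Inl) * z (new_coord \<beta> (\<lambda>_. 0)))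
      + (remainder A B \<alpha> z
      + (\<Sum>j\<in>-{p, q}. snd A j (z \<circ> Inl) * z (new_coord \<alpha> (raise j (\<lambda>_. 0)))))"
    unfolding apply_scalar_op_def scalar_symbol_def split solve[symmetric] new_symmetry_deriv[OF z]
    by (simp add: new_symmetry_def)
  then show ?thesis
    by (simp add: remainder_def)
qed

lemma commuting_new_symmetry:
  assumes z: "z \<in> S'"
  shows "cov_deriv X' p (cov_deriv X' q (new_symmetry \<alpha>)) z = cov_deriv X' q (cov_deriv X' p (new_symmetry \<alpha>)) z"
proof -
  let ?e = "\<lambda>i j. cov_deriv X' i (cov_deriv X' j (new_symmetry \<alpha>)) z - cov_deriv X' j (cov_deriv X' i (new_symmetry \<alpha>)) z"
  let ?a = "\<lambda>i j. snd A1 i (z \<circ> Inl) * snd A2 j (z \<circ> Inl) * ?e i j"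
  have op_local: "local_fun \<Theta>' (cov_scalar_op X' P V \<alpha>)"
    if "local_scalar_op \<Omega> P" "\<And>b. local_fun \<Theta>' (V b)" for P :: "('d, 'n) scalar_op" and V \<alpha>
    by (rule local_fun_apply_scalar_op[OF new.derivations_axioms local_pullback_base that])
  \<comment> \<open>By the relations, second-order expressions in the new unknown become pullbacks
    of expressions in \<open>U\<close>, and the integrability condition on the old covering
    applies.\<close>
  have step: "cov_scalar_op X' P (cov_scalar_op X' A new_symmetry) \<alpha> z =
      cov_scalar_op X P (cov_scalar_op X B U) \<alpha> (cov_forget z)"
    if AB: "(A, B) \<in> {(A1, B1), (A2, B2)}" for P A B
  proof -
    have loc: "local_scalar_op \<Omega> A" "local_scalar_op \<Omega> B"
      using AB ops by auto
    have "cov_scalar_op X' P (cov_scalar_op X' A new_symmetry) \<alpha> z =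
        cov_scalar_op X' P (\<lambda>b z. cov_scalar_op X B U b (cov_forget z)) \<alpha> z"
      by (intro apply_scalar_op_cong_S[OF new.tangent_derivations_axioms _ _ _ z] op_local loc
          local_new_symmetry local_pullback_forget local_old_scalar_op U_local new_relation[OF new_Sol_subset AB])
    then show ?thesis
      using new_scalar_op_pullback[OF local_old_scalar_op[OF loc(2) U_local] new_Sol_subset[OF z]] by simp
  qed
  have "(\<Sum>i\<in>UNIV. \<Sum>j\<in>UNIV. ?a i j) =
      cov_scalar_op X' A1 (cov_scalar_op X' A2 new_symmetry) \<alpha> z -
      cov_scalar_op X' A2 (cov_scalar_op X' A1 new_symmetry) \<alpha> z"
    by (rule covering_point.commutator_defect[symmetric, OF covering_point_new[OF new_Sol_subset[OF z]]
          ops(1,2) local_new_symmetry A_comm])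
       (use z in \<open>unfold cov_Sol_def, blast\<close>)
  also have "\<dots> = 0"
    using symmetry_compatibility[OF sys ops L_eq cov sym forget_Sol[OF z], of \<alpha>]
      step[of A2 B2 A1] step[of A1 B1 A2] by simp
  finally have sum0: "(\<Sum>i\<in>UNIV. \<Sum>j\<in>UNIV. ?a i j) = 0" .
  \<comment> \<open>All other commutators are already known to vanish; by antisymmetry the two
    remaining terms combine to \<open>det\<close> times the commutator of D_p and D_q.\<close>
  have zero: "?e i j = 0" if "(i, j) \<notin> {(p, q), (q, p)}" for i j
  proof -
    have "i = j \<or> new.commuting i j"
      using that commuting_shift[of i j] commuting_solved_shift[of i j]
        commuting_sym[OF commuting_solved_shift[of j i]] by auto
    then show ?thesis
      using z local_new_symmetry unfolding new.commuting_def by auto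
  qed
  have "(\<Sum>i\<in>UNIV. \<Sum>j\<in>UNIV. ?a i j) = (\<Sum>x\<in>UNIV. ?a (fst x) (snd x))"
    by (simp add: sum.cartesian_product case_prod_unfold)
  also have "\<dots> = (\<Sum>x\<in>{(p, q), (q, p)}. ?a (fst x) (snd x))"
  proof (rule sum.mono_neutral_right)
    show "\<forall>x\<in>UNIV - {(p, q), (q, p)}. ?a (fst x) (snd x) = 0"
    proof
      fix x assume "x \<in> UNIV - {(p, q), (q, p)}"
      then have "?e (fst x) (snd x) = 0"
        by (intro zero) simp
      then show "?a (fst x) (snd x) = 0"
        by (simp only: mult_zero_right)
    qed
  qed auto
  also have "\<dots> = det (z \<circ> Inl) * ?e p q"
    using pq by (simp add: det_symbol_def algebra_simps)
  finally have "det (z \<circ> Inl) * ?e p q = 0"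
    using sum0 by simp
  then show ?thesis
    using new_Sol_subset[OF z] by (simp add: new_domain_def)
qed

text \<open>For the variable with index \<open>J\<close>, both D_p and D_q are moved inside the word
  of \<open>drop_pq J\<close>, which reduces the claim to the new unknown itself. That case is known
  on \<open>S'\<close> only, so tangency is used to differentiate it along the word.\<close>

lemma commuting_pq: "new.commuting p q"
proof (rule commuting_newI)
  fix \<alpha> J z assume z: "z \<in> S'"
  let ?js = "multi_list (drop_pq J)"
  have js: "new.commuting r j" if "j \<in> set ?js" "r \<in> {p, q}" for j r
    using that set_multi_list_drop[of J] by (intro commuting_solved_shift) auto
  have solved: "cov_deriv X' r (new_symmetry \<alpha>) y = solved r \<alpha> y" if "r \<in> {p, q}" "y \<in> \<Theta>'" for r y
    using that by (simp add: new_symmetry_deriv)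
  have solved_eq: "cov_deriv X' r (cov_deriv X' t (new_symmetry \<alpha>)) y = cov_deriv X' r (solved t \<alpha>) y"
    if "t \<in> {p, q}" "y \<in> S'" for r t y
    by (rule new.D_cong[OF new.D_local[OF local_new_symmetry] solved new_Sol_subset]) (use that in auto)
  have "cov_deriv X' p (foldr (cov_deriv X') ?js (solved q \<alpha>)) z =
      foldr (cov_deriv X') ?js (cov_deriv X' p (solved q \<alpha>)) z"
    by (rule new.commuting_foldr[OF js local_solved z]) auto
  also have "\<dots> = foldr (cov_deriv X') ?js (cov_deriv X' q (solved p \<alpha>)) z"
  proof (intro new.foldr_D_cong_S[OF _ _ _ z] new.D_local local_solved)
    fix y assume y: "y \<in> S'"
    show "cov_deriv X' p (solved q \<alpha>) y = cov_deriv X' q (solved p \<alpha>) y"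
      using commuting_new_symmetry[OF y, of \<alpha>] solved_eq[OF _ y, of q p] solved_eq[OF _ y, of p q] by simp
  qed
  also have "\<dots> = cov_deriv X' q (foldr (cov_deriv X') ?js (solved p \<alpha>)) z"
    by (rule new.commuting_foldr[symmetric, OF js local_solved z]) auto
  finally show "cov_deriv X' p (X' q (Inr (\<alpha>, J))) z = cov_deriv X' q (X' p (Inr (\<alpha>, J))) z"
    by (simp add: new_deriv_solved multi_deriv_foldr)
qed

section \<open>The adjoined covering and the relations on it\<close>

lemma diff_covering_new: "diff_covering \<Omega> F \<Theta>' X'"
proof -
  have "new.commuting i i" for i
    by (simp add: new.commuting_def)
  then have "new.commuting i j" for i j
    using commuting_shift[of i j] commuting_solved_shift[of i j] commuting_sym[OF commuting_solved_shift[of j i]]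
      commuting_pq commuting_sym[OF commuting_pq] by blast
  then show ?thesis
    unfolding diff_covering_def new.commuting_def
    using open_new_domain new_over local_new_deriv by blast
qed

lemma extends_covering_new: "extends_covering \<Omega> F \<Theta> X \<Theta>' X'"
  unfolding extends_covering_def
proof (intro conjI ballI allI)
  show "cov_forget ` S' = S"
  proof
    show "S \<subseteq> cov_forget ` S'"
    proof
      fix y assume y: "y \<in> S"
      \<comment> \<open>The adjoined variables are unconstrained, so 0 is as good as any value; the
        condition on \<open>det\<close> concerns the base point alone.\<close>
      define z :: "('d, 'n, 'w + ('n \<times> ('d \<Rightarrow> nat))) cov_point" where
        "z = case_sum (y \<circ> Inl) (case_sum (y \<circ> Inr) (\<lambda>_. 0))"
      have forget: "cov_forget z = y"
        by (rule ext) (auto simp: cov_forget_def z_def map_sum_def split: sum.split)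
      have Inl: "z \<circ> Inl = y \<circ> Inl"
        by (simp add: z_def fun_eq_iff)
      have "y \<in> \<Theta>" "y \<circ> Inl \<in> Sol \<Omega> F"
        using y unfolding cov_Sol_def by blast+
      then have "z \<in> S'"
        using det_nonzero unfolding cov_Sol_def new_domain_def mem_Collect_eq Inl forget by blast
      then show "y \<in> cov_forget ` S'"
        using forget by blast
    qed
  qed (use forget_Sol in blast)
qed (use new_forget in \<open>auto simp: new_deriv_old\<close>)

lemma related_new: "related \<Omega> F A1 A2 B1 B2 \<Theta>' X' (\<lambda>\<alpha> z. U \<alpha> (cov_forget z)) new_symmetry"
  unfolding related_def Let_def
proof (intro ballI allI conjI)
  fix z \<alpha> assume "z \<in> S'"
  then have z: "z \<in> \<Theta>'"
    by (rule new_Sol_subset)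
  show "cov_scalar_op X' A1 new_symmetry \<alpha> z = cov_scalar_op X' B1 (\<lambda>\<alpha> z. U \<alpha> (cov_forget z)) \<alpha> z"
    "cov_scalar_op X' A2 new_symmetry \<alpha> z = cov_scalar_op X' B2 (\<lambda>\<alpha> z. U \<alpha> (cov_forget z)) \<alpha> z"
    using new_relation[OF z, of A1 B1] new_relation[OF z, of A2 B2] new_scalar_op_pullback[OF U_local z]
    by simp_all
qed

end

theorem proposition1:
  fixes \<Omega> :: "('d::{finite,linorder}, 'n::finite) jet set"
    and F :: "'m::finite \<Rightarrow> ('d, 'n) jet \<Rightarrow> complex"
    and A1 A2 B1 B2 :: "('d, 'n) scalar_op"
    and L :: "('d, 'n, 'n, 'm) matrix_op"
    and M :: "('d, 'n, 'm, 'n) matrix_op"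
  assumes "open \<Omega>"
    and "\<And>I. local_fun \<Omega> (F I)"
    and "regular_system \<Omega> F"
    and "local_scalar_op \<Omega> A1" and "local_scalar_op \<Omega> A2"
    and "local_scalar_op \<Omega> B1" and "local_scalar_op \<Omega> B2"
    and "local_matrix_op \<Omega> L" and "local_matrix_op \<Omega> M"
    and i: "op_eq_on \<Omega> (Sol \<Omega> F) (\<lbrakk>A1\<rbrakk>\<^sub>s \<circ> \<lbrakk>A2\<rbrakk>\<^sub>s \<ominus>\<^sub>o \<lbrakk>A2\<rbrakk>\<^sub>s \<circ> \<lbrakk>A1\<rbrakk>\<^sub>s) op_zero"
    and ii: "op_eq_on \<Omega> (Sol \<Omega> F) (\<lbrakk>B1\<rbrakk>\<^sub>s \<circ> \<lbrakk>B2\<rbrakk>\<^sub>s \<ominus>\<^sub>o \<lbrakk>B2\<rbrakk>\<^sub>s \<circ> \<lbrakk>B1\<rbrakk>\<^sub>s) op_zero"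
    and iii: "op_eq_on \<Omega> (Sol \<Omega> F) (\<lbrakk>A1\<rbrakk>\<^sub>s \<circ> \<lbrakk>B2\<rbrakk>\<^sub>s \<ominus>\<^sub>o \<lbrakk>A2\<rbrakk>\<^sub>s \<circ> \<lbrakk>B1\<rbrakk>\<^sub>s) (\<lbrakk>L\<rbrakk>\<^sub>m \<circ> \<ell> F)"
    and iv: "op_eq_on \<Omega> (Sol \<Omega> F) (\<ell> F) (\<lbrakk>M\<rbrakk>\<^sub>m \<circ> (\<lbrakk>B1\<rbrakk>\<^sub>s \<circ> \<lbrakk>A2\<rbrakk>\<^sub>s \<ominus>\<^sub>o \<lbrakk>B2\<rbrakk>\<^sub>s \<circ> \<lbrakk>A1\<rbrakk>\<^sub>s))"
    and v: "\<exists>p q. p \<noteq> q \<and> expressible (Sol \<Omega> F) A1 A2 B1 B2 p q"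
  shows "recursion_operator TYPE('w) \<Omega> F A1 A2 B1 B2"
  unfolding recursion_operator_def
proof (intro allI impI conjI, goal_cases)
  case (1 \<Theta> X U U')
  then show ?case
    by (intro related_nonlocal_symmetry[where U = U, OF assms(1-7,9) ii iv])
       (simp_all add: nonlocal_symmetry_def)
next
  case (2 \<Theta> X U)
  obtain p q where pq: "p \<noteq> q" "expressible (Sol \<Omega> F) A1 A2 B1 B2 p q"
    using v by blast
  interpret adjoined_covering \<Omega> F A1 A2 B1 B2 L p q \<Theta> X U
    by unfold_locales
       (use assms(1-8) i iii 2 pq(1) expressible_det_nonzero[OF pq(2,1)] in auto)
  \<comment> \<open>The argument of the first clause, now on the adjoined covering and for the
    pullback of \<open>U\<close>.\<close>
  have "nonlocal_symmetry \<Omega> F new_domain new_deriv new_symmetry"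
    by (rule related_nonlocal_symmetry[OF assms(1-7,9) ii iv diff_covering_new
          local_pullback_forget[OF U_local] local_new_symmetry related_new])
  then show ?case
    using diff_covering_new extends_covering_new related_new by (auto simp: comp_def)
qed

end
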